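(* Suppose that the Lévy measure $\nu$ of $X$ has a completely monotone density. Then the function $$h_p(b)=\Phi_K(q)\int_0^\infty e^{-\Phi_K(q)y}Z_{q,p}'(b+y)\,\mathrm{d}y,\quad b\ge0,$$ is a nonnegative, infinitely differentiable and strictly convex function on $(0,\infty)$ such that $h_p(\infty):=\lim_{b\to\infty}h_p(b)=\infty$. In particular, a minimizer of $h_p$ over $[0,\infty)$ exists and is unique.
   Context: $X=\{X_t:t\ge 0\}$ is a spectrally negative Lévy process (a Lévy process with no positive jumps) with Lévy triplet $(\gamma,\sigma,\nu)$, $\gamma\in\mathbb{R}$, $\sigma\ge0$, where $\nu$ is a measure on $(0,\infty)$ with $\int_{(0,\infty)}(1\wedge z^2)\nu(\mathrm{d}z)<\infty$. Its Laplace exponent is $\psi(\lambda)=\gamma\lambda+\frac12\sigma^2\lambda^2-\int_{(0,\infty)}(1-e^{-\lambda z}-\lambda z\mathbf{1}_{\{0<z\le1\}})\nu(\mathrm{d}z)$, $\lambda\ge0$; it is understood that $\psi$ is strictly convex with $\psi(\infty)=\infty$; $\Phi(r)=\sup\{\lambda\ge0:\psi(\lambda)=r\}$. $X$ has paths of bounded variation (BV) iff $\sigma=0$ and $\int_0^1 z\,\nu(\mathrm{d}z)<\infty$, and then $X_t=ct-S_t$ with $c:=\gamma+\int_0^1z\,\nu(\mathrm{d}z)>0$ and $S$ a driftless subordinator. Constants $p,q,K>0$ are fixed. Standing assumption: if $X$ has paths of BV, then $K\in(0,c)$. Let $\psi_K(\lambda)=\psi(\lambda)-K\lambda$ (the Laplace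 exponent of $Y_t=X_t-Kt$) and $\Phi_K(r)=\sup\{\lambda\ge0:\psi_K(\lambda)=r\}$. A function $f$ is completely monotone if $(-1)^nf^{(n)}\ge0$ for all $n\ge0$; "$\nu$ has a completely monotone density" means $\nu(\mathrm{d}z)=f(z)\mathrm{d}z$ on $(0,\infty)$ with $f$ completely monotone on $(0,\infty)$. $W^{(q)}$ is the continuous function on $[0,\infty)$ with $\int_0^\infty e^{-\theta y}W^{(q)}(y)\mathrm{d}y=1/(\psi(\theta)-q)$ for $\theta>\Phi(q)$, extended by $W^{(q)}(x)=0$ for $x<0$. Set $Z_{q,p}(x)=e^{\Phi(p+q)x}\left(1-p\int_0^xe^{-\Phi(p+q)y}W^{(q)}(y)\mathrm{d}y\right)$, $x\in\mathbb{R}$. *)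

theory Defs
  imports "HOL-Probability.Probability"
begin

section \<open>Classes of real functions\<close>

definition infinitely_differentiable_on :: "real set \<Rightarrow> (real \<Rightarrow> real) \<Rightarrow> bool" where
  "infinitely_differentiable_on S f \<longleftrightarrow>
     (\<forall>n. \<forall>x\<in>S. (deriv ^^ n) f field_differentiable (at x))"

definition completely_monotone_on :: "real set \<Rightarrow> (real \<Rightarrow> real) \<Rightarrow> bool" where
  "completely_monotone_on S f \<longleftrightarrow>
     infinitely_differentiable_on S f \<and> (\<forall>n. \<forall>x\<in>S. 0 \<le> (-1) ^ n * (deriv ^^ n) f x)"

definition strictly_convex_on :: "real set \<Rightarrow> (real \<Rightarrow> real) \<Rightarrow> bool" where
  "strictly_convex_on S f \<longleftrightarrow> convex S \<and>
     (\<forall>x\<in>S. \<forall>y\<in>S. \<forall>u\<in>{0<..<1}. x \<noteq> y \<longrightarrow>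
        f ((1 - u) * x + u * y) < (1 - u) * f x + u * f y)"

definition bounded_variation_on :: "real \<Rightarrow> real \<Rightarrow> (real \<Rightarrow> real) \<Rightarrow> bool" where
  "bounded_variation_on a b f \<longleftrightarrow>
     (\<exists>B. \<forall>(n::nat) t. mono_on {..n} t \<longrightarrow> t ` {..n} \<subseteq> {a..b} \<longrightarrow>
        (\<Sum>i<n. \<bar>f (t (Suc i)) - f (t i)\<bar>) \<le> B)"


section \<open>Spectrally negative Levy processes\<close>

text \<open>The time parameter is a real number; only times \<open>t \<ge> 0\<close> matter.\<close>

locale levy_process = prob_space M for M :: "'a measure" +
  fixes X :: "real \<Rightarrow> 'a \<Rightarrow> real"
  assumes measurable_X: "\<And>t. 0 \<le> t \<Longrightarrow> random_variable borel (X t)"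
    and starts_at_0: "AE \<omega> in M. X 0 \<omega> = 0"
    and independent_increments:
      "\<And>(n::nat) t. 0 \<le> t 0 \<Longrightarrow> mono_on {..n} t \<Longrightarrow>
         indep_vars (\<lambda>_. borel) (\<lambda>i \<omega>. X (t (Suc i)) \<omega> - X (t i) \<omega>) {..<n}"
    and stationary_increments:
      "\<And>s t. 0 \<le> s \<Longrightarrow> 0 \<le> t \<Longrightarrow>
         distr M borel (\<lambda>\<omega>. X (s + t) \<omega> - X s \<omega>) = distr M borel (X t)"
    and cadlag_paths:
      "AE \<omega> in M. (\<forall>t\<ge>0. continuous (at_right t) (\<lambda>s. X s \<omega>)) \<and>
                  (\<forall>t>0. \<exists>l. ((\<lambda>s. X s \<omega>) \<longlongrightarrow> l) (at_left t))"

locale spectrally_negative_levy_process = levy_process +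
  assumes no_positive_jumps:
      "AE \<omega> in M. \<forall>t>0. \<forall>l. ((\<lambda>s. X s \<omega>) \<longlongrightarrow> l) (at_left t) \<longrightarrow> X t \<omega> - l \<le> 0"

definition has_bounded_variation_paths :: "'a measure \<Rightarrow> (real \<Rightarrow> 'a \<Rightarrow> real) \<Rightarrow> bool" where
  "has_bounded_variation_paths M X \<longleftrightarrow>
     (AE \<omega> in M. \<forall>T\<ge>0. bounded_variation_on 0 T (\<lambda>t. X t \<omega>))"

text \<open>A measure on \<open>(0,\<infinity>)\<close> is represented as a Borel measure on the real line that gives
  no mass to \<open>(-\<infinity>,0]\<close>; it describes the sizes of the (downward) jumps.\<close>

definition levy_measure :: "real measure \<Rightarrow> bool" where
  "levy_measure \<nu> \<longleftrightarrow> sets \<nu> = sets borel \<and> emeasure \<nu> {..0} = 0 \<and>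
     (\<integral>\<^sup>+z\<in>{0<..}. ennreal (min 1 (z\<^sup>2)) \<partial>\<nu>) < \<infinity>"

definition has_completely_monotone_density :: "real measure \<Rightarrow> bool" where
  "has_completely_monotone_density \<nu> \<longleftrightarrow>
     (\<exists>f. completely_monotone_on {0<..} f \<and>
          \<nu> = density lborel (\<lambda>z. ennreal (f z) * indicator {0<..} z))"

definition laplace_exponent :: "real \<Rightarrow> real \<Rightarrow> real measure \<Rightarrow> real \<Rightarrow> real" where
  "laplace_exponent \<gamma> \<sigma> \<nu> \<theta> = \<gamma> * \<theta> + \<sigma>\<^sup>2 * \<theta>\<^sup>2 / 2 -
     (LINT z:{0<..}|\<nu>. 1 - exp (- \<theta> * z) - \<theta> * z * indicator {0<..1} z)"

text \<open>Since there are no positive jumps, the law of the process is determined by the moment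
  generating function on the nonnegative half-line, which identifies the triplet.\<close>

definition has_levy_triplet ::
    "'a measure \<Rightarrow> (real \<Rightarrow> 'a \<Rightarrow> real) \<Rightarrow> real \<Rightarrow> real \<Rightarrow> real measure \<Rightarrow> bool" where
  "has_levy_triplet M X \<gamma> \<sigma> \<nu> \<longleftrightarrow> 0 \<le> \<sigma> \<and> levy_measure \<nu> \<and>
     (\<forall>t\<ge>0. \<forall>\<theta>\<ge>0. integrable M (\<lambda>\<omega>. exp (\<theta> * X t \<omega>)) \<and>
        (LINT \<omega>|M. exp (\<theta> * X t \<omega>)) = exp (t * laplace_exponent \<gamma> \<sigma> \<nu> \<theta>))"

text \<open>The linear drift coefficient \<open>c\<close>; it is meaningful only if the paths have bounded
  variation, i.e. if the integral converges.\<close>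

definition bv_drift :: "real \<Rightarrow> real measure \<Rightarrow> real" where
  "bv_drift \<gamma> \<nu> = \<gamma> + (LINT z:{0<..1}|\<nu>. z)"


section \<open>Scale functions and the function \<open>h\<^sub>p\<close>\<close>

definition right_inverse :: "(real \<Rightarrow> real) \<Rightarrow> real \<Rightarrow> real" where
  "right_inverse \<psi> r = Sup {\<theta>. 0 \<le> \<theta> \<and> \<psi> \<theta> = r}"

text \<open>These properties determine \<open>W\<close> uniquely.\<close>

definition is_scale_function :: "(real \<Rightarrow> real) \<Rightarrow> real \<Rightarrow> (real \<Rightarrow> real) \<Rightarrow> bool" where
  "is_scale_function \<psi> q W \<longleftrightarrow>
     continuous_on {0..} W \<and> (\<forall>x<0. W x = 0) \<and>
     (\<forall>\<theta>>right_inverse \<psi> q.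
        set_integrable lborel {0..} (\<lambda>y. exp (- \<theta> * y) * W y) \<and>
        (LBINT y:{0..}. exp (- \<theta> * y) * W y) = 1 / (\<psi> \<theta> - q))"

text \<open>\<open>W\<close> vanishes on the negative half-line, so for \<open>x < 0\<close> the integral is \<open>0\<close>, in accordance
  with the empty domain of integration below.\<close>

definition Z_fun :: "(real \<Rightarrow> real) \<Rightarrow> (real \<Rightarrow> real) \<Rightarrow> real \<Rightarrow> real \<Rightarrow> real \<Rightarrow> real" where
  "Z_fun \<psi> W q p x =
     (let \<Phi> = right_inverse \<psi> (p + q)
      in exp (\<Phi> * x) * (1 - p * (LBINT y:{0..x}. exp (- \<Phi> * y) * W y)))"

text \<open>\<open>\<kappa>\<close> stands for \<open>\<Phi>\<^sub>K(q)\<close>. The endpoint \<open>y = 0\<close> is left out because \<open>Z\<close> need not be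
  differentiable at \<open>0\<close>.\<close>

definition h_integrand ::
    "(real \<Rightarrow> real) \<Rightarrow> (real \<Rightarrow> real) \<Rightarrow> real \<Rightarrow> real \<Rightarrow> real \<Rightarrow> real \<Rightarrow> real \<Rightarrow> real" where
  "h_integrand \<psi> W q p \<kappa> b y = exp (- \<kappa> * y) * deriv (Z_fun \<psi> W q p) (b + y)"

definition h_fun ::
    "(real \<Rightarrow> real) \<Rightarrow> (real \<Rightarrow> real) \<Rightarrow> real \<Rightarrow> real \<Rightarrow> real \<Rightarrow> real \<Rightarrow> real" where
  "h_fun \<psi> W K q p b =
     (let \<kappa> = right_inverse (\<lambda>\<theta>. \<psi> \<theta> - K * \<theta>) q
      in \<kappa> * (LBINT y:{0<..}. h_integrand \<psi> W q p \<kappa> b y))"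

end

theory Submission
  imports Defs
begin

text \<open>Let \<open>l = \<Phi>(q)\<close>. If the Levy density is a finite sum of exponentials, then
  \<open>(\<psi>(x) - q) / (x - l)\<close> has the form \<open>a + b * x - (\<Sum>k. w k / (x + t k))\<close> with positive \<open>w k\<close> and
  \<open>t k\<close>; its zeros are real, simple and negative, so its reciprocal is a sum of partial fractions
  with nonnegative weights. A completely monotone density is a limit of such sums (Hausdorff moment
  approximation), and Helly's theorem carries the representation of the reciprocal to the limit:
  \<open>1 / (\<psi>(x) - q) = A / (x - l) - (\<integral> 1 / (x + t) \<mu>(dt))\<close> with a finite measure \<open>\<mu>\<close> on \<open>[0, \<infinity>)\<close>.
  By uniqueness of Laplace transforms, \<open>W(x) = A * exp (l * x) - (\<integral> exp (- t * x) \<mu>(dt))\<close>, and therefore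
  \<open>h(b) = D * exp (l * b) + (\<integral> exp (- t * b) w(t) \<mu>(dt))\<close> with \<open>D > 0\<close> and a bounded weight \<open>w \<ge> 0\<close>.\<close>

section \<open>Partial fractions of reciprocals of rational functions\<close>

text \<open>The pole of \<open>1 / (\<psi>(x) - q)\<close> at \<open>l > 0\<close> rules out a plain
  Stieltjes representation, so the factor \<open>x - l\<close> is divided out first. For exponential
  sums the quotient grows only linearly, and its value at 0 is \<open>q / l\<close> because
  \<open>\<psi>(0) = 0\<close>: it is \<open>q > 0\<close> that pushes all its zeros below 0. The
  partial fraction weights are reciprocals of derivatives at these zeros, and they are nonnegative
  because the function increases between its poles. Reattaching \<open>1 / (x - l)\<close> gives the
  mixture in \<open>W\<close> its minus sign. This sign persists in \<open>Z\<close>, and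
  differentiating \<open>exp (- t * x)\<close> turns it into a plus sign in \<open>h\<close>, so
  \<open>h\<close> is a sum of convex functions; strictness and growth come from
  \<open>exp (l * b)\<close> alone. The integral in \<open>h\<close> converges because
  \<open>\<Phi>\<^sub>K(q) > l\<close>, a consequence of \<open>K > 0\<close> once
  \<open>\<Phi>\<^sub>K(q)\<close> is known to be a genuine root. That it is one is the only point
  where the paths of \<open>X\<close> matter: if \<open>\<psi>\<close> stayed below a line of slope
  \<open>K\<close>, the paths would have bounded variation with drift at most
  \<open>K\<close>.\<close>

definition pole_sum :: "real \<Rightarrow> real \<Rightarrow> (real \<Rightarrow> real) \<Rightarrow> real set \<Rightarrow> real \<Rightarrow> real" where
  "pole_sum a b w P x = a + b * x - (\<Sum>p\<in>P. w p / (x - p))"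

text \<open>The second factor is the divided difference. With positive weights and positive
  \<open>b\<close> it is positive whenever \<open>x\<close> and \<open>y\<close> lie on the same
  side of every pole, so the function increases on each gap between poles. At \<open>y = x\<close>
  the factor is the derivative.\<close>

lemma pole_sum_diff:
  assumes "x \<notin> P" "y \<notin> P"
  shows "pole_sum a b w P y - pole_sum a b w P x =
         (y - x) * (b + (\<Sum>p\<in>P. w p / ((y - p) * (x - p))))"
proof -
  have "(\<Sum>p\<in>P. w p / (x - p)) - (\<Sum>p\<in>P. w p / (y - p))
        = (\<Sum>p\<in>P. (y - x) * (w p / ((y - p) * (x - p))))"
    unfolding sum_subtractf[symmetric]
  proof (rule sum.cong)
    fix p assume "p \<in> P"
    with assms have "x - p \<noteq> 0" "y - p \<noteq> 0" by auto
    then show "w p / (x - p) - w p / (y - p) = (y - x) * (w p / ((y - p) * (x - p)))"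
      by (simp add: divide_simps) (simp add: algebra_simps)
  qed simp
  then show ?thesis
    by (simp add: pole_sum_def algebra_simps sum_distrib_left sum_distrib_right)
qed

lemma isCont_pole_sum:
  assumes "finite P" "x \<notin> P"
  shows "isCont (pole_sum a b w P) x"
  unfolding pole_sum_def [abs_def] using assms
  by (intro continuous_intros) auto

lemma pole_sum_split:
  assumes "finite P" "p \<in> P"
  shows "pole_sum a b w P = (\<lambda>x. pole_sum a b w (P - {p}) x + w p * (- inverse (x - p)))"
  using assms by (auto simp: pole_sum_def sum.remove[of P p] divide_inverse)

lemma pole_sum_at_right_pole:
  assumes "finite P" "p \<in> P" "0 < w p"
  shows "filterlim (pole_sum a b w P) at_bot (at_right p)"
proof -
  have "isCont (pole_sum a b w (P - {p})) p"
    using assms by (intro isCont_pole_sum) auto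
  then have 1: "(pole_sum a b w (P - {p}) \<longlongrightarrow> pole_sum a b w (P - {p}) p) (at_right p)"
    by (metis filterlim_at_split isCont_def)
  have "filterlim (\<lambda>x. inverse (x - p)) at_top (at_right p)"
    by (rule filterlim_compose[OF filterlim_inverse_at_top_right])
       (simp add: filterlim_at_right_to_0[of _ _ p] filterlim_ident)
  then have "filterlim (\<lambda>x. - inverse (x - p)) at_bot (at_right p)"
    by (simp add: filterlim_uminus_at_bot)
  then have "filterlim (\<lambda>x. w p * (- inverse (x - p))) at_bot (at_right p)"
    by (rule filterlim_tendsto_pos_mult_at_bot[OF tendsto_const \<open>0 < w p\<close>])
  then have "filterlim (\<lambda>x. - (- pole_sum a b w (P - {p}) x + - (w p * (- inverse (x - p))))) at_bot (at_right p)"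
    using filterlim_tendsto_add_at_top[OF tendsto_minus[OF 1]]
    unfolding filterlim_uminus_at_bot by (simp only: minus_minus)
  then show ?thesis
    by (simp add: pole_sum_split[OF assms(1,2)])
qed

lemma pole_sum_at_left_pole:
  assumes "finite P" "p \<in> P" "0 < w p"
  shows "filterlim (pole_sum a b w P) at_top (at_left p)"
proof -
  have "isCont (pole_sum a b w (P - {p})) p"
    using assms by (intro isCont_pole_sum) auto
  then have 1: "(pole_sum a b w (P - {p}) \<longlongrightarrow> pole_sum a b w (P - {p}) p) (at_left p)"
    by (metis filterlim_at_split isCont_def)
  have "filterlim (\<lambda>x. inverse (x - p)) at_bot (at_left p)"
    by (rule filterlim_compose[OF filterlim_inverse_at_bot_neg])
       (auto simp: filterlim_at eventually_at_filter intro!: tendsto_eq_intros)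
  then have "filterlim (\<lambda>x. - inverse (x - p)) at_top (at_left p)"
    by (simp add: filterlim_uminus_at_top)
  then have "filterlim (\<lambda>x. w p * (- inverse (x - p))) at_top (at_left p)"
    by (rule filterlim_tendsto_pos_mult_at_top[OF tendsto_const \<open>0 < w p\<close>])
  from filterlim_tendsto_add_at_top[OF 1 this] show ?thesis
    by (simp add: pole_sum_split[OF assms(1,2)])
qed

text \<open>Going left from \<open>y\<close> within its gap, the function becomes negative: it tends
  to minus infinity at the nearest pole, or falls at least linearly if there is none. That no pole
  lies between \<open>r\<close> and \<open>y\<close> is what later keeps roots from different gaps
  apart.\<close>

lemma pole_sum_root_left:
  assumes fin: "finite P" and w: "\<And>p. p \<in> P \<Longrightarrow> 0 < w p" and b: "0 < b"
    and y: "y \<notin> P" "0 < pole_sum a b w P y"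
  shows "\<exists>r<y. pole_sum a b w P r = 0 \<and> r \<notin> P \<and> (\<forall>p\<in>P. \<not> (r < p \<and> p < y))"
proof -
  let ?G = "pole_sum a b w P"
  have "\<exists>x<y. ?G x < 0 \<and> {x..y} \<inter> P = {}"
  proof (cases "\<exists>p\<in>P. p < y")
    case False
    \<comment> \<open>Left of all poles the slope is at least \<open>b\<close>, so over the distance
      \<open>?G y / b + 1\<close> the function drops by at least \<open>?G y + b\<close>.\<close>
    define x where "x = y - ?G y / b - 1"
    have "x < y" using y(2) b by (simp add: x_def add_pos_pos field_simps)
    then have disj: "{x..y} \<inter> P = {}" using False y(1) by (auto simp: not_less order.order_iff_strict)
    then have xP: "x \<notin> P" using \<open>x < y\<close> by (auto simp: disjoint_iff)
    have "0 \<le> (\<Sum>p\<in>P. w p / ((y - p) * (x - p)))"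
    proof (rule sum_nonneg)
      fix p assume p: "p \<in> P"
      then have "y < p" using False y(1) by (metis linorder_less_linear)
      then have "0 < (y - p) * (x - p)" using \<open>x < y\<close> by (intro mult_neg_neg) auto
      then show "0 \<le> w p / ((y - p) * (x - p))" using w[OF p] by simp
    qed
    then have "(y - x) * b \<le> ?G y - ?G x"
      unfolding pole_sum_diff[OF xP y(1)] using \<open>x < y\<close> by (intro mult_left_mono) auto
    moreover have "(y - x) * b = ?G y + b" using b by (simp add: x_def field_simps)
    ultimately have "?G x < 0" using b by linarith
    with disj \<open>x < y\<close> show ?thesis by blast
  next
    case True
    define q where "q = Max {p\<in>P. p < y}"
    have "finite {p\<in>P. p < y}" "{p\<in>P. p < y} \<noteq> {}" using True fin by auto
    from Max_in[OF this] Max_ge[OF this(1)]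
    have q: "q \<in> P" "q < y" and qmax: "\<And>p. p \<in> P \<Longrightarrow> p < y \<Longrightarrow> p \<le> q"
      by (auto simp: q_def)
    have "eventually (\<lambda>x. ?G x < 0) (at_right q)"
      using pole_sum_at_right_pole[where w=w, OF fin q(1) w[OF q(1)]]
      by (auto simp: filterlim_at_bot_dense)
    moreover have "eventually (\<lambda>x. q < x \<and> x < y) (at_right q)"
      using q(2) by (auto simp: eventually_at_right intro!: exI[of _ y])
    ultimately have "eventually (\<lambda>x. ?G x < 0 \<and> q < x \<and> x < y) (at_right q)"
      by eventually_elim auto
    then obtain x where x: "?G x < 0" "q < x" "x < y"
      using eventually_happens'[OF trivial_limit_at_right_real] by blast
    have "{x..y} \<inter> P = {}" using x qmax y(1) by (force simp: order.order_iff_strict)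
    with x show ?thesis by blast
  qed
  then obtain x where x: "x < y" "?G x < 0" "{x..y} \<inter> P = {}" by blast
  have "continuous_on {x..y} ?G"
    using x(3) by (intro continuous_at_imp_continuous_on ballI isCont_pole_sum fin) auto
  from IVT'[OF _ _ _ this, of 0] x y obtain r where r: "x \<le> r" "r \<le> y" "?G r = 0" by force
  then have "r \<noteq> y" using y(2) by auto
  moreover have "p \<notin> {x..y}" if "p \<in> P" for p using that x(3) by auto
  ultimately show ?thesis using r by (intro exI[of _ r]) force
qed

lemma pole_sum_pos_left:
  assumes fin: "finite P" and w: "0 < w p" and p: "p \<in> P"
  shows "\<exists>y<p. y \<notin> P \<and> 0 < pole_sum a b w P y \<and> (\<forall>q\<in>P. \<not> (y < q \<and> q < p))"
proof -
  have 1: "eventually (\<lambda>x. 0 < pole_sum a b w P x) (at_left p)"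
    using pole_sum_at_left_pole[where p=p and w=w and P=P, OF fin p w] by (auto simp: filterlim_at_top_dense)
  have "eventually (\<lambda>x. q < p \<longrightarrow> q < x) (at_left p)" for q
    by (cases "q < p") (auto simp: eventually_at_left intro!: exI[of _ q])
  then have "eventually (\<lambda>x. \<forall>q\<in>P. q < p \<longrightarrow> q < x) (at_left p)"
    using fin by (auto intro: eventually_ball_finite)
  moreover have "eventually (\<lambda>x. x < p) (at_left p)" by (auto simp: eventually_at_filter)
  ultimately have "eventually (\<lambda>x. 0 < pole_sum a b w P x \<and> (\<forall>q\<in>P. q < p \<longrightarrow> q < x) \<and> x < p) (at_left p)"
    using 1 by eventually_elim auto
  then obtain y where "0 < pole_sum a b w P y" "\<forall>q\<in>P. q < p \<longrightarrow> q < y" "y < p"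
    using eventually_happens'[OF trivial_limit_at_left_real] by blast
  then show ?thesis by (intro exI[of _ y]) force
qed

text \<open>There is one root in the gap ending at 0, where the value is positive, and one in the
  gap directly to the left of each pole. These are as many as the degree of the numerator, so no
  other zeros, real or complex, can exist.\<close>

lemma pole_sum_roots:
  assumes fin: "finite P" and w: "\<And>p. p \<in> P \<Longrightarrow> 0 < w p" and b: "0 < b"
    and P: "\<And>p. p \<in> P \<Longrightarrow> p < 0" and pos: "0 < pole_sum a b w P 0"
  obtains R where "finite R" "card R = Suc (card P)" "R \<inter> P = {}"
    "\<And>r. r \<in> R \<Longrightarrow> r < 0 \<and> pole_sum a b w P r = 0"
proof -
  let ?G = "pole_sum a b w P"
  have "0 \<notin> P" using P by force
  from pole_sum_root_left[where P=P and w=w, OF fin w b this pos] obtain r0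
    where r0: "r0 < 0" "?G r0 = 0" "r0 \<notin> P" "\<forall>p\<in>P. \<not> (r0 < p \<and> p < 0)" by blast
  have "\<exists>r<p. ?G r = 0 \<and> r \<notin> P \<and> (\<forall>q\<in>P. \<not> (r < q \<and> q < p))" if p: "p \<in> P" for p
  proof -
    from pole_sum_pos_left[where P=P and w=w and p=p, OF fin w[OF p] p] obtain y where y: "y < p" "y \<notin> P" "0 < ?G y"
      "\<forall>q\<in>P. \<not> (y < q \<and> q < p)" by blast
    from pole_sum_root_left[where P=P and w=w, OF fin w b y(2,3)] obtain r where "r < y" "?G r = 0" "r \<notin> P"
      "\<forall>p\<in>P. \<not> (r < p \<and> p < y)" by blast
    with y show ?thesis by (intro exI[of _ r]) (auto, metis linorder_cases)
  qed
  then obtain f where f: "\<And>p. p \<in> P \<Longrightarrow> f p < p \<and> ?G (f p) = 0 \<and> f p \<notin> P \<and> (\<forall>q\<in>P. \<not> (f p < q \<and> q < p))"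
    by metis
  \<comment> \<open>For \<open>p < p'\<close> the gap condition on \<open>f p'\<close> excludes
    \<open>f p' < p\<close>, hence \<open>f p < p < f p'\<close>. The same argument with 0 in place
    of \<open>p'\<close> puts every \<open>f p\<close> below \<open>r0\<close>.\<close>
  have "inj_on f P"
    by (rule inj_onI) (metis f linorder_cases)
  have "r0 \<notin> f ` P"
    using f r0 P by (metis imageE)
  show thesis
  proof
    show "finite (insert r0 (f ` P))" using fin by simp
    show "card (insert r0 (f ` P)) = Suc (card P)"
      using \<open>r0 \<notin> f ` P\<close> fin \<open>inj_on f P\<close> by (simp add: card_image)
    show "insert r0 (f ` P) \<inter> P = {}" using r0 f by auto
    show "r < 0 \<and> ?G r = 0" if "r \<in> insert r0 (f ` P)" for r
      using that r0 f P by (auto, smt (verit, best))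
  qed
qed

section \<open>Polynomial identities for the numerator and the partial fractions\<close>

lemma degree_prod_linear: "degree (\<Prod>r\<in>R. [:- r, 1:]) = card (R :: real set)"
  by (simp add: degree_prod_sum_eq)

lemma lead_coeff_prod_linear: "lead_coeff (\<Prod>r\<in>R. [:- r, 1:]) = (1 :: real)"
  by (simp add: lead_coeff_prod)

lemma poly_eqI_roots:
  fixes p :: "real poly"
  assumes "finite R" "\<And>r. r \<in> R \<Longrightarrow> poly p r = poly q r" "degree (p - q) < card R"
  shows "p = q"
proof (rule ccontr)
  assume "p \<noteq> q"
  then have "p - q \<noteq> 0" by simp
  then have "card {x. poly (p - q) x = 0} \<le> degree (p - q)" "finite {x. poly (p - q) x = 0}"
    by (rule card_poly_roots_bound, rule poly_roots_finite)
  moreover have "R \<subseteq> {x. poly (p - q) x = 0}" using assms(2) by auto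
  ultimately show False using assms(3) card_mono[of "{x. poly (p - q) x = 0}" R] by linarith
qed

text \<open>Clearing denominators gives a polynomial of degree at most \<open>card P + 1\<close>
  whose coefficient at that degree is \<open>b\<close>. Subtracting \<open>b\<close> times the monic
  polynomial with zeros \<open>R\<close> cancels this coefficient; the difference has degree at most
  \<open>card P\<close> but vanishes at \<open>card P + 1\<close> points.\<close>

lemma pole_sum_numerator:
  fixes P R :: "real set"
  assumes fin: "finite P" "finite R" and card: "card R = Suc (card P)" and disj: "R \<inter> P = {}"
    and R: "\<And>r. r \<in> R \<Longrightarrow> pole_sum a b w P r = 0" and x: "x \<notin> P"
  shows "(\<Prod>p\<in>P. x - p) * pole_sum a b w P x = b * (\<Prod>r\<in>R. x - r)"
proof -
  define D where "D = (\<Prod>p\<in>P. [:- p, 1:])"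
  define Q where "Q = (\<Prod>r\<in>R. [:- r, 1:])"
  define E where "E = (\<Sum>p\<in>P. smult (w p) (\<Prod>q\<in>P - {p}. [:- q, 1:]))"
  define N where "N = D * [:a, b:] - E"
  have N: "poly N y = (\<Prod>p\<in>P. y - p) * pole_sum a b w P y" if "y \<notin> P" for y
  proof -
    have "poly E y = (\<Sum>p\<in>P. w p * (\<Prod>q\<in>P - {p}. y - q))"
      by (simp add: E_def poly_sum poly_prod)
    also have "\<dots> = (\<Sum>p\<in>P. (\<Prod>q\<in>P. y - q) * (w p / (y - p)))"
    proof (rule sum.cong)
      fix p assume "p \<in> P"
      then show "w p * (\<Prod>q\<in>P - {p}. y - q) = (\<Prod>q\<in>P. y - q) * (w p / (y - p))"
        using that fin by (subst prod.remove[of P p]) auto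
    qed simp
    finally show ?thesis
      by (simp add: N_def D_def poly_prod pole_sum_def algebra_simps sum_distrib_left)
  qed
  have dE: "degree E \<le> card P"
    unfolding E_def
  proof (rule degree_sum_le[OF fin(1)])
    fix p assume "p \<in> P"
    have "degree (smult (w p) (\<Prod>q\<in>P - {p}. [:- q, 1:])) \<le> card (P - {p})"
      using degree_smult_le[of "w p" "\<Prod>q\<in>P - {p}. [:- q, 1:]"] by (simp add: degree_prod_linear)
    also have "\<dots> \<le> card P" using fin by (simp add: card_Diff1_le)
    finally show "degree (smult (w p) (\<Prod>q\<in>P - {p}. [:- q, 1:])) \<le> card P" .
  qed
  have dD: "degree D = card P" "coeff D (card P) = 1"
    using degree_prod_linear[of P] lead_coeff_prod_linear[of P] by (auto simp: D_def)
  have dQ: "degree Q = Suc (card P)" "coeff Q (Suc (card P)) = 1"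
    using degree_prod_linear[of R] lead_coeff_prod_linear[of R] card by (auto simp: Q_def)
  have "degree (N - smult b Q) \<le> card P"
  proof (rule degree_le, intro allI impI)
    fix i assume i: "card P < i"
    then obtain j where j: "i = Suc j" "card P \<le> j" by (cases i) auto
    have 1: "coeff E i = 0" "coeff D i = 0" using i dE dD by (auto intro: coeff_eq_0)
    show "coeff (N - smult b Q) i = 0"
    proof (cases "j = card P")
      case True
      then show ?thesis using 1 dD dQ j by (simp add: N_def mult.commute[of D])
    next
      case False
      then have "coeff D j = 0" "coeff Q i = 0" using dD dQ j by (auto intro: coeff_eq_0)
      then show ?thesis using 1 j by (simp add: N_def mult.commute[of D])
    qed
  qed
  then have "N = smult b Q"
  proof (intro poly_eqI_roots[OF fin(2)])
    fix r assume r: "r \<in> R"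
    then have "r \<notin> P" using disj by auto
    then show "poly N r = poly (smult b Q) r"
      using N[of r] R[OF r] r fin(2) by (auto simp: Q_def poly_prod)
  qed (use card in auto)
  then have "poly N x = b * (\<Prod>r\<in>R. x - r)"
    by (simp add: Q_def poly_prod)
  with N[OF x] show ?thesis by simp
qed

text \<open>Lagrange interpolation of the numerator at the nodes \<open>R\<close>, which is exact
  because its degree is below the number of nodes.\<close>

lemma lagrange_partial_fractions:
  fixes P R :: "real set"
  assumes fin: "finite R" and card: "card P < card R" and x: "x \<notin> R"
  shows "(\<Prod>p\<in>P. x - p) / (\<Prod>r\<in>R. x - r) =
         (\<Sum>r\<in>R. ((\<Prod>p\<in>P. r - p) / (\<Prod>s\<in>R - {r}. r - s)) / (x - r))"
proof -
  define c where "c r = (\<Prod>p\<in>P. r - p) / (\<Prod>s\<in>R - {r}. r - s)" for r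
  define D where "D = (\<Prod>p\<in>P. [:- p, 1:])"
  define E where "E = (\<Sum>r\<in>R. smult (c r) (\<Prod>s\<in>R - {r}. [:- s, 1:]))"
  have "degree E \<le> card R - 1"
    unfolding E_def
  proof (rule degree_sum_le[OF fin])
    fix p assume "p \<in> R"
    have "degree (smult (c p) (\<Prod>q\<in>R - {p}. [:- q, 1:])) \<le> card (R - {p})"
      using degree_smult_le[of "c p" "\<Prod>q\<in>R - {p}. [:- q, 1:]"] by (simp add: degree_prod_linear)
    then show "degree (smult (c p) (\<Prod>q\<in>R - {p}. [:- q, 1:])) \<le> card R - 1"
      using \<open>p \<in> R\<close> fin by simp
  qed
  moreover have "degree D = card P" by (simp add: D_def degree_prod_linear)
  ultimately have deg: "degree (D - E) < card R"
    using card degree_diff_le_max[of D E] by linarith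
  have "D = E"
  proof (rule poly_eqI_roots[OF fin _ deg])
    fix r assume r: "r \<in> R"
    have "poly E r = (\<Sum>t\<in>R. c t * (\<Prod>s\<in>R - {t}. r - s))"
      by (simp add: E_def poly_sum poly_prod)
    also have "\<dots> = c r * (\<Prod>s\<in>R - {r}. r - s)"
      using fin r by (subst sum.remove[OF fin r]) (auto intro!: sum.neutral)
    also have "\<dots> = (\<Prod>p\<in>P. r - p)" using fin by (auto simp: c_def)
    finally show "poly D r = poly E r" by (simp add: D_def poly_prod)
  qed
  then have "(\<Prod>p\<in>P. x - p) = (\<Sum>r\<in>R. c r * (\<Prod>s\<in>R - {r}. x - s))"
    by (metis (no_types, lifting) D_def E_def poly_smult poly_prod poly_sum sum.cong prod.cong poly_pCons poly_0 mult_zero_right add_0_right mult.right_neutral uminus_add_conv_diff)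
  also have "\<dots> = (\<Sum>r\<in>R. c r / (x - r) * (\<Prod>s\<in>R. x - s))"
  proof (rule sum.cong)
    fix r assume "r \<in> R"
    then show "c r * (\<Prod>s\<in>R - {r}. x - s) = c r / (x - r) * (\<Prod>s\<in>R. x - s)"
      using x fin by (subst prod.remove[of R r]) auto
  qed simp
  finally have "(\<Prod>p\<in>P. x - p) = (\<Sum>r\<in>R. c r / (x - r)) * (\<Prod>s\<in>R. x - s)"
    by (simp add: sum_distrib_right)
  moreover have "(\<Prod>s\<in>R. x - s) \<noteq> 0" using x fin by auto
  ultimately show ?thesis by (simp add: c_def)
qed

text \<open>The coefficient \<open>c r\<close> is the residue of the reciprocal at the simple zero
  \<open>r\<close>, that is, the reciprocal of the derivative
  \<open>b + (\<Sum>p\<in>P. w p / (r - p)\<^sup>2) > 0\<close>.\<close>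

lemma inverse_pole_sum:
  assumes fin: "finite P" and w: "\<And>p. p \<in> P \<Longrightarrow> 0 < w p" and b: "0 < b"
    and P: "\<And>p. p \<in> P \<Longrightarrow> p < 0" and pos: "0 < pole_sum a b w P 0"
  obtains R c where "finite R" "\<And>r. r \<in> R \<Longrightarrow> r < 0 \<and> 0 \<le> c r"
    "\<And>x. 0 < x \<Longrightarrow> 0 < pole_sum a b w P x \<and> 1 / pole_sum a b w P x = (\<Sum>r\<in>R. c r / (x - r))"
proof -
  let ?G = "pole_sum a b w P"
  from pole_sum_roots[where P=P and w=w, OF fin w b P pos] obtain R where R: "finite R" "card R = Suc (card P)" "R \<inter> P = {}"
    "\<And>r. r \<in> R \<Longrightarrow> r < 0 \<and> ?G r = 0" by blast
  define c where "c r = (\<Prod>p\<in>P. r - p) / (\<Prod>s\<in>R - {r}. r - s) / b" for r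
  note num = pole_sum_numerator[OF fin R(1,2,3), of a b w]
  have c_pos: "0 \<le> c r" if r: "r \<in> R" for r
  proof -
    \<comment> \<open>\<open>L\<close> and \<open>M\<close> are the two sides of the numerator
      identity after division by \<open>x - r\<close>. They agree near \<open>r\<close> except
      possibly at \<open>r\<close>, hence by continuity also at \<open>r\<close>, which yields the
      derivative at the root without differentiating.\<close>
    define L where "L x = (\<Prod>p\<in>P. x - p) * (b + (\<Sum>p\<in>P. w p / ((x - p) * (r - p))))" for x
    define M where "M x = b * (\<Prod>s\<in>R - {r}. x - s)" for x
    have rP: "r \<notin> P" using r R(3) by auto
    have "isCont L r" unfolding L_def using rP by (intro continuous_intros) auto
    moreover have "isCont M r" unfolding M_def by (intro continuous_intros)
    moreover have "eventually (\<lambda>x. L x = M x) (at r)"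
    proof -
      have "eventually (\<lambda>x. x \<notin> P) (at r)"
        using rP fin finite_imp_closed[OF fin] by (intro eventually_at_in_open'[where A = "- P", simplified]) auto
      moreover have "eventually (\<lambda>x. x \<noteq> r) (at r)" by (simp add: eventually_at_filter)
      ultimately show ?thesis
      proof eventually_elim
        case (elim x)
        have "(\<Prod>p\<in>P. x - p) * (?G x - ?G r) = b * (\<Prod>r\<in>R. x - r)"
          using num elim R(4) r by simp
        then have "(x - r) * L x = (x - r) * M x"
          unfolding pole_sum_diff[OF rP elim(1)] L_def M_def
          by (subst (asm) prod.remove[OF R(1) r]) (simp add: mult_ac)
        then show ?case using elim by simp
      qed
    qed
    ultimately have "L r = M r"
      unfolding isCont_def by (metis tendsto_cong tendsto_unique trivial_limit_at)
    moreover have "(\<Prod>s\<in>R - {r}. r - s) \<noteq> 0" using R(1) by auto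
    moreover have "0 < b + (\<Sum>p\<in>P. w p / ((r - p) * (r - p)))"
      using b w by (intro add_pos_nonneg sum_nonneg) (auto intro!: divide_nonneg_nonneg simp: less_imp_le)
    ultimately have "c r = 1 / (b + (\<Sum>p\<in>P. w p / ((r - p) * (r - p))))"
      using b unfolding L_def M_def c_def by (auto simp: field_simps)
    with \<open>0 < b + _\<close> show ?thesis by simp
  qed
  show thesis
  proof
    show "finite R" by fact
    show "r < 0 \<and> 0 \<le> c r" if "r \<in> R" for r using R(4) c_pos that by auto
    fix x :: real assume x: "0 < x"
    have xP: "x \<notin> P" and "0 \<notin> P" and xR: "x \<notin> R" using P R(4) x by force+
    have "0 \<le> (\<Sum>p\<in>P. w p / ((x - p) * (0 - p)))"
      using w P x by (intro sum_nonneg divide_nonneg_nonneg mult_nonneg_nonneg) (auto simp: less_imp_le intro: less_imp_le order.strict_trans)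
    then have "0 \<le> (x - 0) * (b + (\<Sum>p\<in>P. w p / ((x - p) * (0 - p))))"
      using x b by (intro mult_nonneg_nonneg add_nonneg_nonneg) auto
    then have Gx: "0 < ?G x" using pole_sum_diff[OF \<open>0 \<notin> P\<close> xP, of a b w] pos by linarith
    have nz: "(\<Prod>r\<in>R. x - r) \<noteq> 0" "(\<Prod>p\<in>P. x - p) \<noteq> 0" using xR xP R(1) fin by auto
    have "1 / ?G x = (\<Prod>p\<in>P. x - p) / (\<Prod>r\<in>R. x - r) / b"
      using num[of x] R(4) xP nz Gx b by (simp add: field_simps)
    also have "\<dots> = (\<Sum>r\<in>R. c r / (x - r))"
      using lagrange_partial_fractions[OF R(1) _ xR, of P] R(2)
      by (simp add: c_def sum_divide_distrib mult_ac)
    finally show "0 < ?G x \<and> 1 / ?G x = (\<Sum>r\<in>R. c r / (x - r))" using Gx by simp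
  qed
qed

section \<open>Limits of reciprocals with a Stieltjes representation\<close>

text \<open>In the variable \<open>z = 1 / (1 + t)\<close>, which compactifies the half-line of all \<open>t\<close> to \<open>[0, 1]\<close>
  (\<open>z = 0\<close> is \<open>t = \<infinity>\<close>), this is \<open>(u + t) / (x + t)\<close>. Normalizing at \<open>x = u\<close> makes the
  representing measures of \<open>1 / \<kappa>\<close> probability measures, so that no mass is lost in limits.\<close>

definition stieltjes_kernel :: "real \<Rightarrow> real \<Rightarrow> real \<Rightarrow> real" where
  "stieltjes_kernel u x z = (1 + (u - 1) * z) / (1 + (x - 1) * z)"

definition reciprocal_stieltjes :: "real \<Rightarrow> real \<Rightarrow> (real \<Rightarrow> real) \<Rightarrow> bool" where
  "reciprocal_stieltjes l u \<kappa> \<longleftrightarrow>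
     (\<exists>\<rho>. real_distribution \<rho> \<and> (AE z in \<rho>. 0 \<le> z \<and> z \<le> 1) \<and>
        (\<forall>x>l. 1 / \<kappa> x = 1 / \<kappa> u * (LINT z|\<rho>. stieltjes_kernel u x z)))"

lemma borel_measurable_stieltjes_kernel [measurable]:
  "stieltjes_kernel u x \<in> borel_measurable borel"
  unfolding stieltjes_kernel_def [abs_def] by measurable

lemma stieltjes_denom_pos:
  assumes "0 < x" "0 \<le> z" "z \<le> 1"
  shows "0 < 1 + (x - 1) * (z::real)"
proof -
  have "1 + (x - 1) * z = (1 - z) + x * z" by (simp add: algebra_simps)
  moreover have "0 < (1 - z) + x * z"
    using assms by (cases "z = 1") (auto intro: add_pos_nonneg)
  ultimately show ?thesis by simp
qed

text \<open>The bound is uniform in \<open>z\<close>, as needed both for integrability against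
  probability measures and for passing to weak limits.\<close>

lemma stieltjes_kernel_bounds:
  assumes "0 < u" "0 < x" "0 \<le> z" "z \<le> 1"
  shows "0 < stieltjes_kernel u x z" "stieltjes_kernel u x z \<le> 1 + u / x"
proof -
  note pos = stieltjes_denom_pos[OF assms(1,3,4)] stieltjes_denom_pos[OF assms(2,3,4)]
  show "0 < stieltjes_kernel u x z" using pos by (simp add: stieltjes_kernel_def)
  have "0 \<le> x * z + u / x * (1 - z)" using assms by simp
  also have "x * z + u / x * (1 - z) = (1 + u / x) * (1 + (x - 1) * z) - (1 + (u - 1) * z)"
    using assms by (simp add: field_simps)
  finally have "1 + (u - 1) * z \<le> (1 + u / x) * (1 + (x - 1) * z)" by simp
  then show "stieltjes_kernel u x z \<le> 1 + u / x"
    using pos by (simp add: stieltjes_kernel_def pos_divide_le_eq)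
qed

text \<open>The pole \<open>r = - t\<close> becomes an atom at \<open>z = 1 / (1 - r)\<close> with
  mass \<open>g r\<close>. The masses sum to 1 because the given expansion holds in particular at
  \<open>x = u\<close>.\<close>

lemma reciprocal_stieltjes_finite_sum:
  assumes fin: "finite R" and R: "\<And>r. r \<in> R \<Longrightarrow> r < 0 \<and> 0 \<le> c r"
    and \<kappa>: "\<And>x. 0 < x \<Longrightarrow> 0 < \<kappa> x \<and> 1 / \<kappa> x = (\<Sum>r\<in>R. c r / (x - r))"
    and "0 \<le> l" "0 < u"
  shows "reciprocal_stieltjes l u \<kappa>"
proof -
  define g where "g r = c r / (u - r) * \<kappa> u" for r
  define Z where "Z r = 1 / (1 - r)" for r :: real
  define \<rho> where "\<rho> = distr (point_measure R g) borel Z"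
  note \<kappa>u = \<kappa>[OF \<open>0 < u\<close>]
  have g: "0 \<le> g r" if "r \<in> R" for r
    using R[OF that] \<kappa>u \<open>0 < u\<close> by (auto simp: g_def)
  have "(\<Sum>r\<in>R. g r) = (\<Sum>r\<in>R. c r / (u - r)) * \<kappa> u"
    by (simp add: g_def sum_distrib_right)
  also have "\<dots> = 1" using \<kappa>u by (metis less_irrefl nonzero_eq_divide_eq)
  finally have "(\<Sum>r\<in>R. g r) = 1" .
  then interpret pm: prob_space "point_measure R g"
    using fin g by (intro prob_space_point_measure) auto
  have Z: "Z \<in> borel_measurable (point_measure R g)" by simp
  have "prob_space \<rho>" unfolding \<rho>_def by (rule pm.prob_space_distr[OF Z])
  then have "real_distribution \<rho>"
    by (simp add: real_distribution_def real_distribution_axioms_def \<rho>_def)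
  moreover have "AE z in \<rho>. 0 \<le> z \<and> z \<le> 1"
    unfolding \<rho>_def
    by (subst AE_distr_iff[OF Z]) (use R in \<open>auto intro!: AE_I2 simp: Z_def space_point_measure divide_simps dest!: R\<close>)
  moreover have "1 / \<kappa> x = 1 / \<kappa> u * (LINT z|\<rho>. stieltjes_kernel u x z)" if x: "l < x" for x
  proof -
    have "(LINT z|\<rho>. stieltjes_kernel u x z) = (\<Sum>r\<in>R. g r * stieltjes_kernel u x (Z r))"
      unfolding \<rho>_def using fin g
      by (subst integral_distr[OF Z]) (auto simp: lebesgue_integral_point_measure_finite)
    also have "\<dots> = (\<Sum>r\<in>R. \<kappa> u * (c r / (x - r)))"
    proof (rule sum.cong)
      fix r assume r: "r \<in> R"
      have pos: "0 < u - r" "0 < x - r" "0 < 1 - r" using R[OF r] x assms(4,5) by auto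
      have "1 + (u - 1) * Z r = (u - r) * Z r" "1 + (x - 1) * Z r = (x - r) * Z r"
        using pos by (auto simp: Z_def field_simps)
      then have "stieltjes_kernel u x (Z r) = (u - r) / (x - r)"
        using pos by (simp add: stieltjes_kernel_def Z_def)
      then show "g r * stieltjes_kernel u x (Z r) = \<kappa> u * (c r / (x - r))"
        using pos by (simp add: g_def)
    qed simp
    also have "\<dots> = \<kappa> u * (1 / \<kappa> x)" using \<kappa>[of x] x \<open>0 \<le> l\<close> by (simp add: sum_distrib_left)
    finally have "(LINT z|\<rho>. stieltjes_kernel u x z) = \<kappa> u * (1 / \<kappa> x)" .
    moreover have "\<kappa> u \<noteq> 0" using \<kappa>u by simp
    ultimately show ?thesis by simp
  qed
  ultimately show ?thesis unfolding reciprocal_stieltjes_def by blast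
qed

text \<open>Probability measures carried by \<open>[0, 1]\<close> are tight, so a subsequence
  converges weakly to a probability measure. The kernel is bounded and continuous on
  \<open>[0, 1]\<close>, hence its integrals converge, and the prefactors
  \<open>1 / \<kappa>s n u\<close> converge by assumption.\<close>

lemma reciprocal_stieltjes_limit:
  assumes st: "\<And>n. reciprocal_stieltjes l u (\<kappa>s n)" and "0 \<le> l" "l < u"
    and lim: "\<And>x. l < x \<Longrightarrow> (\<lambda>n. \<kappa>s n x) \<longlonglongrightarrow> \<kappa> x" and pos: "\<And>x. l < x \<Longrightarrow> 0 < \<kappa> x"
  shows "reciprocal_stieltjes l u \<kappa>"
proof -
  obtain \<rho> where "\<forall>n. real_distribution (\<rho> n) \<and> (AE z in \<rho> n. 0 \<le> z \<and> z \<le> 1) \<and>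
      (\<forall>x>l. 1 / \<kappa>s n x = 1 / \<kappa>s n u * (LINT z|\<rho> n. stieltjes_kernel u x z))"
    using st unfolding reciprocal_stieltjes_def by metis
  then have \<rho>: "real_distribution (\<rho> n)" "AE z in \<rho> n. 0 \<le> z \<and> z \<le> 1"
      "l < x \<Longrightarrow> 1 / \<kappa>s n x = 1 / \<kappa>s n u * (LINT z|\<rho> n. stieltjes_kernel u x z)" for n x
    by auto
  \<comment> \<open>Weak convergence requires test functions that are continuous and bounded on the
    whole line, whereas the kernel may have a pole outside \<open>[0, 1]\<close>. Clamping the
    argument repairs this, and the image of the limit under \<open>C\<close> lives on
    \<open>[0, 1]\<close> by construction.\<close>
  define C where "C z = max 0 (min 1 z)" for z :: real
  have C: "0 \<le> C z" "C z \<le> 1" for z by (auto simp: C_def)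
  have C_id: "0 \<le> z \<Longrightarrow> z \<le> 1 \<Longrightarrow> C z = z" for z by (auto simp: C_def)
  have C_meas[measurable]: "C \<in> borel_measurable borel" unfolding C_def [abs_def] by measurable
  have "tight \<rho>"
    unfolding tight_def
  proof (intro conjI allI impI)
    fix \<epsilon> :: real assume "0 < \<epsilon>"
    \<comment> \<open>Tightness is stated with intervals open on the left; the endpoint -1 ensures
      that an atom at \<open>z = 0\<close> is included.\<close>
    have "measure (\<rho> n) {-1<..1} = 1" for n
    proof -
      interpret real_distribution "\<rho> n" by (rule \<rho>)
      show ?thesis using \<rho>(2)[of n] by (subst prob_eq_1) (auto elim: eventually_mono)
    qed
    then show "\<exists>a b. a < b \<and> (\<forall>n. 1 - \<epsilon> < measure (\<rho> n) {a<..b})"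
      using \<open>0 < \<epsilon>\<close> by (intro exI[of _ "-1"] exI[of _ 1]) auto
  qed (rule \<rho>)
  from tight_imp_convergent_subsubsequence[OF this strict_mono_id] obtain s N
    where s: "strict_mono s" and N: "real_distribution N" and conv: "weak_conv_m (\<rho> \<circ> id \<circ> s) N"
    by blast
  interpret N: real_distribution N by (rule N)
  define \<rho>' where "\<rho>' = distr N borel C"
  have "real_distribution \<rho>'"
    unfolding \<rho>'_def by (rule N.real_distribution_distr) measurable
  moreover have "AE z in \<rho>'. 0 \<le> z \<and> z \<le> 1"
    unfolding \<rho>'_def by (subst AE_distr_iff) (auto simp: C)
  moreover have "1 / \<kappa> x = 1 / \<kappa> u * (LINT z|\<rho>'. stieltjes_kernel u x z)" if x: "l < x" for x
  proof -
    have "0 < x" "0 < u" using x \<open>l < u\<close> \<open>0 \<le> l\<close> by auto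
    let ?k = "\<lambda>z. stieltjes_kernel u x (C z)"
    have cont: "isCont ?k z" for z
      unfolding stieltjes_kernel_def C_def
      using stieltjes_denom_pos[OF \<open>0 < x\<close> C(1)[of z] C(2)[of z]]
      by (intro continuous_intros) (simp add: C_def)
    have bd: "norm (?k z) \<le> 1 + u / x" for z
      using stieltjes_kernel_bounds[OF \<open>0 < u\<close> \<open>0 < x\<close> C] by (simp add: less_imp_le abs_of_pos)
    have "(\<lambda>n. integral\<^sup>L ((\<rho> \<circ> id \<circ> s) n) ?k) \<longlonglongrightarrow> integral\<^sup>L N ?k"
      by (rule weak_conv_imp_integral_bdd_continuous_conv[OF _ N conv cont bd]) (simp add: \<rho>)
    moreover have "integral\<^sup>L ((\<rho> \<circ> id \<circ> s) n) ?k = (LINT z|\<rho> (s n). stieltjes_kernel u x z)" for n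
    proof -
      interpret real_distribution "\<rho> (s n)" by (rule \<rho>)
      show ?thesis
        unfolding comp_def id_def
        by (intro integral_cong_AE eventually_mono[OF \<rho>(2)[of "s n"]]) (auto simp: C_id)
    qed
    moreover have "integral\<^sup>L N ?k = (LINT z|\<rho>'. stieltjes_kernel u x z)"
      unfolding \<rho>'_def by (subst integral_distr) auto
    ultimately have 1: "(\<lambda>n. LINT z|\<rho> (s n). stieltjes_kernel u x z) \<longlonglongrightarrow> (LINT z|\<rho>'. stieltjes_kernel u x z)"
      by simp
    have lims: "(\<lambda>n. 1 / \<kappa>s (s n) y) \<longlonglongrightarrow> 1 / \<kappa> y" if "l < y" for y
      using LIMSEQ_subseq_LIMSEQ[OF lim[OF that] s] pos[OF that]
      by (intro tendsto_divide) (auto simp: comp_def)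
    have "(\<lambda>n. 1 / \<kappa>s (s n) u * (LINT z|\<rho> (s n). stieltjes_kernel u x z)) \<longlonglongrightarrow>
          1 / \<kappa> u * (LINT z|\<rho>'. stieltjes_kernel u x z)"
      by (intro tendsto_mult lims 1 \<open>l < u\<close>)
    then have "(\<lambda>n. 1 / \<kappa>s (s n) x) \<longlonglongrightarrow> 1 / \<kappa> u * (LINT z|\<rho>'. stieltjes_kernel u x z)"
      using \<rho>(3)[OF x] by simp
    with lims[OF x] show ?thesis by (rule LIMSEQ_unique)
  qed
  ultimately show ?thesis unfolding reciprocal_stieltjes_def by blast
qed

text \<open>Splitting off the pole at \<open>l\<close> by
  \<open>(u + t) / ((x - l) * (x + t)) = (u + t) / (l + t) * (1 / (x - l) - 1 / (x + t))\<close>.\<close>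

lemma reciprocal_stieltjes_representation:
  assumes st: "reciprocal_stieltjes l u \<kappa>" and "0 < l" "l < u" "0 < \<kappa> u"
  obtains A \<mu> where "0 < A" "finite_measure \<mu>" "sets \<mu> = sets borel" "AE t in \<mu>. 0 \<le> t"
    "\<And>x. l < x \<Longrightarrow> 1 / ((x - l) * \<kappa> x) = A / (x - l) - (LINT t|\<mu>. 1 / (x + t))"
proof -
  obtain \<rho> where \<rho>: "real_distribution \<rho>" and supp: "AE z in \<rho>. 0 \<le> z \<and> z \<le> 1"
    and rep: "\<And>x. l < x \<Longrightarrow> 1 / \<kappa> x = 1 / \<kappa> u * (LINT z|\<rho>. stieltjes_kernel u x z)"
    using st unfolding reciprocal_stieltjes_def by blast
  interpret real_distribution \<rho> by (rule \<rho>)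
  have "0 < u" using assms by simp
  \<comment> \<open>In the variable \<open>t\<close> this is
    \<open>(u + t) / (l + t) / \<kappa> u\<close>, the factor that the splitting of the pole at
    \<open>l\<close> produces.\<close>
  define m where "m z = stieltjes_kernel u l z / \<kappa> u" for z
  \<comment> \<open>The point \<open>z = 0\<close> stands for \<open>t = \<infinity>\<close>, where
    \<open>1 / (x + t)\<close> vanishes. It contributes to \<open>A\<close>, but it must be left out
    of \<open>\<mu>\<close>: since division by 0 gives 0, the map to \<open>t\<close> would send it
    to -1.\<close>
  define g where "g z = m z * indicator {0<..1} z" for z
  have mm[measurable]: "m \<in> borel_measurable borel" unfolding m_def [abs_def] by measurable
  have gm[measurable]: "g \<in> borel_measurable borel" unfolding g_def [abs_def] by measurable
  have m: "0 < m z" "m z \<le> (1 + u / l) / \<kappa> u" if "0 \<le> z" "z \<le> 1" for z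
    using stieltjes_kernel_bounds[OF \<open>0 < u\<close> \<open>0 < l\<close> that] \<open>0 < \<kappa> u\<close>
    by (auto simp: m_def divide_right_mono)
  have g: "0 \<le> g z" "g z \<le> (1 + u / l) / \<kappa> u" for z
    using m[of z] assms by (auto simp: g_def indicator_def less_imp_le)
  have int_m: "integrable \<rho> m"
    using m by (intro integrable_const_bound[where B="(1 + u / l) / \<kappa> u"] eventually_mono[OF supp])
      (auto simp: abs_of_pos)
  have int_g: "integrable \<rho> g"
    using g by (intro integrable_const_bound[where B="(1 + u / l) / \<kappa> u"]) auto
  define A where "A = (LINT z|\<rho>. m z)"
  define \<mu> where "\<mu> = distr (density \<rho> (\<lambda>z. ennreal (g z))) borel (\<lambda>z. 1 / z - 1)"
  have inv_meas: "(\<lambda>z::real. 1 / z - 1) \<in> borel_measurable (density \<rho> (\<lambda>z. ennreal (g z)))"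
    by measurable
  have "0 < A"
  proof -
    have "A \<noteq> 0"
    proof
      assume "A = 0"
      then have "AE z in \<rho>. m z = 0"
        unfolding A_def
        by (subst (asm) integral_nonneg_eq_0_iff_AE[OF int_m])
           (auto intro!: eventually_mono[OF supp] simp: m less_imp_le)
      with supp have "AE z in \<rho>. False" by eventually_elim (use m in force)
      then show False by simp
    qed
    moreover have "0 \<le> A" unfolding A_def
      by (intro integral_nonneg_AE eventually_mono[OF supp]) (simp add: m less_imp_le)
    ultimately show ?thesis by simp
  qed
  moreover have "finite_measure \<mu>"
  proof
    have "emeasure \<mu> (space \<mu>) = (\<integral>\<^sup>+z. ennreal (g z) \<partial>\<rho>)"
      by (simp add: \<mu>_def emeasure_distr[OF inv_meas] emeasure_density)
    also have "\<dots> = ennreal (LINT z|\<rho>. g z)"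
      by (rule nn_integral_eq_integral[OF int_g]) (simp add: g)
    finally show "emeasure \<mu> (space \<mu>) \<noteq> \<infinity>" by simp
  qed
  moreover have "sets \<mu> = sets borel" by (simp add: \<mu>_def)
  moreover have "AE t in \<mu>. 0 \<le> t"
    unfolding \<mu>_def by (subst AE_distr_iff[OF inv_meas])
      (auto simp: AE_density g_def indicator_def divide_simps)
  moreover have "1 / ((x - l) * \<kappa> x) = A / (x - l) - (LINT t|\<mu>. 1 / (x + t))" if x: "l < x" for x
  proof -
    have "0 < x" using x \<open>0 < l\<close> by simp
    have \<mu>_eq: "(LINT t|\<mu>. 1 / (x + t)) = (LINT z|\<rho>. g z * (1 / (x + (1 / z - 1))))"
      unfolding \<mu>_def using g by (subst integral_distr[OF inv_meas]) (auto simp: integral_real_density)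
    have eq: "stieltjes_kernel u x z / \<kappa> u / (x - l) = m z / (x - l) - g z * (1 / (x + (1 / z - 1)))"
      if z: "0 \<le> z" "z \<le> 1" for z
    proof (cases "z = 0")
      case True
      then show ?thesis by (simp add: m_def g_def stieltjes_kernel_def)
    next
      case False
      have pos: "0 < 1 + (x - 1) * z" "0 < 1 + (l - 1) * z"
        using stieltjes_denom_pos[OF _ z] \<open>0 < x\<close> \<open>0 < l\<close> by auto
      have 1: "1 / (x + (1 / z - 1)) = z / (1 + (x - 1) * z)"
        using False by (simp add: field_simps)
      have "1 / (1 + (x - 1) * z) / (x - l) = 1 / (1 + (l - 1) * z) * (1 / (x - l) - z / (1 + (x - 1) * z))"
      proof -
        have "1 / (x - l) - z / (1 + (x - 1) * z) = (1 + (l - 1) * z) / ((x - l) * (1 + (x - 1) * z))"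
          using pos x by (simp add: divide_simps) (simp add: algebra_simps)
        then show ?thesis using pos by simp
      qed
      then have "(1 + (u - 1) * z) / \<kappa> u * (1 / (1 + (x - 1) * z) / (x - l)) =
          (1 + (u - 1) * z) / \<kappa> u * (1 / (1 + (l - 1) * z) * (1 / (x - l) - z / (1 + (x - 1) * z)))"
        by simp
      then show ?thesis
        unfolding 1 using False z by (simp add: m_def g_def stieltjes_kernel_def right_diff_distrib mult_ac)
    qed
    have int_k: "integrable \<rho> (\<lambda>z. stieltjes_kernel u x z / \<kappa> u / (x - l))"
      using stieltjes_kernel_bounds[OF \<open>0 < u\<close> \<open>0 < x\<close>]
      by (intro integrable_divide integrable_const_bound[where B="1 + u / x"] eventually_mono[OF supp])
         (auto simp: abs_of_pos)
    have int_2: "integrable \<rho> (\<lambda>z. g z * (1 / (x + (1 / z - 1))))"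
    proof -
      have "integrable \<rho> (\<lambda>z. m z / (x - l) - stieltjes_kernel u x z / \<kappa> u / (x - l))"
        using int_m int_k by auto
      then show ?thesis
        by (rule integrable_cong_AE_imp) (auto intro!: eventually_mono[OF supp] simp: eq simp del: divide_divide_eq_left)
    qed
    have "1 / ((x - l) * \<kappa> x) = (1 / \<kappa> x) / (x - l)" by simp
    also have "\<dots> = (LINT z|\<rho>. stieltjes_kernel u x z / \<kappa> u / (x - l))"
      by (simp add: rep[OF x])
    also have "\<dots> = (LINT z|\<rho>. m z / (x - l) - g z * (1 / (x + (1 / z - 1))))"
      by (intro integral_cong_AE eventually_mono[OF supp]) (auto simp: eq simp del: divide_divide_eq_left)
    also have "\<dots> = A / (x - l) - (LINT z|\<rho>. g z * (1 / (x + (1 / z - 1))))"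
      using int_m int_2 by (simp add: A_def)
    finally show ?thesis by (simp only: \<mu>_eq)
  qed
  ultimately show thesis by (rule that)
qed

section \<open>Approximation of completely monotone functions by exponential sums\<close>

text \<open>The sign is chosen so that completely monotone functions have nonnegative iterated
  differences, without alternating factors.\<close>

definition backward_diff :: "(nat \<Rightarrow> real) \<Rightarrow> nat \<Rightarrow> real" where
  "backward_diff c j = c j - c (Suc j)"

lemma sum_choose_Suc:
  fixes F :: "nat \<Rightarrow> real"
  shows "(\<Sum>i\<le>Suc n. real (Suc n choose i) * F i) =
         (\<Sum>i\<le>n. real (n choose i) * (F i + F (Suc i)))"
proof -
  have "(\<Sum>i\<le>Suc n. real (Suc n choose i) * F i)
      = F 0 + (\<Sum>i\<le>n. real (n choose Suc i) * F (Suc i)) + (\<Sum>i\<le>n. real (n choose i) * F (Suc i))"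
    by (subst sum.atMost_Suc_shift) (simp add: sum.distrib[symmetric] algebra_simps)
  also have "F 0 + (\<Sum>i\<le>n. real (n choose Suc i) * F (Suc i)) = (\<Sum>i\<le>Suc n. real (n choose i) * F i)"
    by (subst sum.atMost_Suc_shift) simp
  also have "\<dots> = (\<Sum>i\<le>n. real (n choose i) * F i)" by simp
  finally show ?thesis by (simp add: sum.distrib algebra_simps)
qed

text \<open>The identity operator is the sum of \<open>backward_diff\<close> and the shift, which
  commute; this is the binomial expansion of its \<open>n\<close>-th power.\<close>

lemma sum_choose_backward_diff:
  "(\<Sum>i\<le>n. real (n choose i) * (backward_diff ^^ (n - i)) c (j + i)) = c j"
proof (induction n)
  case (Suc n)
  have "(\<Sum>i\<le>Suc n. real (Suc n choose i) * (backward_diff ^^ (Suc n - i)) c (j + i))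
      = (\<Sum>i\<le>n. real (n choose i) * (backward_diff ^^ (n - i)) c (j + i))"
    unfolding sum_choose_Suc by (intro sum.cong) (auto simp: Suc_diff_le backward_diff_def)
  then show ?case using Suc.IH by simp
qed simp

text \<open>The weight that Hausdorff's solution of the moment problem puts on the node \<open>k / N\<close>.\<close>

definition hausdorff_weight :: "(nat \<Rightarrow> real) \<Rightarrow> nat \<Rightarrow> nat \<Rightarrow> real" where
  "hausdorff_weight c N k = real (N choose k) * (backward_diff ^^ (N - k)) c k"

text \<open>The weights reproduce the sequence exactly when powers are replaced by binomial ratios;
  for \<open>j = 0\<close> this says that the total mass is \<open>c 0\<close>. Since \<open>(N
  choose k) * (k choose j) = (N choose j) * (N - j choose k - j)\<close>, it reduces to the previous
  expansion.\<close>

lemma sum_hausdorff_weight: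
  assumes "j \<le> N"
  shows "(\<Sum>k\<le>N. real (k choose j) / real (N choose j) * hausdorff_weight c N k) = c j"
proof -
  let ?t = "\<lambda>k. real (k choose j) / real (N choose j) * hausdorff_weight c N k"
  have "(\<Sum>k\<le>N. ?t k) = (\<Sum>k\<in>{j..N}. ?t k)"
    by (intro sum.mono_neutral_right) (auto simp: binomial_eq_0)
  also have "\<dots> = (\<Sum>i\<le>N - j. ?t (j + i))"
    using assms by (intro sum.reindex_bij_witness[of _ "\<lambda>i. j + i" "\<lambda>k. k - j"]) auto
  also have "\<dots> = (\<Sum>i\<le>N - j. real (N - j choose i) * (backward_diff ^^ (N - j - i)) c (j + i))"
  proof (rule sum.cong)
    fix i assume "i \<in> {..N - j}"
    then have "(N choose (j + i)) * (j + i choose j) = (N choose j) * (N - j choose i)"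
      using assms choose_mult[of j "j + i" N] by simp
    then have "real (N choose (j + i)) * real (j + i choose j) = real (N choose j) * real (N - j choose i)"
      by (metis of_nat_mult)
    then have "real (j + i choose j) / real (N choose j) * real (N choose (j + i)) = real (N - j choose i)"
      using assms by (simp add: field_simps)
    then show "?t (j + i) = real (N - j choose i) * (backward_diff ^^ (N - j - i)) c (j + i)"
      by (simp add: hausdorff_weight_def mult.assoc[symmetric])
  qed simp
  finally show ?thesis by (simp only: sum_choose_backward_diff)
qed

lemma choose_Suc_ratio:
  assumes "j < N"
  shows "real (k choose Suc j) / real (N choose Suc j) =
         real (k choose j) / real (N choose j) * (real (k - j) / real (N - j))"
proof -
  have *: "real (n choose Suc j) * real (Suc j) = real (n choose j) * real (n - j)" for n
  proof -
    have "Suc j * (n choose Suc j) = (n - j) * (n choose j)"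
      using binomial_absorption[of j n] binomial_absorb_comp[of n j] by (simp only:)
    then have "real (Suc j * (n choose Suc j)) = real ((n - j) * (n choose j))" by (simp only:)
    then show ?thesis unfolding of_nat_mult by (simp only: mult.commute)
  qed
  have "real (n choose Suc j) = real (n choose j) * real (n - j) / real (Suc j)" for n
    using *[of n] by (simp add: field_simps del: of_nat_Suc)
  then show ?thesis by simp
qed

text \<open>The ratio is the product of the factors \<open>(k - i) / (N - i)\<close> over
  \<open>i < j\<close>, with truncated subtraction. Each factor is within \<open>J / (N - J)\<close>
  of \<open>k / N\<close>, and for products of numbers in \<open>[0, 1]\<close> the errors at most
  add up.\<close>

lemma choose_ratio_power_bound:
  assumes "k \<le> N" "J < N" "j \<le> J"
  shows "\<bar>real (k choose j) / real (N choose j) - (real k / real N) ^ j\<bar> \<le> real j * (real J / real (N - J))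
         \<and> real (k choose j) / real (N choose j) \<le> 1"
  using \<open>j \<le> J\<close>
proof (induction j)
  case 0
  then show ?case by simp
next
  case (Suc j)
  define q where "q = real (k choose j) / real (N choose j)"
  define r where "r = real (k - j) / real (N - j)"
  define y where "y = real k / real N"
  have q: "0 \<le> q" "q \<le> 1" "\<bar>q - y ^ j\<bar> \<le> real j * (real J / real (N - J))"
    using Suc by (auto simp: q_def y_def)
  have "j < N" using Suc.prems assms by simp
  have r: "0 \<le> r" "r \<le> 1" using \<open>k \<le> N\<close> \<open>j < N\<close> by (auto simp: r_def)
  have y: "0 \<le> y" "y \<le> 1" using \<open>k \<le> N\<close> \<open>j < N\<close> by (auto simp: y_def)
  have "\<bar>r - y\<bar> \<le> real j / real (N - j)"
  proof (cases "j \<le> k")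
    case True
    have "y - r = real j * (real N - real k) / (real N * (real N - real j))"
      using True \<open>j < N\<close> by (simp add: y_def r_def of_nat_diff field_simps)
    also have "\<dots> \<le> real j * real N / (real N * (real N - real j))"
      using \<open>j < N\<close> by (intro divide_right_mono mult_left_mono) auto
    also have "\<dots> = real j / real (N - j)" using \<open>j < N\<close> by (simp add: of_nat_diff)
    finally have "y - r \<le> real j / real (N - j)" .
    moreover have "0 \<le> y - r"
      unfolding \<open>y - r = _\<close> using assms \<open>j < N\<close>
      by (intro divide_nonneg_nonneg mult_nonneg_nonneg) auto
    then have "\<bar>r - y\<bar> = y - r" by simp
    ultimately show ?thesis by simp
  next
    case False
    then have "\<bar>r - y\<bar> = real k / real N" by (simp add: r_def y_def)
    also have "\<dots> \<le> real j / real (N - j)"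
      using False \<open>j < N\<close> by (intro frac_le) auto
    finally show ?thesis .
  qed
  also have "\<dots> \<le> real J / real (N - J)"
    using Suc.prems \<open>J < N\<close> by (intro frac_le) auto
  finally have ry: "\<bar>r - y\<bar> \<le> real J / real (N - J)" .
  have "q * r - y ^ Suc j = (q - y ^ j) * r + y ^ j * (r - y)" by (simp add: algebra_simps)
  also have "\<bar>\<dots>\<bar> \<le> \<bar>q - y ^ j\<bar> * r + y ^ j * \<bar>r - y\<bar>"
    using r y abs_triangle_ineq[of "(q - y ^ j) * r" "y ^ j * (r - y)"] by (simp add: abs_mult)
  also have "\<dots> \<le> \<bar>q - y ^ j\<bar> * 1 + 1 * \<bar>r - y\<bar>"
    using r y by (intro add_mono mult_left_mono mult_right_mono power_le_one) auto
  also have "\<dots> \<le> real (Suc j) * (real J / real (N - J))"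
    using q(3) ry by (simp add: algebra_simps add_divide_distrib)
  finally have "\<bar>q * r - y ^ Suc j\<bar> \<le> real (Suc j) * (real J / real (N - J))" .
  moreover have "q * r \<le> 1" using q r by (intro mult_le_one)
  ultimately show ?case
    unfolding choose_Suc_ratio[OF \<open>j < N\<close>] q_def[symmetric] r_def[symmetric] y_def[symmetric] by simp
qed

text \<open>The binomial moments are exact, so the error is the mean difference between a power and
  a binomial ratio under nonnegative weights of total mass \<open>c 0\<close>.\<close>

lemma hausdorff_moment_approx:
  assumes c: "\<And>n j. 0 \<le> (backward_diff ^^ n) c j" and "J < N" "j \<le> J"
  shows "\<bar>(\<Sum>k\<le>N. hausdorff_weight c N k * (real k / real N) ^ j) - c j\<bar> \<le> c 0 * (real j * (real J / real (N - J)))"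
proof -
  let ?w = "hausdorff_weight c N"
  have w: "0 \<le> ?w k" for k using c by (simp add: hausdorff_weight_def)
  have "(\<Sum>k\<le>N. ?w k * (real k / real N) ^ j) - c j
     = (\<Sum>k\<le>N. ?w k * ((real k / real N) ^ j - real (k choose j) / real (N choose j)))"
    using assms by (subst sum_hausdorff_weight[of j N c, symmetric])
      (auto simp: sum_subtractf[symmetric] algebra_simps)
  also have "\<bar>\<dots>\<bar> \<le> (\<Sum>k\<le>N. ?w k * (real j * (real J / real (N - J))))"
  proof (rule order_trans[OF sum_abs], rule sum_mono)
    fix k assume "k \<in> {..N}"
    then show "\<bar>?w k * ((real k / real N) ^ j - real (k choose j) / real (N choose j))\<bar> \<le> ?w k * (real j * (real J / real (N - J)))"
      using choose_ratio_power_bound[of k N J j] assms(2,3) w[of k]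
      unfolding abs_mult abs_of_nonneg[OF w] abs_minus_commute[of "_ ^ j"]
      by (intro mult_left_mono) auto
  qed
  also have "\<dots> = c 0 * (real j * (real J / real (N - J)))"
    using sum_hausdorff_weight[of 0 N c] by (subst sum_distrib_right[symmetric]) simp
  finally show ?thesis .
qed

text \<open>The values of \<open>f\<close> on a grid of mesh \<open>h\<close> are moments of an approximate measure on the nodes
  \<open>k / N = exp (- s * h)\<close>; the node \<open>k = 0\<close>, where \<open>s = \<infinity>\<close>, only affects the moment of order
  \<open>0\<close> and is dropped. Monotonicity extends the approximation from the grid to all \<open>x\<close>.\<close>

lemma exponential_sum_approximation:
  fixes f :: "real \<Rightarrow> real"
  assumes cont: "\<And>x. 0 < x \<Longrightarrow> isCont f x"
    and alt: "\<And>n h j. 0 < h \<Longrightarrow> 0 \<le> (backward_diff ^^ n) (\<lambda>i. f (real i * h)) j"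
  obtains S w where "\<And>m::nat. finite (S m)" "\<And>m s. s \<in> S m \<Longrightarrow> 0 \<le> s \<and> 0 < w m s"
    "\<And>m x. 0 \<le> x \<Longrightarrow> (\<Sum>s\<in>S m. w m s * exp (- s * x)) \<le> f 0"
    "\<And>x. 0 < x \<Longrightarrow> (\<lambda>m. \<Sum>s\<in>S m. w m s * exp (- s * x)) \<longlonglongrightarrow> f x"
proof -
  \<comment> \<open>At a fixed \<open>x\<close> the grid index is of order \<open>m\<close>, and the
    moment error is of order (index squared) / \<open>N\<close>. Taking \<open>N\<close> cubic in
    \<open>m\<close> sends both the mesh and the error to 0.\<close>
  define h where "h m = 1 / real (Suc m)" for m
  define N where "N m = Suc m ^ 3" for m
  define W where "W m = hausdorff_weight (\<lambda>i. f (real i * h m)) (N m)" for m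
  define \<sigma> where "\<sigma> m k = - ln (real k / real (N m)) / h m" for m k
  \<comment> \<open>Indices of weight 0 are dropped because the partial fraction argument asks for
    strictly positive weights.\<close>
  define I where "I m = {k\<in>{1..N m}. 0 < W m k}" for m
  define S where "S m = \<sigma> m ` I m" for m
  define w where "w m s = W m (the_inv_into (I m) (\<sigma> m) s)" for m s
  define g where "g m x = (\<Sum>k\<in>I m. W m k * exp (- \<sigma> m k * x))" for m x
  have h: "0 < h m" for m by (simp add: h_def)
  have N: "0 < N m" for m by (simp add: N_def)
  have W: "0 \<le> W m k" for m k using alt[OF h] by (simp add: W_def hausdorff_weight_def)
  have \<sigma>: "0 \<le> \<sigma> m k" if "k \<in> I m" for m k
  proof -
    have "ln (real k / real (N m)) \<le> 0"
      using that N[of m] by (subst ln_le_zero_iff) (auto simp: I_def)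
    then show ?thesis using h[of m] by (simp add: \<sigma>_def divide_nonpos_pos)
  qed
  have inj: "inj_on (\<sigma> m) (I m)" for m
    using h[of m] N[of m] by (auto simp: inj_on_def \<sigma>_def I_def)
  have g_eq: "(\<Sum>s\<in>S m. w m s * exp (- s * x)) = g m x" for m x
    unfolding S_def g_def using inj
    by (subst sum.reindex) (auto simp: w_def the_inv_into_f_f intro!: sum.cong)
  have g_mono: "g m y \<le> g m x" if "x \<le> y" for m x y
    unfolding g_def using \<sigma> W that by (intro sum_mono mult_left_mono) (auto intro: mult_left_mono)
  have g_grid: "g m (real j * h m) = (\<Sum>k\<in>{1..N m}. W m k * (real k / real (N m)) ^ j)" for m j
  proof -
    have "g m (real j * h m) = (\<Sum>k\<in>I m. W m k * (real k / real (N m)) ^ j)"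
      unfolding g_def
    proof (rule sum.cong)
      fix k assume "k \<in> I m"
      then have "0 < real k / real (N m)" using N[of m] by (simp add: I_def)
      moreover have "- \<sigma> m k * (real j * h m) = real j * ln (real k / real (N m))"
        using h[of m] by (simp add: \<sigma>_def)
      ultimately show "W m k * exp (- \<sigma> m k * (real j * h m)) = W m k * (real k / real (N m)) ^ j"
        by (metis exp_ln exp_of_nat_mult)
    qed simp
    also have "\<dots> = (\<Sum>k\<in>{1..N m}. W m k * (real k / real (N m)) ^ j)"
      using W by (intro sum.mono_neutral_left) (auto simp: I_def order.order_iff_strict)
    finally show ?thesis .
  qed
  have split0: "(\<Sum>k\<le>N m. F k) = F 0 + (\<Sum>k\<in>{1..N m}. F k)" for F :: "nat \<Rightarrow> real" and m
    by (simp add: atMost_atLeast0 sum.atLeast_Suc_atMost)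
  have bound: "g m x \<le> f 0" if "0 \<le> x" for m x
  proof -
    have "g m x \<le> g m (real 0 * h m)" using that by (intro g_mono) simp
    also have "\<dots> \<le> (\<Sum>k\<le>N m. W m k)"
      unfolding g_grid split0 using W[of m 0] by simp
    also have "\<dots> = f 0" using sum_hausdorff_weight[of 0 "N m" "\<lambda>i. f (real i * h m)"] by (simp add: W_def)
    finally show ?thesis .
  qed
  have lim: "(\<lambda>m. g m x) \<longlonglongrightarrow> f x" if x: "0 < x" for x
  proof -
    define j where "j m = nat \<lfloor>x / h m\<rfloor>" for m
    have j: "real (j m) * h m \<le> x" "x \<le> real (Suc (j m)) * h m" for m
    proof -
      have "real (j m) \<le> x / h m" "x / h m \<le> real (Suc (j m))"
        using x h[of m] by (auto simp: j_def) linarith+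
      then show "real (j m) * h m \<le> x" "x \<le> real (Suc (j m)) * h m"
        using h[of m] by (auto simp: field_simps)
    qed
    define e where "e m = f 0 * (real (Suc (j m)) * (real (Suc (j m)) / real (N m - Suc (j m))))" for m
    have h0: "h \<longlonglongrightarrow> 0" unfolding h_def by (rule LIMSEQ_Suc[OF lim_1_over_n])
    have f0: "0 \<le> f 0" using alt[of 1 0 0] by simp
    have jx: "real (Suc (j m)) \<le> (x + 1) * real (Suc m)" for m
      using j(1)[of m] by (simp add: h_def field_simps)
    have Nlarge: "eventually (\<lambda>m. Suc (j m) < N m) sequentially"
    proof -
      have "eventually (\<lambda>m. (x + 1) * real (Suc m) < real (Suc m) ^ 3) sequentially" by real_asymp
      then show ?thesis
      proof eventually_elim
        case (elim m)
        then have "real (Suc (j m)) < real (N m)" using jx[of m] by (simp add: N_def)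
        then show ?case by linarith
      qed
    qed
    have e0: "e \<longlonglongrightarrow> 0"
    proof (rule tendsto_sandwich[OF _ _ tendsto_const])
      show "eventually (\<lambda>m. 0 \<le> e m) sequentially" using f0 by (auto simp: e_def)
      have pos: "eventually (\<lambda>m. 0 < real (Suc m) ^ 3 - (x + 1) * real (Suc m)) sequentially" by real_asymp
      show "eventually (\<lambda>m. e m \<le> f 0 * (((x + 1) * real (Suc m)) * (((x + 1) * real (Suc m)) / (real (Suc m) ^ 3 - (x + 1) * real (Suc m))))) sequentially"
        using pos Nlarge
      proof eventually_elim
        case (elim m)
        have "real (Suc m) ^ 3 - (x + 1) * real (Suc m) \<le> real (N m - Suc (j m))"
          using jx[of m] elim(2) by (simp add: N_def of_nat_diff)
        with elim jx[of m] f0 x show ?case unfolding e_def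
          by (intro mult_left_mono mult_mono frac_le divide_nonneg_nonneg) auto
      qed
      have "((\<lambda>m::nat. ((x + 1) * real (Suc m)) * (((x + 1) * real (Suc m)) / (real (Suc m) ^ 3 - (x + 1) * real (Suc m)))) \<longlongrightarrow> 0) sequentially"
        by real_asymp
      from tendsto_mult[OF tendsto_const[of "f 0"] this]
      show "(\<lambda>m. f 0 * (((x + 1) * real (Suc m)) * (((x + 1) * real (Suc m)) / (real (Suc m) ^ 3 - (x + 1) * real (Suc m))))) \<longlonglongrightarrow> 0" by simp
    qed
    have approx: "eventually (\<lambda>m. \<forall>i\<in>{j m, Suc (j m)}. \<bar>(\<Sum>k\<le>N m. W m k * (real k / real (N m)) ^ i) - f (real i * h m)\<bar> \<le> e m) sequentially"
      using Nlarge
    proof eventually_elim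
      case (elim m)
      show ?case
      proof
        fix i assume i: "i \<in> {j m, Suc (j m)}"
        then have "\<bar>(\<Sum>k\<le>N m. W m k * (real k / real (N m)) ^ i) - f (real i * h m)\<bar>
           \<le> f 0 * (real i * (real (Suc (j m)) / real (N m - Suc (j m))))"
          using hausdorff_moment_approx[of "\<lambda>i. f (real i * h m)" "Suc (j m)" "N m" i, OF alt[OF h] elim]
          by (auto simp: W_def)
        also have "\<dots> \<le> e m" unfolding e_def using i f0
          by (intro mult_left_mono mult_right_mono) auto
        finally show "\<bar>(\<Sum>k\<le>N m. W m k * (real k / real (N m)) ^ i) - f (real i * h m)\<bar> \<le> e m" .
      qed
    qed
    have jx1: "(\<lambda>m. real (j m) * h m) \<longlonglongrightarrow> x"
    proof (rule tendsto_sandwich[OF _ _ _ tendsto_const])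
      show "eventually (\<lambda>m. x - h m \<le> real (j m) * h m) sequentially"
        using j(2) by (auto simp: algebra_simps)
      show "(\<lambda>m. x - h m) \<longlonglongrightarrow> x" using tendsto_diff[OF tendsto_const h0, of x] by simp
    qed (use j in auto)
    have jx2: "(\<lambda>m. real (Suc (j m)) * h m) \<longlonglongrightarrow> x"
      using tendsto_add[OF jx1 h0] by (simp add: algebra_simps)
    show ?thesis
    \<comment> \<open>Both \<open>f\<close> at the two neighbouring grid points and the monotone
      \<open>g m\<close> enclose the value at \<open>x\<close>. The lower bound uses the order
      \<open>Suc (j m)\<close>, for which the missing node 0 contributes nothing; in the upper bound
      leaving it out only decreases \<open>g m\<close>.\<close>
    proof (rule tendsto_sandwich)
      show "eventually (\<lambda>m. f (real (Suc (j m)) * h m) - e m \<le> g m x) sequentially"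
        using approx
      proof eventually_elim
        case (elim m)
        have "(\<Sum>k\<le>N m. W m k * (real k / real (N m)) ^ Suc (j m)) = g m (real (Suc (j m)) * h m)"
          unfolding split0 g_grid by simp
        moreover have "g m (real (Suc (j m)) * h m) \<le> g m x" by (rule g_mono[OF j(2)])
        ultimately show ?case using elim by force
      qed
      show "eventually (\<lambda>m. g m x \<le> f (real (j m) * h m) + e m) sequentially"
        using approx
      proof eventually_elim
        case (elim m)
        have "g m (real (j m) * h m) \<le> (\<Sum>k\<le>N m. W m k * (real k / real (N m)) ^ j m)"
          unfolding split0 g_grid using W[of m 0] by simp
        moreover have "g m x \<le> g m (real (j m) * h m)" by (rule g_mono[OF j(1)])
        ultimately show ?case using elim by force
      qed
      show "(\<lambda>m. f (real (Suc (j m)) * h m) - e m) \<longlonglongrightarrow> f x"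
        using tendsto_diff[OF isCont_tendsto_compose[OF cont[OF x] jx2] e0] by simp
      show "(\<lambda>m. f (real (j m) * h m) + e m) \<longlonglongrightarrow> f x"
        using tendsto_add[OF isCont_tendsto_compose[OF cont[OF x] jx1] e0] by simp
    qed
  qed
  show thesis
  proof
    show "finite (S m)" for m by (simp add: S_def I_def)
    show "0 \<le> s \<and> 0 < w m s" if "s \<in> S m" for m s
      using that inj[of m] \<sigma>[of _ m] by (auto simp: S_def w_def the_inv_into_f_f I_def)
  qed (use g_eq bound lim in auto)
qed

text \<open>One difference maps the sequence \<open>F\<close> to another sequence satisfying the
  same hypotheses, because \<open>(-1) ^ n * F n\<close> is nonincreasing. A general sequence
  \<open>F\<close> in place of iterated derivatives lets the induction replace it.\<close>

lemma iterated_difference_nonneg: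
  fixes F :: "nat \<Rightarrow> real \<Rightarrow> real"
  assumes "\<And>n x. 0 < x \<Longrightarrow> (F n has_real_derivative F (Suc n) x) (at x)"
    and "\<And>n x. 0 < x \<Longrightarrow> 0 \<le> (-1) ^ n * F n x" and "0 < h" "0 < x"
  shows "0 \<le> ((\<lambda>f x. f x - f (x + h)) ^^ k) (F 0) x"
  using assms(1,2,4)
proof (induction k arbitrary: F x)
  case 0
  then show ?case using "0.prems"(2)[of x 0] by simp
next
  case (Suc k)
  define G where "G n x = F n x - F n (x + h)" for n x
  have "(G n has_real_derivative G (Suc n) x) (at x)" if "0 < x" for n x
    unfolding G_def using Suc.prems(1) that \<open>0 < h\<close>
    by (intro DERIV_diff) (auto simp: DERIV_shift[symmetric])
  moreover have "0 \<le> (-1) ^ n * G n x" if "0 < x" for n x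
  proof -
    have "(-1) ^ n * F n (x + h) \<le> (-1) ^ n * F n x"
    proof (rule DERIV_nonpos_imp_nonincreasing[of x "x + h" "\<lambda>y. (-1) ^ n * F n y"])
      show "x \<le> x + h" using \<open>0 < h\<close> by simp
      fix y assume "x \<le> y" "y \<le> x + h"
      then have "0 < y" using that by simp
      then have "((\<lambda>y. (-1) ^ n * F n y) has_real_derivative (-1) ^ n * F (Suc n) y) (at y)"
        by (intro DERIV_cmult Suc.prems)
      moreover have "(-1) ^ n * F (Suc n) y \<le> 0" using Suc.prems(2)[OF \<open>0 < y\<close>, of "Suc n"] by simp
      ultimately show "\<exists>z. ((\<lambda>y. (-1) ^ n * F n y) has_real_derivative z) (at y) \<and> z \<le> 0" by blast
    qed
    then show ?thesis by (simp add: G_def right_diff_distrib)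
  qed
  ultimately have "0 \<le> ((\<lambda>f x. f x - f (x + h)) ^^ k) (G 0) x"
    using Suc.prems(3) by (rule Suc.IH)
  moreover have "G 0 = (\<lambda>x. F 0 x - F 0 (x + h))" by (auto simp: G_def)
  ultimately show ?case by (simp add: funpow_Suc_right del: funpow.simps)
qed

text \<open>The offset \<open>a\<close> will keep the grid inside the open half-line, away from a
  possible singularity of the density at 0.\<close>

lemma backward_diff_grid:
  "(backward_diff ^^ n) (\<lambda>i. f (a + real i * h)) j = ((\<lambda>f x. f x - f (x + h)) ^^ n) f (a + real j * h)"
proof (induction n arbitrary: j)
  case (Suc n)
  have "a + real (Suc j) * h = a + real j * h + h" by (simp add: algebra_simps)
  moreover have "(backward_diff ^^ Suc n) c j = (backward_diff ^^ n) c j - (backward_diff ^^ n) c (Suc j)" for c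
    unfolding funpow.simps comp_apply by (rule backward_diff_def)
  ultimately show ?case by (simp only: Suc.IH funpow.simps comp_apply)
qed simp

section \<open>Laplace exponents with completely monotone density\<close>

definition levy_kernel :: "real \<Rightarrow> real \<Rightarrow> real" where
  "levy_kernel \<theta> z = 1 - exp (- \<theta> * z) - \<theta> * z * indicator {0<..1} z"

text \<open>The parameter \<open>s\<close> is the variance, the square of the Gaussian coefficient,
  so that it can be perturbed additively.\<close>

definition levy_exponent :: "real \<Rightarrow> real \<Rightarrow> (real \<Rightarrow> real) \<Rightarrow> real \<Rightarrow> real" where
  "levy_exponent \<gamma> s f \<theta> = \<gamma> * \<theta> + s * \<theta>\<^sup>2 / 2 - (LBINT z:{0<..}. levy_kernel \<theta> z * f z)"

lemma borel_measurable_levy_kernel [measurable]: "levy_kernel \<theta> \<in> borel_measurable borel"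
  unfolding levy_kernel_def [abs_def] by measurable

lemma exp_minus_taylor1_bound:
  fixes v :: real
  assumes "0 \<le> v"
  shows "\<bar>exp (- v) - 1 + v\<bar> \<le> v\<^sup>2"
proof -
  have "exp (- v) \<le> 1 / (1 + v)"
    using exp_ge_add_one_self[of v] assms by (simp add: exp_minus field_simps)
  moreover have "1 / (1 + v) - 1 + v \<le> v\<^sup>2"
    using assms by (simp add: field_simps power2_eq_square)
  ultimately show ?thesis using exp_ge_add_one_self[of "- v"] by simp
qed

lemma levy_kernel_bound:
  assumes "0 \<le> \<theta>" "0 < z"
  shows "\<bar>levy_kernel \<theta> z\<bar> \<le> (1 + \<theta>\<^sup>2) * min 1 (z\<^sup>2)"
proof (cases "z \<le> 1")
  case True
  define v where "v = \<theta> * z"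
  have v: "0 \<le> v" using assms by (simp add: v_def)
  have "\<bar>1 - exp (- v) - v\<bar> \<le> v\<^sup>2"
    using exp_minus_taylor1_bound[OF v] by simp
  also have "\<dots> \<le> (1 + \<theta>\<^sup>2) * z\<^sup>2" by (simp add: v_def power_mult_distrib algebra_simps)
  also have "z\<^sup>2 = min 1 (z\<^sup>2)" using True assms by (simp add: power_le_one)
  finally show ?thesis using True assms by (simp add: levy_kernel_def v_def)
next
  case False
  have "\<bar>levy_kernel \<theta> z\<bar> \<le> 1" using False assms by (simp add: levy_kernel_def)
  also have "1 = min 1 (z\<^sup>2)" using False by (simp add: min_def)
  also have "\<dots> \<le> (1 + \<theta>\<^sup>2) * min 1 (z\<^sup>2)" using mult_right_mono[of 1 "1 + \<theta>\<^sup>2" "min 1 (z\<^sup>2)"] by simp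
  finally show ?thesis .
qed

lemma levy_kernel_0 [simp]: "levy_kernel 0 z = 0"
  by (simp add: levy_kernel_def)

lemma levy_exponent_0 [simp]: "levy_exponent \<gamma> s f 0 = 0"
  by (simp add: levy_exponent_def)

lemma set_integrable_levy_kernel:
  assumes "0 \<le> \<theta>" and f: "(\<lambda>z. indicator {0<..} z * f z) \<in> borel_measurable borel"
    and int: "set_integrable lborel {0<..} (\<lambda>z. min 1 (z\<^sup>2) * F z)"
    and bd: "\<And>z. 0 < z \<Longrightarrow> \<bar>f z\<bar> \<le> F z"
  shows "set_integrable lborel {0<..} (\<lambda>z. levy_kernel \<theta> z * f z)"
  unfolding set_integrable_def
proof (rule Bochner_Integration.integrable_bound)
  show "integrable lborel (\<lambda>z. (1 + \<theta>\<^sup>2) * (indicator {0<..} z *\<^sub>R (min 1 (z\<^sup>2) * F z)))"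
    using int unfolding set_integrable_def by simp
  have "(\<lambda>z. levy_kernel \<theta> z * (indicator {0<..} z * f z)) \<in> borel_measurable borel"
    using f by measurable
  then show "(\<lambda>z. indicator {0<..} z *\<^sub>R (levy_kernel \<theta> z * f z)) \<in> borel_measurable lborel"
    by (simp add: mult_ac)
  show "AE z in lborel. norm (indicator {0<..} z *\<^sub>R (levy_kernel \<theta> z * f z))
      \<le> norm ((1 + \<theta>\<^sup>2) * (indicator {0<..} z *\<^sub>R (min 1 (z\<^sup>2) * F z)))"
  proof (rule AE_I2)
    fix z :: real
    show "norm (indicator {0<..} z *\<^sub>R (levy_kernel \<theta> z * f z))
      \<le> norm ((1 + \<theta>\<^sup>2) * (indicator {0<..} z *\<^sub>R (min 1 (z\<^sup>2) * F z)))"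
    proof (cases "0 < z")
      case True
      have "\<bar>levy_kernel \<theta> z\<bar> * \<bar>f z\<bar> \<le> ((1 + \<theta>\<^sup>2) * min 1 (z\<^sup>2)) * F z"
        using levy_kernel_bound[OF \<open>0 \<le> \<theta>\<close> True] bd[OF True] by (intro mult_mono) auto
      also have "\<dots> \<le> \<bar>(1 + \<theta>\<^sup>2) * (min 1 (z\<^sup>2) * F z)\<bar>" by (simp add: mult.assoc)
      finally show ?thesis using True by (simp add: abs_mult)
    qed simp
  qed
qed

lemma levy_exponent_tendsto:
  assumes "0 \<le> \<theta>" and f: "\<And>n. (\<lambda>z. indicator {0<..} z * f n z) \<in> borel_measurable borel"
    "(\<lambda>z. indicator {0<..} z * g z) \<in> borel_measurable borel"
    and int: "set_integrable lborel {0<..} (\<lambda>z. min 1 (z\<^sup>2) * F z)"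
    and bd: "\<And>n z. 0 < z \<Longrightarrow> \<bar>f n z\<bar> \<le> F z"
    and lim: "\<And>z. 0 < z \<Longrightarrow> (\<lambda>n. f n z) \<longlonglongrightarrow> g z"
    and s: "s \<longlonglongrightarrow> s'"
  shows "(\<lambda>n. levy_exponent \<gamma> (s n) (f n) \<theta>) \<longlonglongrightarrow> levy_exponent \<gamma> s' g \<theta>"
proof -
  have bd': "\<bar>g z\<bar> \<le> F z" if "0 < z" for z
    using tendsto_rabs[OF lim[OF that]] bd[OF that] by (intro LIMSEQ_le_const2) auto
  have "(\<lambda>n. LBINT z:{0<..}. levy_kernel \<theta> z * f n z) \<longlonglongrightarrow> (LBINT z:{0<..}. levy_kernel \<theta> z * g z)"
    unfolding set_lebesgue_integral_def
  proof (rule integral_dominated_convergence)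
    show "integrable lborel (\<lambda>z. (1 + \<theta>\<^sup>2) * (indicator {0<..} z *\<^sub>R (min 1 (z\<^sup>2) * F z)))"
      using int unfolding set_integrable_def by simp
    show "(\<lambda>z. indicator {0<..} z *\<^sub>R (levy_kernel \<theta> z * f n z)) \<in> borel_measurable lborel" for n
      using set_integrable_levy_kernel[OF \<open>0 \<le> \<theta>\<close> f(1) int bd, of n]
      unfolding set_integrable_def by (rule borel_measurable_integrable)
    show "(\<lambda>z. indicator {0<..} z *\<^sub>R (levy_kernel \<theta> z * g z)) \<in> borel_measurable lborel"
      using set_integrable_levy_kernel[OF \<open>0 \<le> \<theta>\<close> f(2) int bd']
      unfolding set_integrable_def by (rule borel_measurable_integrable)
    show "AE z in lborel. (\<lambda>n. indicator {0<..} z *\<^sub>R (levy_kernel \<theta> z * f n z)) \<longlonglongrightarrow>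
        indicator {0<..} z *\<^sub>R (levy_kernel \<theta> z * g z)"
      using lim by (intro AE_I2) (auto simp: indicator_def intro!: tendsto_intros)
    show "AE z in lborel. norm (indicator {0<..} z *\<^sub>R (levy_kernel \<theta> z * f n z)) \<le>
        (1 + \<theta>\<^sup>2) * (indicator {0<..} z *\<^sub>R (min 1 (z\<^sup>2) * F z))" for n
    proof (rule AE_I2)
      fix z :: real
      show "norm (indicator {0<..} z *\<^sub>R (levy_kernel \<theta> z * f n z)) \<le>
          (1 + \<theta>\<^sup>2) * (indicator {0<..} z *\<^sub>R (min 1 (z\<^sup>2) * F z))"
      proof (cases "0 < z")
        case True
        have "\<bar>levy_kernel \<theta> z\<bar> * \<bar>f n z\<bar> \<le> ((1 + \<theta>\<^sup>2) * min 1 (z\<^sup>2)) * F z"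
          using levy_kernel_bound[OF \<open>0 \<le> \<theta>\<close> True] bd[OF True] by (intro mult_mono) auto
        then show ?thesis using True by (simp add: abs_mult mult_ac)
      qed simp
    qed
  qed
  then show ?thesis unfolding levy_exponent_def by (intro tendsto_intros s) auto
qed

lemma set_integral_exp_decay:
  assumes "0 < (a::real)"
  shows "set_integrable lborel {0<..} (\<lambda>x. exp (- a * x))" "(LBINT x:{0<..}. exp (- a * x)) = 1 / a"
  using integrable_I0i_exp_mscale[OF assms] LBINT_I0i_exp_mscale[OF assms]
  by (simp_all add: mult.commute interval_lebesgue_integral_0_infty)

lemma levy_kernel_exponential:
  assumes "0 \<le> \<theta>" "0 < t"
  shows "set_integrable lborel {0<..} (\<lambda>z. levy_kernel \<theta> z * exp (- t * z))"
    "(LBINT z:{0<..}. levy_kernel \<theta> z * exp (- t * z)) =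
       1 / t - 1 / (t + \<theta>) - \<theta> * (LBINT z:{0<..1}. z * exp (- t * z))"
proof -
  have 1: "set_integrable lborel {0<..} (\<lambda>z. exp (- t * z))" "(LBINT z:{0<..}. exp (- t * z)) = 1 / t"
    by (rule set_integral_exp_decay[OF \<open>0 < t\<close>])+
  have "0 < t + \<theta>" using assms by simp
  note 2 = set_integral_exp_decay[OF this]
  have "set_integrable lborel {0..1} (\<lambda>z::real. z * exp (- t * z))"
    by (intro borel_integrable_atLeastAtMost' continuous_intros)
  then have 3: "set_integrable lborel {0<..1} (\<lambda>z::real. z * exp (- t * z))"
    by (rule set_integrable_subset) auto
  have ind: "(\<lambda>z. indicator {0<..} z *\<^sub>R (\<theta> * (z * exp (- t * z) * indicator {0<..1} z)))
      = (\<lambda>z. \<theta> * (indicator {0<..1} z *\<^sub>R (z * exp (- t * z))))"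
    by (auto simp: indicator_def fun_eq_iff)
  have 4: "set_integrable lborel {0<..} (\<lambda>z::real. \<theta> * (z * exp (- t * z) * indicator {0<..1} z))"
    unfolding set_integrable_def ind using 3 unfolding set_integrable_def by (rule integrable_mult_right)
  have 5: "(LBINT z:{0<..}. \<theta> * (z * exp (- t * z) * indicator {0<..1} z)) = \<theta> * (LBINT z:{0<..1}. z * exp (- t * z))"
    unfolding set_lebesgue_integral_def ind by (rule integral_mult_right_zero)
  have eq: "levy_kernel \<theta> z * exp (- t * z) =
      exp (- t * z) - exp (- (t + \<theta>) * z) - \<theta> * (z * exp (- t * z) * indicator {0<..1} z)" for z
    using exp_add[of "- t * z" "- \<theta> * z"] by (simp add: levy_kernel_def algebra_simps)
  show "set_integrable lborel {0<..} (\<lambda>z. levy_kernel \<theta> z * exp (- t * z))"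
    unfolding eq by (rule set_integral_diff(1)[OF set_integral_diff(1)[OF 1(1) 2(1)] 4])
  show "(LBINT z:{0<..}. levy_kernel \<theta> z * exp (- t * z)) =
       1 / t - 1 / (t + \<theta>) - \<theta> * (LBINT z:{0<..1}. z * exp (- t * z))"
    unfolding eq set_integral_diff(2)[OF set_integral_diff(1)[OF 1(1) 2(1)] 4]
      set_integral_diff(2)[OF 1(1) 2(1)] 1(2) 2(2) 5 ..
qed

text \<open>The compensator integrals stay unevaluated: they multiply \<open>\<theta>\<close> and
  merely change the drift. The rest is rational in \<open>\<theta>\<close> with poles at the points
  \<open>- t\<close>.\<close>

lemma levy_exponent_exponential_sum:
  assumes fin: "finite T" and T: "\<And>t. t \<in> T \<Longrightarrow> 0 < t" and "0 \<le> \<theta>"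
  shows "levy_exponent \<gamma> s (\<lambda>z. \<Sum>t\<in>T. w t * exp (- t * z)) \<theta> =
     (\<gamma> + (\<Sum>t\<in>T. w t * (LBINT z:{0<..1}. z * exp (- t * z)))) * \<theta> + s * \<theta>\<^sup>2 / 2
       - (\<Sum>t\<in>T. w t * (1 / t - 1 / (t + \<theta>)))"
proof -
  have "(LBINT z:{0<..}. levy_kernel \<theta> z * (\<Sum>t\<in>T. w t * exp (- t * z)))
      = (LBINT z:{0<..}. (\<Sum>t\<in>T. w t * (levy_kernel \<theta> z * exp (- t * z))))"
    by (simp add: sum_distrib_left mult_ac)
  also have "\<dots> = (\<Sum>t\<in>T. w t * (LBINT z:{0<..}. levy_kernel \<theta> z * exp (- t * z)))"
  proof -
    have "(LBINT z:{0<..}. (\<Sum>t\<in>T. w t * (levy_kernel \<theta> z * exp (- t * z))))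
        = (LINT z|lborel. (\<Sum>t\<in>T. w t * (indicator {0<..} z *\<^sub>R (levy_kernel \<theta> z * exp (- t * z)))))"
      unfolding set_lebesgue_integral_def by (simp add: sum_distrib_left mult_ac)
    also have "\<dots> = (\<Sum>t\<in>T. (LINT z|lborel. w t * (indicator {0<..} z *\<^sub>R (levy_kernel \<theta> z * exp (- t * z)))))"
      using levy_kernel_exponential(1)[OF \<open>0 \<le> \<theta>\<close> T] unfolding set_integrable_def
      by (intro Bochner_Integration.integral_sum integrable_mult_right)
    finally show ?thesis unfolding set_lebesgue_integral_def by simp
  qed
  also have "\<dots> = (\<Sum>t\<in>T. w t * (1 / t - 1 / (t + \<theta>))) - \<theta> * (\<Sum>t\<in>T. w t * (LBINT z:{0<..1}. z * exp (- t * z)))"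
    unfolding sum_distrib_left sum_subtractf[symmetric]
    by (intro sum.cong refl, simp only: levy_kernel_exponential(2)[OF \<open>0 \<le> \<theta>\<close> T]) (simp add: algebra_simps)
  finally show ?thesis by (simp add: levy_exponent_def algebra_simps)
qed

section \<open>The Laplace exponent with its zero at \<open>l\<close> divided out, and its
  approximation\<close>

definition diff_quotient :: "(real \<Rightarrow> real) \<Rightarrow> real \<Rightarrow> real \<Rightarrow> real" where
  "diff_quotient \<psi> l x = (\<psi> x - \<psi> l) / (x - l)"

lemma reciprocal_stieltjes_cong:
  assumes "reciprocal_stieltjes l u \<kappa>" "l < u" "\<And>x. l < x \<Longrightarrow> \<kappa> x = \<kappa>' x"
  shows "reciprocal_stieltjes l u \<kappa>'"
  using assms by (auto simp: reciprocal_stieltjes_def)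

text \<open>Since \<open>1 / (t + l) - 1 / (t + x)\<close> contains the factor \<open>x - l\<close>,
  and \<open>x\<^sup>2 - l\<^sup>2\<close> does too, the quotient is a pole sum with slope
  \<open>s / 2\<close>, poles \<open>- t\<close> and weights \<open>w t / (l + t)\<close>. Its value
  at 0 is \<open>\<psi> l / l\<close>, because \<open>\<psi> 0 = 0\<close>, and right of 0 it stays
  above this value; this second claim survives limits.\<close>

lemma diff_quotient_exponential_sum:
  fixes T :: "real set" and w :: "real \<Rightarrow> real" and \<gamma> s l u x :: real
  assumes fin: "finite T" and T: "\<And>t. t \<in> T \<Longrightarrow> 0 < t \<and> 0 < w t" and "0 < s" "0 < l" "l < u"
  defines "\<psi> \<equiv> levy_exponent \<gamma> s (\<lambda>z. \<Sum>t\<in>T. w t * exp (- t * z))"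
  assumes pos: "0 < \<psi> l"
  shows "reciprocal_stieltjes l u (diff_quotient \<psi> l)" "l < x \<Longrightarrow> \<psi> l / l \<le> diff_quotient \<psi> l x"
proof -
  define P where "P = uminus ` T"
  define v where "v p = w (- p) / (l - p)" for p
  define \<gamma>' where "\<gamma>' = \<gamma> + (\<Sum>t\<in>T. w t * (LBINT z:{0<..1}. z * exp (- t * z)))"
  define G where "G = pole_sum (\<gamma>' + s * l / 2) (s / 2) v P"
  have P: "finite P" "\<And>p. p \<in> P \<Longrightarrow> 0 < v p" "\<And>p. p \<in> P \<Longrightarrow> p < 0"
    using fin T \<open>0 < l\<close> by (auto simp: P_def v_def add_pos_pos)
  have G: "diff_quotient \<psi> l x = G x" if "0 \<le> x" "x \<noteq> l" for x
  proof -
    have "\<psi> x - \<psi> l = \<gamma>' * (x - l) + s * (x\<^sup>2 - l\<^sup>2) / 2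
       - (\<Sum>t\<in>T. w t * (1 / t - 1 / (t + x)) - w t * (1 / t - 1 / (t + l)))"
      unfolding \<psi>_def using T that \<open>0 < l\<close>
      by (subst (1 2) levy_exponent_exponential_sum[OF fin])
         (auto simp: \<gamma>'_def sum_subtractf diff_divide_distrib algebra_simps)
    also have "(\<Sum>t\<in>T. w t * (1 / t - 1 / (t + x)) - w t * (1 / t - 1 / (t + l)))
       = (\<Sum>t\<in>T. (x - l) * (w t / (l + t) / (x + t)))"
    proof (rule sum.cong)
      fix t assume "t \<in> T"
      then have "0 < t + x" "0 < t + l" using T[of t] that \<open>0 < l\<close> by auto
      then have "1 / (t + l) - 1 / (t + x) = (x - l) * (1 / (l + t) / (x + t))"
        by (simp add: divide_simps) (simp add: algebra_simps)
      moreover have "w t * (1 / t - 1 / (t + x)) - w t * (1 / t - 1 / (t + l)) = w t * (1 / (t + l) - 1 / (t + x))"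
        by (simp add: right_diff_distrib)
      ultimately show "w t * (1 / t - 1 / (t + x)) - w t * (1 / t - 1 / (t + l)) = (x - l) * (w t / (l + t) / (x + t))"
        by simp
    qed simp
    also have "\<dots> = (x - l) * (\<Sum>p\<in>P. v p / (x - p))"
      by (simp add: P_def sum.reindex v_def sum_distrib_left)
    also have "\<gamma>' * (x - l) + s * (x\<^sup>2 - l\<^sup>2) / 2 - \<dots> = (x - l) * G x"
      by (simp add: G_def pole_sum_def power2_eq_square) (simp add: field_simps)
    finally show ?thesis using that by (simp add: diff_quotient_def)
  qed
  have "\<psi> 0 = 0" by (simp add: \<psi>_def)
  then have G0: "G 0 = \<psi> l / l" using G[of 0] \<open>0 < l\<close> by (simp add: diff_quotient_def)
  then have "0 < G 0" using pos \<open>0 < l\<close> by simp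
  then have "0 < pole_sum (\<gamma>' + s * l / 2) (s / 2) v P 0" by (simp only: G_def)
  from inverse_pole_sum[where P = P and w = v, OF P(1) P(2) half_gt_zero[OF \<open>0 < s\<close>] P(3) this] obtain R c where R: "finite R" "\<And>r. r \<in> R \<Longrightarrow> r < 0 \<and> 0 \<le> c r"
    "\<And>x. 0 < x \<Longrightarrow> 0 < G x \<and> 1 / G x = (\<Sum>r\<in>R. c r / (x - r))"
    unfolding G_def by blast
  have "reciprocal_stieltjes l u G"
    using R \<open>0 < l\<close> \<open>l < u\<close> by (intro reciprocal_stieltjes_finite_sum[of R c]) auto
  then show "reciprocal_stieltjes l u (diff_quotient \<psi> l)"
    using \<open>l < u\<close> G \<open>0 < l\<close> by (elim reciprocal_stieltjes_cong) auto
  show "\<psi> l / l \<le> diff_quotient \<psi> l x" if "l < x"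
  proof -
    have "0 \<notin> P" "x \<notin> P" using P(3) that \<open>0 < l\<close> by force+
    have "0 \<le> (x - 0) * (s / 2 + (\<Sum>p\<in>P. v p / ((x - p) * (0 - p))))"
    proof (intro mult_nonneg_nonneg add_nonneg_nonneg sum_nonneg divide_nonneg_nonneg)
      fix p assume "p \<in> P"
      then show "0 \<le> v p" "0 \<le> x - p" "0 \<le> 0 - p" using P(2,3)[of p] that \<open>0 < l\<close> by auto
    qed (use that \<open>0 < l\<close> \<open>0 < s\<close> in auto)
    then show ?thesis
      using pole_sum_diff[OF \<open>0 \<notin> P\<close> \<open>x \<notin> P\<close>, of "\<gamma>' + s * l / 2" "s / 2" v] G[of x] that \<open>0 < l\<close> G0
      by (simp add: G_def)
  qed
qed

text \<open>All approximants are divided at the same point \<open>l\<close>, whatever their value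
  there, so the roots of the approximants need not be followed. Their values at \<open>l\<close> are
  positive only from some index on, hence the shift by \<open>N\<close>.\<close>

lemma diff_quotient_limit:
  assumes st: "\<And>n. 0 < \<psi>s n l \<Longrightarrow> reciprocal_stieltjes l u (diff_quotient (\<psi>s n) l)"
    and lim: "\<And>x. 0 \<le> x \<Longrightarrow> (\<lambda>n. \<psi>s n x) \<longlonglongrightarrow> \<psi> x"
    and "0 < l" "l < u" "0 < \<psi> l" and pos: "\<And>x. l < x \<Longrightarrow> \<psi> l < \<psi> x"
  shows "reciprocal_stieltjes l u (diff_quotient \<psi> l)"
proof -
  have "eventually (\<lambda>n. 0 < \<psi>s n l) sequentially"
    using order_tendstoD(1)[OF lim[of l] \<open>0 < \<psi> l\<close>] \<open>0 < l\<close> by simp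
  then obtain N where N: "\<And>n. N \<le> n \<Longrightarrow> 0 < \<psi>s n l" by (auto simp: eventually_sequentially)
  show ?thesis
  proof (rule reciprocal_stieltjes_limit)
    show "reciprocal_stieltjes l u (diff_quotient (\<psi>s (n + N)) l)" for n
      using N by (intro st) simp
    fix x assume x: "l < x"
    show "(\<lambda>n. diff_quotient (\<psi>s (n + N)) l x) \<longlonglongrightarrow> diff_quotient \<psi> l x"
      unfolding diff_quotient_def using x \<open>0 < l\<close> LIMSEQ_ignore_initial_segment[OF lim, of _ N]
      by (intro tendsto_divide tendsto_diff tendsto_const) auto
    show "0 < diff_quotient \<psi> l x" using pos[OF x] x by (simp add: diff_quotient_def)
  qed (use assms in auto)
qed

text \<open>The factor \<open>exp (- \<epsilon> * z)\<close> has two effects: it moves every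
  exponent to a strictly positive one (the node \<open>k = N\<close> yields the exponent 0), and it
  makes \<open>f 0 * exp (- \<epsilon> * z)\<close> an integrable majorant of all the approximating
  sums.\<close>

lemma reciprocal_stieltjes_bounded_density:
  fixes f :: "real \<Rightarrow> real" and \<gamma> s l u \<epsilon> :: real
  assumes cont: "\<And>x. 0 < x \<Longrightarrow> isCont f x"
    and alt: "\<And>n h j. 0 < h \<Longrightarrow> 0 \<le> (backward_diff ^^ n) (\<lambda>i. f (real i * h)) j"
    and "0 < \<epsilon>" "0 < s" "0 < l" "l < u"
  defines "\<psi> \<equiv> levy_exponent \<gamma> s (\<lambda>z. exp (- \<epsilon> * z) * f z)"
  assumes pos: "0 < \<psi> l"
  shows "reciprocal_stieltjes l u (diff_quotient \<psi> l)"
proof -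
  obtain S w where S: "\<And>m::nat. finite (S m)" "\<And>m s. s \<in> S m \<Longrightarrow> 0 \<le> s \<and> 0 < w m s"
    "\<And>m x. 0 \<le> x \<Longrightarrow> (\<Sum>s\<in>S m. w m s * exp (- s * x)) \<le> f 0"
    "\<And>x. 0 < x \<Longrightarrow> (\<lambda>m. \<Sum>s\<in>S m. w m s * exp (- s * x)) \<longlonglongrightarrow> f x"
    using exponential_sum_approximation[OF cont alt] by blast
  define T where "T m = (\<lambda>s. s + \<epsilon>) ` S m" for m
  define v where "v m t = w m (t - \<epsilon>)" for m t
  define g where "g m z = (\<Sum>t\<in>T m. v m t * exp (- t * z))" for m z
  define \<psi>s where "\<psi>s m = levy_exponent \<gamma> s (g m)" for m
  have g: "g m z = exp (- \<epsilon> * z) * (\<Sum>s\<in>S m. w m s * exp (- s * z))" for m z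
    unfolding g_def T_def v_def
    by (subst sum.reindex) (auto simp: inj_on_def sum_distrib_left algebra_simps exp_add[symmetric] intro!: sum.cong)
  have T: "finite (T m)" "\<And>t. t \<in> T m \<Longrightarrow> 0 < t \<and> 0 < v m t" for m
    using S(1)[of m] S(2)[of _ m] \<open>0 < \<epsilon>\<close> by (auto simp: T_def v_def add_nonneg_pos)
  have f_meas: "(\<lambda>z. indicator {0<..} z * (exp (- \<epsilon> * z) * f z)) \<in> borel_measurable borel"
  proof -
    have "continuous_on {0<..} (\<lambda>z. exp (- \<epsilon> * z) * f z)"
      using cont by (intro continuous_at_imp_continuous_on ballI continuous_intros) auto
    from borel_measurable_continuous_on_indicator[OF _ this] show ?thesis by simp
  qed
  have f0: "0 \<le> f 0" using alt[of 1 0 0] by simp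
  have int: "set_integrable lborel {0<..} (\<lambda>z. min 1 (z\<^sup>2) * (f 0 * exp (- \<epsilon> * z)))"
  proof -
    have "set_integrable lborel {0<..} (\<lambda>z. f 0 * exp (- \<epsilon> * z))"
      using set_integral_exp_decay(1)[OF \<open>0 < \<epsilon>\<close>] by simp
    then show ?thesis
      by (rule set_integrable_bound)
         (use f0 in \<open>auto simp: set_borel_measurable_def abs_mult mult_left_le_one_le\<close>)
  qed
  have lim: "(\<lambda>m. \<psi>s m x) \<longlonglongrightarrow> \<psi> x" if "0 \<le> x" for x
    unfolding \<psi>s_def \<psi>_def
  proof (rule levy_exponent_tendsto[OF that _ f_meas int _ _ tendsto_const])
    show "(\<lambda>z. indicator {0<..} z * g m z) \<in> borel_measurable borel" for m
      unfolding g_def by measurable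
    fix z :: real assume z: "0 < z"
    show "\<bar>g m z\<bar> \<le> f 0 * exp (- \<epsilon> * z)" for m
    proof -
      have "0 \<le> (\<Sum>s\<in>S m. w m s * exp (- s * z))"
        using S(2) by (intro sum_nonneg mult_nonneg_nonneg) (auto simp: less_imp_le)
      then show ?thesis using S(3)[of z m] z by (simp add: g abs_mult mult.commute)
    qed
    show "(\<lambda>m. g m z) \<longlonglongrightarrow> exp (- \<epsilon> * z) * f z"
      unfolding g by (intro tendsto_intros S(4) z)
  qed
  \<comment> \<open>The weak inequality between \<open>\<psi>s m l / l\<close> and the quotient
    passes to the limit, and \<open>\<psi> l > 0\<close> makes the conclusion strict.\<close>
  have pos': "\<psi> l < \<psi> x" if x: "l < x" for x
  proof -
    have "eventually (\<lambda>m. 0 < \<psi>s m l) sequentially"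
      using order_tendstoD(1)[OF lim[of l] pos] \<open>0 < l\<close> by simp
    then have "eventually (\<lambda>m. \<psi>s m l / l \<le> diff_quotient (\<psi>s m) l x) sequentially"
    proof eventually_elim
      case (elim m)
      then show ?case
        unfolding \<psi>s_def g_def [abs_def]
        by (intro diff_quotient_exponential_sum(2)[OF T \<open>0 < s\<close> \<open>0 < l\<close> \<open>l < u\<close> _ x])
    qed
    moreover have "(\<lambda>m. \<psi>s m l / l) \<longlonglongrightarrow> \<psi> l / l"
      using \<open>0 < l\<close> by (intro tendsto_intros lim) auto
    moreover have "(\<lambda>m. diff_quotient (\<psi>s m) l x) \<longlonglongrightarrow> diff_quotient \<psi> l x"
      unfolding diff_quotient_def using x \<open>0 < l\<close>
      by (intro tendsto_divide tendsto_diff tendsto_const lim) auto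
    ultimately have "\<psi> l / l \<le> diff_quotient \<psi> l x"
      by (intro tendsto_le[OF trivial_limit_sequentially]) auto
    moreover have "0 < \<psi> l / l" using pos \<open>0 < l\<close> by simp
    ultimately have "0 < diff_quotient \<psi> l x" by linarith
    then show ?thesis using x by (simp add: diff_quotient_def zero_less_divide_iff)
  qed
  show ?thesis
  proof (rule diff_quotient_limit[where \<psi>s = \<psi>s, OF _ lim \<open>0 < l\<close> \<open>l < u\<close> pos pos'])
    fix m assume "0 < \<psi>s m l"
    then show "reciprocal_stieltjes l u (diff_quotient (\<psi>s m) l)"
      unfolding \<psi>s_def g_def [abs_def]
      by (intro diff_quotient_exponential_sum(1)[OF T \<open>0 < s\<close> \<open>0 < l\<close> \<open>l < u\<close>])
  qed
qed

lemma completely_monotone_on_antimono: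
  assumes "completely_monotone_on {0<..} f" "0 < x" "x \<le> y"
  shows "f y \<le> f x" "0 \<le> f x"
proof -
  have D: "(f has_real_derivative deriv f t) (at t)" "deriv f t \<le> 0" "0 \<le> f t" if "0 < t" for t
  proof -
    have "(deriv ^^ 0) f field_differentiable at t" "0 \<le> (-1) ^ 1 * (deriv ^^ 1) f t" "0 \<le> (-1) ^ 0 * (deriv ^^ 0) f t"
      using assms(1) that unfolding completely_monotone_on_def infinitely_differentiable_on_def by blast+
    then show "(f has_real_derivative deriv f t) (at t)" "deriv f t \<le> 0" "0 \<le> f t"
      by (auto simp: DERIV_deriv_iff_field_differentiable)
  qed
  show "f y \<le> f x"
  proof (rule DERIV_nonpos_imp_nonincreasing[OF \<open>x \<le> y\<close>])
    fix t assume "x \<le> t"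
    then have "0 < t" using assms(2) by simp
    then show "\<exists>z. (f has_real_derivative z) (at t) \<and> z \<le> 0" using D by blast
  qed
  show "0 \<le> f x" using D assms(2) by blast
qed

lemma completely_monotone_on_isCont:
  assumes "completely_monotone_on {0<..} f" "0 < x"
  shows "isCont f x"
proof -
  have "(deriv ^^ 0) f field_differentiable at x"
    using assms unfolding completely_monotone_on_def infinitely_differentiable_on_def by blast
  then show ?thesis by (simp add: field_differentiable_imp_continuous_at)
qed

text \<open>The density is replaced by \<open>exp (- \<epsilon> * z) * f (\<epsilon> + z)\<close>, which is bounded and integrable, and the
  Gaussian part by \<open>s + \<epsilon>\<close>, because the partial fractions need a positive leading coefficient.\<close>

lemma reciprocal_stieltjes_completely_monotone:
  fixes f :: "real \<Rightarrow> real" and \<gamma> s l u :: real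
  assumes cm: "completely_monotone_on {0<..} f"
    and int: "set_integrable lborel {0<..} (\<lambda>z. min 1 (z\<^sup>2) * f z)"
    and "0 \<le> s" "0 < l" "l < u"
  defines "\<psi> \<equiv> levy_exponent \<gamma> s f"
  assumes pos: "0 < \<psi> l" and mono: "\<And>x. l < x \<Longrightarrow> \<psi> l < \<psi> x"
  shows "reciprocal_stieltjes l u (diff_quotient \<psi> l)"
proof -
  define \<epsilon> where "\<epsilon> n = 1 / real (Suc n)" for n
  have \<epsilon>: "0 < \<epsilon> n" for n by (simp add: \<epsilon>_def)
  have \<epsilon>0: "\<epsilon> \<longlonglongrightarrow> 0" unfolding \<epsilon>_def by (rule LIMSEQ_Suc[OF lim_1_over_n])
  define g where "g n z = exp (- \<epsilon> n * z) * f (\<epsilon> n + z)" for n z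
  have cont: "isCont f x" if "0 < x" for x by (rule completely_monotone_on_isCont[OF cm that])
  show ?thesis
  proof (rule diff_quotient_limit[where \<psi>s = "\<lambda>n. levy_exponent \<gamma> (s + \<epsilon> n) (g n)"])
    fix n assume *: "0 < levy_exponent \<gamma> (s + \<epsilon> n) (g n) l"
    have "0 \<le> (backward_diff ^^ k) (\<lambda>i. f (\<epsilon> n + real i * h)) j" if "0 < h" for k h j
      unfolding backward_diff_grid
    proof (rule iterated_difference_nonneg[where F="\<lambda>n. (deriv ^^ n) f", simplified funpow_0])
      fix m and x :: real assume "0 < x"
      then have "(deriv ^^ m) f field_differentiable at x" "0 \<le> (-1) ^ m * (deriv ^^ m) f x"
        using cm unfolding completely_monotone_on_def infinitely_differentiable_on_def by blast+
      then show "((deriv ^^ m) f has_real_derivative (deriv ^^ Suc m) f x) (at x)"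
        "0 \<le> (-1) ^ m * (deriv ^^ m) f x"
        by (auto simp: DERIV_deriv_iff_field_differentiable)
    qed (use that \<epsilon>[of n] in \<open>auto intro: add_pos_nonneg\<close>)
    moreover have "isCont (\<lambda>z. f (\<epsilon> n + z)) x" if "0 < x" for x
      using that \<epsilon>[of n] by (intro isCont_o2[OF _ cont] continuous_intros) auto
    ultimately show "reciprocal_stieltjes l u (diff_quotient (levy_exponent \<gamma> (s + \<epsilon> n) (g n)) l)"
      using * \<epsilon>[of n] assms(3-5) unfolding g_def [abs_def]
      by (intro reciprocal_stieltjes_bounded_density) (auto intro: add_nonneg_pos)
  next
    fix x :: real assume "0 \<le> x"
    show "(\<lambda>n. levy_exponent \<gamma> (s + \<epsilon> n) (g n) x) \<longlonglongrightarrow> \<psi> x"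
      unfolding \<psi>_def
    proof (rule levy_exponent_tendsto[OF \<open>0 \<le> x\<close> _ _ int])
      show "(\<lambda>z. indicator {0<..} z * g n z) \<in> borel_measurable borel" for n
      proof -
        have "isCont (g n) z" if "0 < z" for z
          unfolding g_def using that \<epsilon>[of n] by (intro continuous_intros isCont_o2[OF _ cont]) auto
        then have "continuous_on {0<..} (g n)" by (intro continuous_at_imp_continuous_on) auto
        from borel_measurable_continuous_on_indicator[OF _ this] show ?thesis by simp
      qed
      have "continuous_on {0<..} f" using cont by (intro continuous_at_imp_continuous_on) auto
      from borel_measurable_continuous_on_indicator[OF _ this]
      show "(\<lambda>z. indicator {0<..} z * f z) \<in> borel_measurable borel" by simp
      fix z :: real assume z: "0 < z"
      \<comment> \<open>Damping and shifting to the right both decrease \<open>f\<close>, so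
        \<open>f\<close> itself dominates every approximation.\<close>
      show "\<bar>g n z\<bar> \<le> f z" for n
      proof -
        have "f (\<epsilon> n + z) \<le> f z" "0 \<le> f (\<epsilon> n + z)"
          using \<epsilon>[of n] z by (auto intro!: completely_monotone_on_antimono[OF cm])
        moreover have "exp (- \<epsilon> n * z) \<le> 1" using \<epsilon>[of n] z by simp
        ultimately show ?thesis unfolding g_def abs_mult
          using mult_mono[of "exp (- \<epsilon> n * z)" 1 "f (\<epsilon> n + z)" "f z"] by simp
      qed
      have "(\<lambda>n. \<epsilon> n + z) \<longlonglongrightarrow> z" using tendsto_add[OF \<epsilon>0 tendsto_const, of z] by simp
      from isCont_tendsto_compose[OF cont[OF z] this]
      have "(\<lambda>n. exp (- \<epsilon> n * z) * f (\<epsilon> n + z)) \<longlonglongrightarrow> exp (- 0 * z) * f z"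
        by (intro tendsto_intros \<epsilon>0)
      then show "(\<lambda>n. g n z) \<longlonglongrightarrow> f z" by (simp add: g_def)
    next
      show "(\<lambda>n. s + \<epsilon> n) \<longlonglongrightarrow> s" using tendsto_add[OF tendsto_const \<epsilon>0, of s] by simp
    qed
  qed (use assms in auto)
qed

section \<open>Mixtures of exponentials and their Laplace transforms\<close>

text \<open>A consequence of \<open>(1 + t * c / k) ^ k \<le> exp (t * c)\<close>. It gives finite
  derivatives of mixtures at positive arguments although the measure may have no moments.\<close>

lemma power_exp_bound:
  assumes "0 < c" "0 \<le> t"
  shows "t ^ k * exp (- t * c) \<le> (real k / c) ^ k"
proof (cases "k = 0")
  case True
  then show ?thesis using assms by simp
next
  case False
  have "t ^ k \<le> (real k / c * (1 + t * c / real k)) ^ k"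
    using assms False by (intro power_mono) (auto simp: field_simps)
  also have "\<dots> = (real k / c) ^ k * (1 + t * c / real k) ^ k" by (rule power_mult_distrib)
  also have "\<dots> \<le> (real k / c) ^ k * exp (t * c)"
  proof (intro mult_left_mono exp_ge_one_plus_x_over_n_power_n)
    show "- real k \<le> t * c" by (rule order_trans[of _ 0]) (use assms in auto)
  qed (use assms False in auto)
  finally have "t ^ k * exp (- t * c) \<le> (real k / c) ^ k * exp (t * c) * exp (- t * c)"
    by (intro mult_right_mono) auto
  then show ?thesis by (simp add: mult.assoc exp_add[symmetric])
qed

text \<open>The term \<open>exp (- v)\<close> on the right covers negative \<open>v\<close>, which
  occurs when a difference quotient is taken from the left.\<close>

lemma exp_taylor1_bound:
  fixes v :: real
  shows "\<bar>exp (- v) - 1 + v\<bar> \<le> v\<^sup>2 * (1 + exp (- v))"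
proof (cases "0 \<le> v")
  case True
  have "\<bar>exp (- v) - 1 + v\<bar> \<le> v\<^sup>2" by (rule exp_minus_taylor1_bound[OF True])
  also have "\<dots> \<le> v\<^sup>2 * (1 + exp (- v))" by (simp add: algebra_simps)
  finally show ?thesis .
next
  case False
  define r where "r = - v"
  have r: "0 < r" using False by (simp add: r_def)
  have "(1 - r) * exp r \<le> exp (- r) * exp r"
    using exp_ge_add_one_self[of "- r"] by (intro mult_right_mono) auto
  then have 1: "exp r - 1 \<le> r * exp r" by (simp add: exp_add[symmetric] algebra_simps)
  then have "r * (exp r - 1) \<le> r * (r * exp r)" using r by (intro mult_left_mono) auto
  with 1 have "exp r - 1 - r \<le> r\<^sup>2 * exp r" by (simp add: power2_eq_square algebra_simps)
  also have "\<dots> \<le> r\<^sup>2 * (1 + exp r)" by (intro mult_left_mono) auto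
  finally show ?thesis using exp_ge_add_one_self[of r] by (simp add: r_def)
qed

lemma exp_strict_convex:
  fixes a b u :: real
  assumes "0 < u" "u < 1" "a \<noteq> b"
  shows "exp ((1 - u) * a + u * b) < (1 - u) * exp a + u * exp b"
proof -
  define m where "m = (1 - u) * a + u * b"
  have ne: "a - m \<noteq> 0" "b - m \<noteq> 0"
  proof -
    have "a - m = u * (a - b)" "b - m = (1 - u) * (b - a)" by (simp_all add: m_def algebra_simps)
    then show "a - m \<noteq> 0" "b - m \<noteq> 0" using assms by auto
  qed
  have "1 + (a - m) < exp (a - m)" "1 + (b - m) < exp (b - m)"
    using exp_minus_greater[of "- (a - m)"] exp_minus_greater[of "- (b - m)"] ne by auto
  then have "(1 - u) * (1 + (a - m)) + u * (1 + (b - m)) < (1 - u) * exp (a - m) + u * exp (b - m)"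
    using assms by (intro add_strict_mono mult_strict_left_mono) auto
  moreover have "(1 - u) * (1 + (a - m)) + u * (1 + (b - m)) = 1" by (simp add: m_def algebra_simps)
  ultimately have "1 * exp m < ((1 - u) * exp (a - m) + u * exp (b - m)) * exp m"
    by (intro mult_strict_right_mono) auto
  also have "\<dots> = (1 - u) * exp a + u * exp b"
    by (simp add: algebra_simps exp_add[symmetric])
  finally show ?thesis by (simp add: m_def)
qed

locale exponential_mixture = finite_measure \<mu> for \<mu> :: "real measure" +
  assumes sets_borel: "sets \<mu> = sets borel" and nonneg: "AE t in \<mu>. 0 \<le> t"
begin

lemma borel_measurable_eq [simp]: "borel_measurable \<mu> = borel_measurable borel"
  by (rule measurable_cong_sets[OF sets_borel refl])

lemma integrable_bounded:
  assumes "f \<in> borel_measurable borel" "\<And>t. 0 \<le> t \<Longrightarrow> \<bar>f t\<bar> \<le> (B::real)"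
  shows "integrable \<mu> f"
  using assms by (intro integrable_const_bound[of _ B] eventually_mono[OF nonneg]) auto

definition mix :: "(real \<Rightarrow> real) \<Rightarrow> real \<Rightarrow> real" where
  "mix w x = (LINT t|\<mu>. w t * exp (- t * x))"

lemma integrable_mix:
  assumes w: "w \<in> borel_measurable borel" "\<And>t. 0 \<le> t \<Longrightarrow> \<bar>w t\<bar> \<le> B" and "0 \<le> x"
  shows "integrable \<mu> (\<lambda>t. w t * exp (- t * x))"
proof (rule integrable_bounded)
  show "\<bar>w t * exp (- t * x)\<bar> \<le> B" if "0 \<le> t" for t
  proof -
    have "\<bar>w t\<bar> * exp (- t * x) \<le> B * 1"
      using w(2)[OF that] that \<open>0 \<le> x\<close> by (intro mult_mono) auto
    then show ?thesis by (simp add: abs_mult)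
  qed
qed (use w(1) in measurable)

lemma mix_nonneg:
  assumes "\<And>t. 0 \<le> t \<Longrightarrow> 0 \<le> w t"
  shows "0 \<le> mix w x"
  unfolding mix_def by (intro integral_nonneg_AE eventually_mono[OF nonneg]) (simp add: assms)

text \<open>By Fubini, integrating \<open>exp (- (a + t) * y)\<close> over \<open>y\<close> only
  changes the weight, by the factor \<open>1 / (a + t)\<close>. The shift \<open>b\<close> allows
  the same fact to serve for \<open>W\<close>, for the tail integral in \<open>Z\<close> and for
  \<open>h\<close>.\<close>

lemma mix_laplace:
  assumes w: "w \<in> borel_measurable borel" "\<And>t. 0 \<le> t \<Longrightarrow> 0 \<le> w t \<and> w t \<le> B"
    and "0 < a" "0 \<le> b"
  shows "set_integrable lborel {0<..} (\<lambda>y. exp (- a * y) * mix w (b + y))"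
    "(LBINT y:{0<..}. exp (- a * y) * mix w (b + y)) = mix (\<lambda>t. w t / (a + t)) b"
proof -
  interpret P: pair_sigma_finite \<mu> lborel ..
  define g where "g t y = indicator {0<..} y * (exp (- a * y) * (w t * exp (- t * (b + y))))" for t y :: real
  have [measurable]: "w \<in> borel_measurable \<mu>" using w(1) by simp
  have ident[measurable]: "(\<lambda>t. t) \<in> borel_measurable \<mu>" by simp
  have B: "0 \<le> B" using w(2)[of 0] by simp
  have g_eq: "g t y = w t * exp (- t * b) * (indicator {0<..} y *\<^sub>R exp (- (a + t) * y))" for t y
    by (simp add: g_def algebra_simps exp_add[symmetric] exp_diff exp_minus)
  have inner: "integrable lborel (g t)" "(LINT y|lborel. g t y) = w t / (a + t) * exp (- t * b)"
    if "0 \<le> t" for t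
  proof -
    have "0 < a + t" using that \<open>0 < a\<close> by simp
    note E = set_integral_exp_decay[OF this]
    show "integrable lborel (g t)"
      unfolding g_eq [abs_def] using E(1) unfolding set_integrable_def by (rule integrable_mult_right)
    show "(LINT y|lborel. g t y) = w t / (a + t) * exp (- t * b)"
      unfolding g_eq using E(2) unfolding set_lebesgue_integral_def by simp
  qed
  have bd: "\<bar>w t / (a + t)\<bar> \<le> B / a" if "0 \<le> t" for t
    using w(2)[OF that] that \<open>0 < a\<close> B by (simp add: frac_le)
  have w': "(\<lambda>t. w t / (a + t)) \<in> borel_measurable borel" using w(1) by measurable
  have int_g: "integrable (\<mu> \<Otimes>\<^sub>M lborel) (\<lambda>(t, y). g t y)"
  proof (rule P.Fubini_integrable)
    show "(\<lambda>(t, y). g t y) \<in> borel_measurable (\<mu> \<Otimes>\<^sub>M lborel)"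
      unfolding g_def by measurable
    have *: "(LINT y|lborel. norm (case (t, y) of (t, y) \<Rightarrow> g t y)) = w t / (a + t) * exp (- t * b)" if "0 \<le> t" for t
    proof -
      have "norm (case (t, y) of (t, y) \<Rightarrow> g t y) = g t y" for y
        using w(2)[OF that] by (simp add: g_def indicator_def)
      then show ?thesis using inner(2)[OF that] by simp
    qed
    show "integrable \<mu> (\<lambda>t. LINT y|lborel. norm (case (t, y) of (t, y) \<Rightarrow> g t y))"
    proof (rule integrable_cong_AE_imp[OF integrable_mix[OF w' bd \<open>0 \<le> b\<close>]])
      show "(\<lambda>t. LINT y|lborel. norm (case (t, y) of (t, y) \<Rightarrow> g t y)) \<in> borel_measurable \<mu>"
        unfolding g_def by measurable
      show "AE t in \<mu>. w t / (a + t) * exp (- t * b) = (LINT y|lborel. norm (case (t, y) of (t, y) \<Rightarrow> g t y))"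
        by (intro eventually_mono[OF nonneg]) (simp only: *)
    qed
    show "AE t in \<mu>. integrable lborel (\<lambda>y. case (t, y) of (t, y) \<Rightarrow> g t y)"
      by (intro eventually_mono[OF nonneg]) (simp add: inner(1))
  qed
  have outer: "(LINT t|\<mu>. g t y) = indicator {0<..} y *\<^sub>R (exp (- a * y) * mix w (b + y))" for y
    by (simp add: g_def mix_def)
  show "set_integrable lborel {0<..} (\<lambda>y. exp (- a * y) * mix w (b + y))"
    unfolding set_integrable_def outer[symmetric] using P.integrable_snd[OF int_g] .
  have "(LBINT y:{0<..}. exp (- a * y) * mix w (b + y)) = (LINT t|\<mu>. LINT y|lborel. g t y)"
    unfolding set_lebesgue_integral_def outer[symmetric] by (rule P.Fubini_integral[OF int_g])
  also have "\<dots> = mix (\<lambda>t. w t / (a + t)) b"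
    unfolding mix_def
  proof (intro integral_cong_AE eventually_mono[OF nonneg])
    show "(\<lambda>t. LINT y|lborel. g t y) \<in> borel_measurable \<mu>" unfolding g_def by measurable
  qed (use w(1) in \<open>simp_all add: inner(2)\<close>)
  finally show "(LBINT y:{0<..}. exp (- a * y) * mix w (b + y)) = mix (\<lambda>t. w t / (a + t)) b" .
qed

lemma integrable_mix_power:
  assumes w: "w \<in> borel_measurable borel" "\<And>t. 0 \<le> t \<Longrightarrow> \<bar>w t\<bar> \<le> B" and "0 < x"
  shows "integrable \<mu> (\<lambda>t. t ^ n * w t * exp (- t * x))"
proof (rule integrable_bounded)
  show "\<bar>t ^ n * w t * exp (- t * x)\<bar> \<le> B * (real n / x) ^ n" if "0 \<le> t" for t
  proof -
    have "\<bar>t ^ n * w t * exp (- t * x)\<bar> = \<bar>w t\<bar> * (t ^ n * exp (- t * x))"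
      using that by (simp add: abs_mult)
    also have "\<dots> \<le> B * (real n / x) ^ n"
      using w(2)[OF that] power_exp_bound[OF \<open>0 < x\<close> that, of n] that by (intro mult_mono) auto
    finally show ?thesis .
  qed
qed (use w(1) in measurable)

text \<open>Differentiation under the integral sign through a Taylor remainder of order
  \<open>(y - x)\<^sup>2\<close>. For \<open>y > x / 2\<close> all exponentials involved are at most
  \<open>exp (- t * (x / 2))\<close>, which also absorbs the power \<open>t ^ (n + 2)\<close>; hence
  the constant \<open>C\<close>.\<close>

lemma has_real_derivative_mix:
  assumes w: "w \<in> borel_measurable borel" "\<And>t. 0 \<le> t \<Longrightarrow> \<bar>w t\<bar> \<le> B" and x: "0 < x"
  shows "(mix (\<lambda>t. (- t) ^ n * w t) has_real_derivative mix (\<lambda>t. (- t) ^ Suc n * w t) x) (at x)"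
proof -
  let ?G = "\<lambda>n. mix (\<lambda>t. (- t) ^ n * w t)"
  define C where "C = (LINT t|\<mu>. 2 * (t ^ (n + 2) * \<bar>w t\<bar> * exp (- t * (x / 2))))"
  have int: "integrable \<mu> (\<lambda>t. (- t) ^ k * w t * exp (- t * y))" if "0 < y" for k y
  proof -
    have "(- t) ^ k * w t * exp (- t * y) = (- 1) ^ k * (t ^ k * w t * exp (- t * y))" for t
      by (simp only: power_minus[of t k] mult.assoc)
    then show ?thesis
      using integrable_mult_right[OF integrable_mix_power[OF w that, of k], of "(- 1) ^ k"] by (simp only:)
  qed
  have key: "\<bar>?G n y - ?G n x - (y - x) * ?G (Suc n) x\<bar> \<le> (y - x)\<^sup>2 * C" if y: "x / 2 < y" for y
  proof -
    have "0 < y" using x y by simp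
    define R where "R t = (- t) ^ n * w t * exp (- t * y) - (- t) ^ n * w t * exp (- t * x)
          - (y - x) * ((- t) ^ Suc n * w t * exp (- t * x))" for t
    have int_R: "integrable \<mu> R"
      unfolding R_def using int[OF x] int[OF \<open>0 < y\<close>]
      by (intro Bochner_Integration.integrable_diff integrable_mult_right)
    have "?G n y - ?G n x - (y - x) * ?G (Suc n) x = (LINT t|\<mu>. R t)"
      unfolding mix_def R_def using int[OF x, of n] int[OF x, of "Suc n"] int[OF \<open>0 < y\<close>, of n]
      by (simp del: power_Suc)
    then have "\<bar>?G n y - ?G n x - (y - x) * ?G (Suc n) x\<bar> \<le> (LINT t|\<mu>. \<bar>R t\<bar>)"
      using integral_abs_bound[of \<mu> R] by simp
    also have "(LINT t|\<mu>. \<bar>R t\<bar>) \<le> (LINT t|\<mu>. (y - x)\<^sup>2 * (2 * (t ^ (n + 2) * \<bar>w t\<bar> * exp (- t * (x / 2)))))"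
    proof (rule integral_mono_AE)
      show "integrable \<mu> (\<lambda>t. \<bar>R t\<bar>)" using int_R by simp
      show "integrable \<mu> (\<lambda>t. (y - x)\<^sup>2 * (2 * (t ^ (n + 2) * \<bar>w t\<bar> * exp (- t * (x / 2)))))"
        using w x by (intro integrable_mult_right integrable_mix_power[where B=B]) auto
      show "AE t in \<mu>. \<bar>R t\<bar> \<le> (y - x)\<^sup>2 * (2 * (t ^ (n + 2) * \<bar>w t\<bar> * exp (- t * (x / 2))))"
      proof (rule eventually_mono[OF nonneg])
        fix t :: real assume t: "0 \<le> t"
        define v where "v = t * (y - x)"
        have e1: "exp (- t * y) = exp (- t * x) * exp (- v)"
          by (simp add: v_def exp_add[symmetric] algebra_simps)
        have R_eq: "R t = (- t) ^ n * w t * exp (- t * x) * (exp (- v) - 1 + v)"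
          unfolding e1 R_def by (simp add: v_def algebra_simps)
        have "\<bar>R t\<bar> = t ^ n * \<bar>w t\<bar> * exp (- t * x) * \<bar>exp (- v) - 1 + v\<bar>"
          unfolding R_eq using t by (simp add: abs_mult power_abs)
        also have "\<dots> \<le> t ^ n * \<bar>w t\<bar> * exp (- t * x) * (v\<^sup>2 * (1 + exp (- v)))"
          using t exp_taylor1_bound[of v] by (intro mult_left_mono) auto
        also have "\<dots> = t ^ n * \<bar>w t\<bar> * v\<^sup>2 * (exp (- t * x) + exp (- t * y))"
          unfolding e1 by (simp add: algebra_simps)
        also have "\<dots> \<le> t ^ n * \<bar>w t\<bar> * v\<^sup>2 * (exp (- t * (x / 2)) + exp (- t * (x / 2)))"
        proof -
          have "t * (x / 2) \<le> t * x" "t * (x / 2) \<le> t * y"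
            using t x y by (auto intro!: mult_left_mono simp del: times_divide_eq_right)
          then show ?thesis using t by (intro mult_left_mono add_mono) auto
        qed
        also have "\<dots> = (y - x)\<^sup>2 * (2 * (t ^ (n + 2) * \<bar>w t\<bar> * exp (- t * (x / 2))))"
          by (simp add: v_def power_mult_distrib power_add power2_eq_square)
        finally show "\<bar>R t\<bar> \<le> (y - x)\<^sup>2 * (2 * (t ^ (n + 2) * \<bar>w t\<bar> * exp (- t * (x / 2))))" .
      qed
    qed
    also have "\<dots> = (y - x)\<^sup>2 * C" by (simp add: C_def)
    finally show ?thesis .
  qed
  have "((\<lambda>y. (?G n y - ?G n x) / (y - x) - ?G (Suc n) x) \<longlongrightarrow> 0) (at x)"
  proof (rule Lim_null_comparison)
    have "eventually (\<lambda>y. x / 2 < y) (at x)"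
      using x by (intro order_tendstoD(1)[OF tendsto_ident_at]) simp
    moreover have "eventually (\<lambda>y. y \<noteq> x) (at x)" by (simp add: eventually_at_filter)
    ultimately show "eventually (\<lambda>y. norm ((?G n y - ?G n x) / (y - x) - ?G (Suc n) x) \<le> \<bar>y - x\<bar> * C) (at x)"
    proof eventually_elim
      case (elim y)
      have "\<bar>(?G n y - ?G n x) / (y - x) - ?G (Suc n) x\<bar> = \<bar>?G n y - ?G n x - (y - x) * ?G (Suc n) x\<bar> / \<bar>y - x\<bar>"
        using elim by (simp add: abs_divide[symmetric] diff_divide_distrib del: abs_divide)
      also have "\<dots> \<le> (y - x)\<^sup>2 * C / \<bar>y - x\<bar>"
        by (intro divide_right_mono key elim) auto
      also have "\<dots> = \<bar>y - x\<bar> * C"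
      proof -
        have "(y - x)\<^sup>2 * C / \<bar>y - x\<bar> = \<bar>y - x\<bar> * (\<bar>y - x\<bar> * C) / \<bar>y - x\<bar>"
          by (simp add: power2_eq_square mult.assoc[symmetric])
        also have "\<dots> = \<bar>y - x\<bar> * C"
          using elim by (intro nonzero_mult_div_cancel_left) simp
        finally show ?thesis .
      qed
      finally show ?case by simp
    qed
    have "((\<lambda>y. \<bar>y - x\<bar> * C) \<longlongrightarrow> \<bar>x - x\<bar> * C) (at x)" by (intro tendsto_intros)
    then show "((\<lambda>y. \<bar>y - x\<bar> * C) \<longlongrightarrow> 0) (at x)" by simp
  qed
  then show ?thesis unfolding has_field_derivative_iff by (rule LIM_zero_cancel)
qed

lemma mix_convex:
  assumes w: "w \<in> borel_measurable borel" "\<And>t. 0 \<le> t \<Longrightarrow> 0 \<le> w t \<and> w t \<le> B"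
    and "0 \<le> x" "0 \<le> y" "0 < u" "u < 1"
  shows "mix w ((1 - u) * x + u * y) \<le> (1 - u) * mix w x + u * mix w y"
proof -
  have int: "integrable \<mu> (\<lambda>t. w t * exp (- t * x))" if "0 \<le> x" for x
    using w that by (intro integrable_mix[where B=B]) auto
  have "mix w ((1 - u) * x + u * y) \<le>
      (LINT t|\<mu>. (1 - u) * (w t * exp (- t * x)) + u * (w t * exp (- t * y)))"
    unfolding mix_def
  proof (rule integral_mono_AE)
    show "integrable \<mu> (\<lambda>t. w t * exp (- t * ((1 - u) * x + u * y)))"
      using assms by (intro int) auto
    show "integrable \<mu> (\<lambda>t. (1 - u) * (w t * exp (- t * x)) + u * (w t * exp (- t * y)))"
      using assms by (intro Bochner_Integration.integrable_add integrable_mult_right int)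
    show "AE t in \<mu>. w t * exp (- t * ((1 - u) * x + u * y))
        \<le> (1 - u) * (w t * exp (- t * x)) + u * (w t * exp (- t * y))"
    proof (rule eventually_mono[OF nonneg])
      fix t :: real assume t: "0 \<le> t"
      have "exp ((1 - u) * (- t * x) + u * (- t * y)) \<le> (1 - u) * exp (- t * x) + u * exp (- t * y)"
        using convex_onD[OF exp_convex, of u "- t * x" "- t * y"] assms by simp
      then have "w t * exp ((1 - u) * (- t * x) + u * (- t * y)) \<le> w t * ((1 - u) * exp (- t * x) + u * exp (- t * y))"
        using w(2)[OF t] by (intro mult_left_mono) auto
      then show "w t * exp (- t * ((1 - u) * x + u * y))
        \<le> (1 - u) * (w t * exp (- t * x)) + u * (w t * exp (- t * y))"
        by (simp add: algebra_simps)
    qed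
  qed
  also have "\<dots> = (1 - u) * mix w x + u * mix w y"
    unfolding mix_def using int[OF \<open>0 \<le> x\<close>] int[OF \<open>0 \<le> y\<close>]
    by (subst Bochner_Integration.integral_add) auto
  finally show ?thesis .
qed

text \<open>The endpoint 0, where a mixture need not be differentiable, is included: the
  minimization takes place on the closed half-line.\<close>

lemma continuous_on_mix:
  assumes w: "w \<in> borel_measurable borel" "\<And>t. 0 \<le> t \<Longrightarrow> \<bar>w t\<bar> \<le> B"
  shows "continuous_on {0..} (mix w)"
proof (rule continuous_on_sequentiallyI)
  fix X :: "nat \<Rightarrow> real" and x assume X: "\<forall>n. X n \<in> {0..}" "X \<longlonglongrightarrow> x"
  show "(\<lambda>n. mix w (X n)) \<longlonglongrightarrow> mix w x"
    unfolding mix_def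
  proof (rule integral_dominated_convergence)
    show "integrable \<mu> (\<lambda>t. B)" by simp
    show "AE t in \<mu>. (\<lambda>n. w t * exp (- t * X n)) \<longlonglongrightarrow> w t * exp (- t * x)"
      using X by (intro AE_I2 tendsto_intros)
    show "AE t in \<mu>. norm (w t * exp (- t * X n)) \<le> B" for n
    proof (rule eventually_mono[OF nonneg])
      fix t :: real assume t: "0 \<le> t"
      have "\<bar>w t\<bar> * exp (- t * X n) \<le> B * 1"
        using w(2)[OF t] t X(1) by (intro mult_mono) auto
      then show "norm (w t * exp (- t * X n)) \<le> B" by (simp add: abs_mult)
    qed
  qed (unfold borel_measurable_eq, use w(1) in measurable)
qed

end

text \<open>Lerch's theorem. In the variable \<open>v = exp (- y)\<close> the transforms at
  \<open>a + k\<close> are the moments of \<open>H\<close>. If they vanish, so do the integrals of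
  \<open>H\<close> against polynomials and, by Weierstrass, against continuous functions of
  \<open>v\<close>; a bump around \<open>x\<close> then contradicts
  \<open>F x \<noteq> 0\<close>.\<close>

lemma laplace_transform_eq_0_imp_eq_0:
  fixes F :: "real \<Rightarrow> real"
  assumes cont: "continuous_on {0<..} F"
    and int: "\<And>\<theta>. \<theta>\<^sub>0 < \<theta> \<Longrightarrow> set_integrable lborel {0<..} (\<lambda>y. exp (- \<theta> * y) * F y)"
    and zero: "\<And>\<theta>. \<theta>\<^sub>0 < \<theta> \<Longrightarrow> (LBINT y:{0<..}. exp (- \<theta> * y) * F y) = 0"
    and x: "0 < x"
  shows "F x = 0"
proof -
  define a where "a = \<theta>\<^sub>0 + 1"
  define H where "H y = indicator {0<..} y * (exp (- a * y) * F y)" for y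
  have int_H: "integrable lborel H"
    using int[of a] unfolding set_integrable_def H_def by (simp add: a_def)
  have bounded_int: "integrable lborel (\<lambda>y. g y * H y)"
    if "g \<in> borel_measurable borel" "\<And>y. 0 < y \<Longrightarrow> \<bar>g y\<bar> \<le> B" for g B
  proof (rule Bochner_Integration.integrable_bound)
    show "integrable lborel (\<lambda>y. B * H y)" using int_H by simp
    show "(\<lambda>y. g y * H y) \<in> borel_measurable lborel"
      using that(1) borel_measurable_integrable[OF int_H] by measurable
    show "AE y in lborel. norm (g y * H y) \<le> norm (B * H y)"
    proof (rule AE_I2)
      fix y
      show "norm (g y * H y) \<le> norm (B * H y)"
      proof (cases "0 < y")
        case True
        from that(2)[OF this] show ?thesis by (simp add: abs_mult mult_right_mono)
      qed (simp add: H_def)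
    qed
  qed
  \<comment> \<open>The products \<open>v ^ k * (1 - v) ^ m\<close> are treated directly because
    they are the building blocks of the Bernstein polynomials used for the approximation.\<close>
  have poly: "(LINT y|lborel. (exp (- y) ^ k * (1 - exp (- y)) ^ m) * H y) = 0" for k m
  proof (induction m arbitrary: k)
    case 0
    have "exp (- y) ^ k * exp (- a * y) = exp (- (a + real k) * y)" for y
      by (simp add: exp_of_nat_mult[symmetric] exp_add[symmetric] algebra_simps)
    then have "(exp (- y) ^ k * (1 - exp (- y)) ^ 0) * H y = indicator {0<..} y *\<^sub>R (exp (- (a + real k) * y) * F y)" for y
      by (simp add: H_def mult.left_commute mult.assoc[symmetric])
    then show ?case using zero[of "a + real k"] by (simp add: set_lebesgue_integral_def a_def)
  next
    case (Suc m)
    have i: "integrable lborel (\<lambda>y. (exp (- y) ^ k * (1 - exp (- y)) ^ m) * H y)" for k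
      by (rule bounded_int[where B=1]) (auto simp: abs_mult power_abs intro!: mult_le_one power_le_one)
    have "(exp (- y) ^ k * (1 - exp (- y)) ^ Suc m) * H y
        = (exp (- y) ^ k * (1 - exp (- y)) ^ m) * H y - (exp (- y) ^ Suc k * (1 - exp (- y)) ^ m) * H y" for y
      by (simp add: algebra_simps)
    then show ?case using Suc.IH[of k] Suc.IH[of "Suc k"] i[of k] i[of "Suc k"]
      by (simp del: power_Suc)
  qed
  have cont_int: "integrable lborel (\<lambda>y. \<phi> (exp (- y)) * H y)" if \<phi>: "continuous_on UNIV \<phi>" for \<phi> :: "real \<Rightarrow> real"
  proof -
    have "continuous_on {0..1} \<phi>" using \<phi> by (rule continuous_on_subset) simp
    then have "bounded (\<phi> ` {0..1})" by (intro compact_imp_bounded compact_continuous_image) auto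
    then obtain B where B: "\<forall>v\<in>{0..1}. \<bar>\<phi> v\<bar> \<le> B" by (auto simp: bounded_iff)
    show ?thesis
    proof (rule bounded_int)
      show "(\<lambda>y. \<phi> (exp (- y))) \<in> borel_measurable borel"
        by (intro borel_measurable_continuous_onI continuous_on_compose2[OF \<phi>] continuous_intros) auto
      show "\<bar>\<phi> (exp (- y))\<bar> \<le> B" if "0 < y" for y using B that by simp
    qed
  qed
  have cont_zero: "(LINT y|lborel. \<phi> (exp (- y)) * H y) = 0" if \<phi>: "continuous_on UNIV \<phi>" for \<phi> :: "real \<Rightarrow> real"
  proof -
    have "continuous_on {0..1} \<phi>" using \<phi> by (rule continuous_on_subset) simp
    note int_\<phi> = cont_int[OF \<phi>]
    have "\<bar>LINT y|lborel. \<phi> (exp (- y)) * H y\<bar> \<le> e * (LINT y|lborel. \<bar>H y\<bar>)" if e: "0 < e" for e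
    proof -
      from Bernstein_Weierstrass[OF \<open>continuous_on {0..1} \<phi>\<close> e] obtain n where
        n: "\<And>v. v \<in> {0..1} \<Longrightarrow> \<bar>\<phi> v - (\<Sum>k\<le>n. \<phi> (real k / real n) * Bernstein n k v)\<bar> < e"
        by blast
      define p where "p v = (\<Sum>k\<le>n. \<phi> (real k / real n) * Bernstein n k v)" for v
      have p_eq: "p (exp (- y)) * H y = (\<Sum>k\<le>n. (\<phi> (real k / real n) * real (n choose k)) *
          ((exp (- y) ^ k * (1 - exp (- y)) ^ (n - k)) * H y))" for y
        unfolding p_def Bernstein_def sum_distrib_right by (simp add: mult_ac)
      have i: "integrable lborel (\<lambda>y. (exp (- y) ^ k * (1 - exp (- y)) ^ m) * H y)" for k m
        by (rule bounded_int[where B=1]) (auto simp: abs_mult power_abs intro!: mult_le_one power_le_one)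
      have int_p: "integrable lborel (\<lambda>y. p (exp (- y)) * H y)"
        unfolding p_eq by (intro Bochner_Integration.integrable_sum integrable_mult_right i)
      have "(LINT y|lborel. p (exp (- y)) * H y) = 0"
        unfolding p_eq by (subst Bochner_Integration.integral_sum) (simp_all add: poly i del: power_Suc)
      then have "(LINT y|lborel. \<phi> (exp (- y)) * H y) = (LINT y|lborel. \<phi> (exp (- y)) * H y - p (exp (- y)) * H y)"
        using int_\<phi> int_p by simp
      also have "\<bar>\<dots>\<bar> \<le> (LINT y|lborel. \<bar>\<phi> (exp (- y)) * H y - p (exp (- y)) * H y\<bar>)"
        by (rule integral_abs_bound)
      also have "\<dots> \<le> (LINT y|lborel. e * \<bar>H y\<bar>)"
      proof (rule integral_mono)
        show "integrable lborel (\<lambda>y. \<bar>\<phi> (exp (- y)) * H y - p (exp (- y)) * H y\<bar>)"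
          using int_\<phi> int_p by simp
        show "integrable lborel (\<lambda>y. e * \<bar>H y\<bar>)" using int_H by simp
        fix y
        show "\<bar>\<phi> (exp (- y)) * H y - p (exp (- y)) * H y\<bar> \<le> e * \<bar>H y\<bar>"
        proof (cases "0 < y")
          case True
          then have "\<bar>\<phi> (exp (- y)) - p (exp (- y))\<bar> \<le> e"
            using n[of "exp (- y)"] by (simp add: p_def)
          then show ?thesis
            by (simp add: left_diff_distrib[symmetric] abs_mult mult_right_mono)
        qed (simp add: H_def)
      qed
      finally show ?thesis by simp
    qed
    \<comment> \<open>Adding 1 to the denominator avoids a separate case for a vanishing integral of
      \<open>\<bar>H y\<bar>\<close>.\<close>
    then have *: "\<bar>LINT y|lborel. \<phi> (exp (- y)) * H y\<bar> / (1 + (LINT y|lborel. \<bar>H y\<bar>)) \<le> e" if "0 < e" for e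
    proof -
      let ?I = "LINT y|lborel. \<bar>H y\<bar>"
      have "0 \<le> ?I" by simp
      then have "e * ?I \<le> e * (1 + ?I)" using that by simp
      then have "\<bar>LINT y|lborel. \<phi> (exp (- y)) * H y\<bar> \<le> e * (1 + ?I)"
        using \<open>\<And>e. 0 < e \<Longrightarrow> _\<close>[OF that] by linarith
      then show ?thesis using \<open>0 \<le> ?I\<close> by (simp add: pos_divide_le_eq add_pos_nonneg)
    qed
    have "\<bar>LINT y|lborel. \<phi> (exp (- y)) * H y\<bar> / (1 + (LINT y|lborel. \<bar>H y\<bar>)) \<le> 0"
      by (rule field_le_epsilon) (use * in auto)
    moreover have "0 < 1 + (LINT y|lborel. \<bar>H y\<bar>)" by (simp add: add_pos_nonneg)
    ultimately show ?thesis by (simp add: divide_le_0_iff)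
  qed
  show ?thesis
  proof (rule ccontr)
    assume ne: "F x \<noteq> 0"
    define \<sigma> where "\<sigma> = sgn (F x)"
    have "((\<lambda>y. \<sigma> * F y) \<longlongrightarrow> \<sigma> * F x) (at x)"
      using cont x by (intro tendsto_intros) (auto simp: continuous_on_eq_continuous_at isCont_def)
    moreover have "0 < \<sigma> * F x" using ne by (auto simp: \<sigma>_def sgn_if)
    ultimately have "eventually (\<lambda>y. 0 < \<sigma> * F y) (at x)" by (rule order_tendstoD)
    then obtain d where d: "0 < d" "\<And>y. y \<noteq> x \<Longrightarrow> dist y x < d \<Longrightarrow> 0 < \<sigma> * F y"
      by (auto simp: eventually_at)
    define \<delta> where "\<delta> = min (d / 2) (x / 2)"
    have \<delta>: "0 < \<delta>" "\<delta> < d" "\<delta> < x" using d(1) x by (auto simp: \<delta>_def)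
    have pos: "0 < \<sigma> * F y" if "x - \<delta> < y" "y < x + \<delta>" for y
      using d(2)[of y] that \<delta> \<open>0 < \<sigma> * F x\<close> by (cases "y = x") (auto simp: dist_real_def)
    \<comment> \<open>As a function of \<open>y\<close> this bump is positive exactly for
      \<open>x - \<delta> < y < x + \<delta>\<close>. There \<open>F\<close> has constant sign by
      \<open>\<delta> < d\<close>, and \<open>\<delta> < x\<close> keeps the interval inside the
      positive half-line.\<close>
    define \<phi> where "\<phi> v = max 0 ((exp (- (x - \<delta>)) - v) * (v - exp (- (x + \<delta>))))" for v :: real
    have "continuous_on UNIV \<phi>" unfolding \<phi>_def by (intro continuous_intros)
    have \<phi>_pos: "0 < \<phi> (exp (- y))" if "x - \<delta> < y" "y < x + \<delta>" for y
      using that by (auto simp: \<phi>_def less_max_iff_disj)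
    have \<phi>_zero: "\<phi> (exp (- y)) = 0" if "\<not> (x - \<delta> < y \<and> y < x + \<delta>)" for y
    proof (cases "x - \<delta> < y")
      case True
      then have "(exp (- (x - \<delta>)) - exp (- y)) * (exp (- y) - exp (- (x + \<delta>))) \<le> 0"
        using that by (intro mult_nonneg_nonpos) auto
      then show ?thesis by (simp add: \<phi>_def)
    next
      case False
      then have "(exp (- (x - \<delta>)) - exp (- y)) * (exp (- y) - exp (- (x + \<delta>))) \<le> 0"
        using that \<delta> by (intro mult_nonpos_nonneg) auto
      then show ?thesis by (simp add: \<phi>_def)
    qed
    define G where "G y = \<sigma> * (\<phi> (exp (- y)) * H y)" for y
    have G_pos: "0 < G y" if "x - \<delta> < y" "y < x + \<delta>" for y
    proof -
      have "G y = \<phi> (exp (- y)) * exp (- a * y) * (\<sigma> * F y)"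
        using that \<delta> by (simp add: G_def H_def)
      also have "0 < \<dots>" by (intro mult_pos_pos \<phi>_pos[OF that] pos[OF that]) simp
      finally show ?thesis .
    qed
    have G_nonneg: "0 \<le> G y" for y
      using G_pos[of y] \<phi>_zero[of y] by (cases "x - \<delta> < y \<and> y < x + \<delta>") (auto simp: G_def less_imp_le)
    have "integrable lborel (\<lambda>y. \<phi> (exp (- y)) * H y)"
      by (rule cont_int) fact
    then have "integrable lborel G" unfolding G_def by simp
    moreover have "(LINT y|lborel. G y) = 0"
      unfolding G_def using cont_zero[OF \<open>continuous_on UNIV \<phi>\<close>] by simp
    ultimately have "AE y in lborel. G y = 0"
      using integral_nonneg_eq_0_iff_AE[of lborel G] G_nonneg by simp
    then have "AE y in lborel. y \<notin> {x - \<delta><..<x + \<delta>}"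
      by (rule eventually_mono) (use G_pos in force)
    then have "emeasure lborel {x - \<delta><..<x + \<delta>} = 0"
      by (subst (asm) AE_iff_measurable[of "{x - \<delta><..<x + \<delta>}"]) auto
    then show False using \<delta> by simp
  qed
qed

section \<open>Linear growth of the Laplace exponent and bounded variation\<close>

text \<open>By Markov's inequality, exceeding \<open>c * t\<close> by \<open>\<epsilon>\<close> at
  time \<open>t\<close> has probability at most \<open>exp (- \<theta> * \<epsilon>)\<close> for
  arbitrarily large \<open>\<theta>\<close>, hence 0. Stationarity transfers the bound to single
  increments.\<close>

lemma (in levy_process) linear_upper_bound_paths:
  assumes int: "\<And>t \<theta>. 0 \<le> t \<Longrightarrow> 0 \<le> \<theta> \<Longrightarrow> integrable M (\<lambda>\<omega>. exp (\<theta> * X t \<omega>))"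
    and bound: "\<And>t \<theta>. 0 \<le> t \<Longrightarrow> 0 \<le> \<theta> \<Longrightarrow> expectation (\<lambda>\<omega>. exp (\<theta> * X t \<omega>)) \<le> exp (t * (c * \<theta>))"
  shows "AE \<omega> in M. \<forall>s\<ge>0. \<forall>t\<ge>s. X t \<omega> - X s \<omega> \<le> c * (t - s)"
proof -
  have marginal: "AE \<omega> in M. X t \<omega> \<le> c * t" if t: "0 \<le> t" for t
  proof -
    have [measurable]: "X t \<in> borel_measurable M" by (rule measurable_X[OF t])
    have small: "prob {\<omega> \<in> space M. c * t + 1 / real (Suc n) \<le> X t \<omega>} = 0" for n
    proof -
      define A where "A = {\<omega> \<in> space M. c * t + 1 / real (Suc n) \<le> X t \<omega>}"
      have A: "A \<in> events" unfolding A_def by measurable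
      have "prob A \<le> exp (- (real k / real (Suc n)))" for k
      proof -
        define \<theta> where "\<theta> = real k"
        have "prob A * exp (\<theta> * (c * t + 1 / real (Suc n)))
            = expectation (\<lambda>\<omega>. indicator A \<omega> * exp (\<theta> * (c * t + 1 / real (Suc n))))"
          using A by simp
        also have "\<dots> \<le> expectation (\<lambda>\<omega>. exp (\<theta> * X t \<omega>))"
        proof (rule integral_mono)
          show "integrable M (\<lambda>\<omega>. exp (\<theta> * X t \<omega>))" by (rule int[OF t]) (simp add: \<theta>_def)
          show "indicator A \<omega> * exp (\<theta> * (c * t + 1 / real (Suc n))) \<le> exp (\<theta> * X t \<omega>)" for \<omega>
            by (auto simp: A_def indicator_def \<theta>_def intro!: mult_left_mono simp del: of_nat_Suc)
          show "integrable M (\<lambda>\<omega>. indicator A \<omega> * exp (\<theta> * (c * t + 1 / real (Suc n))))"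
            using A by (intro integrable_mult_left integrable_real_indicator) (auto simp: emeasure_eq_measure)
        qed
        also have "\<dots> \<le> exp (t * (c * \<theta>))" by (rule bound[OF t]) (simp add: \<theta>_def)
        also have "exp (\<theta> * (c * t + 1 / real (Suc n))) = exp (t * (c * \<theta>)) * exp (\<theta> / real (Suc n))"
          by (simp add: exp_add[symmetric] algebra_simps)
        finally have "exp (t * (c * \<theta>)) * (prob A * exp (\<theta> / real (Suc n))) \<le> exp (t * (c * \<theta>)) * 1"
          by (simp add: mult_ac)
        then have "prob A * exp (\<theta> / real (Suc n)) \<le> 1" by (simp only: mult_le_cancel_left_pos exp_gt_zero)
        then show ?thesis by (simp add: \<theta>_def exp_minus field_simps)
      qed
      moreover have "(\<lambda>k. exp (- (real k / real (Suc n)))) \<longlonglongrightarrow> 0"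
      proof -
        have "(\<lambda>k. exp (- (1 / real (Suc n))) ^ k) \<longlonglongrightarrow> 0"
          by (rule LIMSEQ_realpow_zero) auto
        then show ?thesis by (simp add: exp_of_nat_mult[symmetric] del: of_nat_Suc)
      qed
      ultimately have "prob A \<le> 0" by (intro LIMSEQ_le_const) auto
      then show ?thesis unfolding A_def by (simp add: measure_le_0_iff)
    qed
    have "AE \<omega> in M. \<forall>n. \<not> c * t + 1 / real (Suc n) \<le> X t \<omega>"
      unfolding AE_all_countable
    proof
      fix n
      show "AE \<omega> in M. \<not> c * t + 1 / real (Suc n) \<le> X t \<omega>"
        using small[of n] by (subst (asm) prob_eq_0) (auto simp del: of_nat_Suc elim!: eventually_mono)
    qed
    then show ?thesis
    proof (rule eventually_mono)
      fix \<omega> assume *: "\<forall>n. \<not> c * t + 1 / real (Suc n) \<le> X t \<omega>"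
      show "X t \<omega> \<le> c * t"
      proof (rule field_le_epsilon)
        fix e :: real assume "0 < e"
        then obtain n where "1 / real (Suc n) < e" using nat_approx_posE by blast
        then show "X t \<omega> \<le> c * t + e" using *[rule_format, of n] by linarith
      qed
    qed
  qed
  have increment: "AE \<omega> in M. X t \<omega> - X s \<omega> \<le> c * (t - s)" if "0 \<le> s" "s \<le> t" for s t
  proof -
    have [measurable]: "X t \<in> borel_measurable M" "X s \<in> borel_measurable M" "X (t - s) \<in> borel_measurable M"
      using that by (auto intro: measurable_X)
    have "AE x in distr M borel (X (t - s)). x \<le> c * (t - s)"
      using marginal[of "t - s"] that by (subst AE_distr_iff) auto
    also have "distr M borel (X (t - s)) = distr M borel (\<lambda>\<omega>. X t \<omega> - X s \<omega>)"
      using stationary_increments[of s "t - s"] that by simp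
    finally show ?thesis by (subst (asm) AE_distr_iff) auto
  qed
  \<comment> \<open>The exceptional null sets depend on \<open>s\<close> and \<open>t\<close>; only
    countably many can be joined, so the other times have to come from regularity of the
    paths.\<close>
  have "AE \<omega> in M. \<forall>s\<in>\<rat>. \<forall>t\<in>\<rat>. 0 \<le> s \<longrightarrow> s \<le> t \<longrightarrow> X t \<omega> - X s \<omega> \<le> c * (t - s)"
    by (intro AE_ball_countable[THEN iffD2] countable_rat ballI AE_impI increment)
  with cadlag_paths show ?thesis
  proof eventually_elim
    case (elim \<omega>)
    define Y where "Y t = X t \<omega> - c * t" for t
    have Y_rat: "Y t \<le> Y s" if "s \<in> \<rat>" "t \<in> \<rat>" "0 \<le> s" "s \<le> t" for s t
    proof -
      have "X t \<omega> - X s \<omega> \<le> c * (t - s)" using elim(2) that by blast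
      then show ?thesis by (simp add: Y_def right_diff_distrib)
    qed
    have lim: "(Y \<longlongrightarrow> Y t) (at_right t)" if "0 \<le> t" for t
    proof -
      have "((\<lambda>s. X s \<omega>) \<longlongrightarrow> X t \<omega>) (at_right t)"
        using elim(1) that by (auto simp: continuous_within)
      then show ?thesis unfolding Y_def by (intro tendsto_intros)
    qed
    \<comment> \<open>The rationals approach from strictly above because the paths are only
      right-continuous.\<close>
    have rat_seq: "\<exists>r. (\<forall>n. r n \<in> \<rat> \<and> t < r n) \<and> r \<longlonglongrightarrow> t" for t :: real
    proof -
      have "\<exists>q\<in>\<rat>. t < q \<and> q < t + 1 / real (Suc n)" for n
        by (intro Rats_dense_in_real) simp
      then obtain r where r: "\<And>n. r n \<in> \<rat> \<and> t < r n \<and> r n < t + 1 / real (Suc n)" by metis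
      have "r \<longlonglongrightarrow> t"
      proof (rule tendsto_sandwich[OF _ _ tendsto_const])
        show "eventually (\<lambda>n. t \<le> r n) sequentially"
          using r by (intro always_eventually allI less_imp_le) blast
        show "eventually (\<lambda>n. r n \<le> t + 1 / real (Suc n)) sequentially"
          using r by (intro always_eventually allI less_imp_le) blast
        show "(\<lambda>n. t + 1 / real (Suc n)) \<longlonglongrightarrow> t"
          using tendsto_add[OF tendsto_const LIMSEQ_Suc[OF lim_1_over_n], of t] by simp
      qed
      with r show ?thesis by blast
    qed
    have seq_lim: "(\<lambda>n. Y (r n)) \<longlonglongrightarrow> Y t" if "0 \<le> t" "\<And>n. t < r n" "r \<longlonglongrightarrow> t" for t r
      using that(3) less_imp_neq[OF that(2)] that(2)
      by (intro filterlim_compose[OF lim[OF that(1)]]) (auto simp: filterlim_at intro!: always_eventually)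
    have "Y t \<le> Y s" if st: "0 \<le> s" "s < t" for s t
    proof -
      obtain r where r: "\<And>n. r n \<in> \<rat> \<and> s < r n" "r \<longlonglongrightarrow> s" using rat_seq[of s] by blast
      obtain q where q: "\<And>n. q n \<in> \<rat> \<and> t < q n" "q \<longlonglongrightarrow> t" using rat_seq[of t] by blast
      have "eventually (\<lambda>n. r n < t) sequentially" using r(2) st by (intro order_tendstoD)
      then have "eventually (\<lambda>n. Y (q n) \<le> Y (r n)) sequentially"
      proof eventually_elim
        case (elim n)
        then show ?case using r(1)[of n] q(1)[of n] st by (intro Y_rat) auto
      qed
      moreover have "(\<lambda>n. Y (q n)) \<longlonglongrightarrow> Y t" using q st by (intro seq_lim) auto
      moreover have "(\<lambda>n. Y (r n)) \<longlonglongrightarrow> Y s" using r st by (intro seq_lim) auto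
      ultimately show ?thesis by (intro tendsto_le[OF trivial_limit_sequentially]) auto
    qed
    then show ?case by (auto simp: Y_def algebra_simps order.order_iff_strict)
  qed
qed

text \<open>The function is a linear function minus a nondecreasing one. Quantitatively, an
  increment \<open>d\<close> over a time step \<open>h\<close> satisfies
  \<open>\<bar>d\<bar> \<le> 2 * \<bar>c\<bar> * h - d\<close>, and the right-hand side
  telescopes.\<close>

lemma bounded_variation_on_linear_upper_bound:
  assumes bound: "\<And>s t. a \<le> s \<Longrightarrow> s \<le> t \<Longrightarrow> t \<le> b \<Longrightarrow> f t - f s \<le> c * (t - s)"
  shows "bounded_variation_on a b f"
proof -
  have tele: "(\<Sum>i<n. g (Suc i) - g i) = g n - g 0" for g :: "nat \<Rightarrow> real" and n
    by (induction n) auto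
  have "(\<Sum>i<n. \<bar>f (t (Suc i)) - f (t i)\<bar>) \<le> 2 * \<bar>c\<bar> * (b - a) + (\<bar>f a\<bar> + \<bar>f b\<bar> + \<bar>c\<bar> * (b - a)) * 2"
    if t: "mono_on {..n} t" "t ` {..n} \<subseteq> {a..b}" for n t
  proof -
    have ab: "a \<le> t i" "t i \<le> b" if "i \<le> n" for i using t(2) that by auto
    have mono: "t i \<le> t (Suc i)" if "i < n" for i
      using t(1) that by (auto simp: mono_on_def)
    have "(\<Sum>i<n. \<bar>f (t (Suc i)) - f (t i)\<bar>)
        \<le> (\<Sum>i<n. 2 * \<bar>c\<bar> * (t (Suc i) - t i) - (f (t (Suc i)) - f (t i)))"
    proof (rule sum_mono)
      fix i assume "i \<in> {..<n}"
      then have i: "i < n" by simp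
      have "f (t (Suc i)) - f (t i) \<le> c * (t (Suc i) - t i)"
        using i ab mono by (intro bound) auto
      also have "\<dots> \<le> \<bar>c\<bar> * (t (Suc i) - t i)"
        using mono[OF i] by (intro mult_right_mono) auto
      finally show "\<bar>f (t (Suc i)) - f (t i)\<bar> \<le> 2 * \<bar>c\<bar> * (t (Suc i) - t i) - (f (t (Suc i)) - f (t i))"
        using mult_nonneg_nonneg[of "\<bar>c\<bar>" "t (Suc i) - t i"] mono[OF i] by (simp add: abs_le_iff)
    qed
    also have "\<dots> = 2 * \<bar>c\<bar> * (t n - t 0) - (f (t n) - f (t 0))"
      by (simp add: sum_subtractf[of "\<lambda>i. 2 * \<bar>c\<bar> * (t (Suc i) - t i)"] sum_distrib_left[symmetric] tele tele[of "\<lambda>i. f (t i)"])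
    also have "\<dots> \<le> 2 * \<bar>c\<bar> * (b - a) + (f (t 0) - f (t n))"
      using ab[of 0] ab[of n] by (simp add: mult_left_mono)
    \<comment> \<open>Only upper bounds on increments are at hand, so the first point is compared
      with \<open>a\<close> and the last one with \<open>b\<close>; the result no longer depends on
      the partition.\<close>
    also have "f (t 0) - f (t n) \<le> (\<bar>f a\<bar> + \<bar>f b\<bar> + \<bar>c\<bar> * (b - a)) * 2"
    proof -
      have "f (t 0) - f a \<le> c * (t 0 - a)" "f b - f (t n) \<le> c * (b - t n)"
        using ab[of 0] ab[of n] by (auto intro!: bound)
      moreover have "c * (t 0 - a) \<le> \<bar>c\<bar> * (b - a)" "c * (b - t n) \<le> \<bar>c\<bar> * (b - a)"
        using ab[of 0] ab[of n] by (auto intro!: mult_mono)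
      ultimately have "f (t 0) - f (t n) \<le> f a - f b + \<bar>c\<bar> * (b - a) * 2" by linarith
      then show ?thesis by (simp add: distrib_right)
    qed
    finally show ?thesis by simp
  qed
  then show ?thesis unfolding bounded_variation_on_def by blast
qed

text \<open>Without this, the set defining \<open>\<Phi>\<^sub>K(q)\<close> could be empty.\<close>

lemma levy_exponent_linear_upper_bound:
  assumes "0 \<le> s" and f: "(\<lambda>z. indicator {0<..} z * f z) \<in> borel_measurable borel"
    and f_nonneg: "\<And>z. 0 < z \<Longrightarrow> 0 \<le> f z"
    and int: "set_integrable lborel {0<..} (\<lambda>z. min 1 (z\<^sup>2) * f z)"
    and bound: "\<And>\<theta>. l < \<theta> \<Longrightarrow> levy_exponent \<gamma> s f \<theta> \<le> K * \<theta> + q"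
  shows "s = 0" "set_integrable lborel {0<..1} (\<lambda>z. z * f z)" "\<gamma> + (LBINT z:{0<..1}. z * f z) \<le> K"
proof -
  have kint: "set_integrable lborel {0<..} (\<lambda>z. levy_kernel \<theta> z * f z)" if "0 \<le> \<theta>" for \<theta>
    by (rule set_integrable_levy_kernel[OF that f int]) (simp add: f_nonneg)
  have int1: "set_integrable lborel {1<..} f"
  proof -
    have "set_integrable lborel {1<..} (\<lambda>z. min 1 (z\<^sup>2) * f z)"
      by (rule set_integrable_subset[OF int]) auto
    moreover have "min 1 (z\<^sup>2) = 1" if "1 < z" for z :: real
      using that by (simp add: min_def)
    ultimately show ?thesis
      by (subst set_integrable_cong[OF refl refl, where f' = "\<lambda>z. min 1 (z\<^sup>2) * f z"]) auto
  qed
  define c1 where "c1 = (LBINT z:{1<..}. f z)"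
  \<comment> \<open>Jumps above 1 contribute at most the constant \<open>c1\<close>, and on
    \<open>(0, 1]\<close> the integrand on the left is nonnegative. After division by a large
    \<open>\<theta>\<close>, a positive \<open>s\<close> would violate the bound.\<close>
  have key: "\<gamma> * \<theta> + s * \<theta>\<^sup>2 / 2 + (LBINT z:{0<..1}. - levy_kernel \<theta> z * f z) \<le> K * \<theta> + q + c1"
    if "l < \<theta>" "0 \<le> \<theta>" for \<theta>
  proof -
    have i1: "set_integrable lborel {0<..1} (\<lambda>z. levy_kernel \<theta> z * f z)"
      "set_integrable lborel {1<..} (\<lambda>z. levy_kernel \<theta> z * f z)"
      by (rule set_integrable_subset[OF kint[OF that(2)]]; auto)+
    have split: "{0::real<..} = {0<..1} \<union> {1<..}" by auto
    have "(LBINT z:{0<..}. levy_kernel \<theta> z * f z)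
        = (LBINT z:{0<..1}. levy_kernel \<theta> z * f z) + (LBINT z:{1<..}. levy_kernel \<theta> z * f z)"
      unfolding split by (rule set_integral_Un[OF _ i1]) auto
    moreover have "(LBINT z:{1<..}. levy_kernel \<theta> z * f z) \<le> c1"
      unfolding c1_def
    proof (rule set_integral_mono[OF i1(2) int1])
      fix z :: real assume "z \<in> {1<..}"
      then show "levy_kernel \<theta> z * f z \<le> f z"
        using mult_right_mono[of "levy_kernel \<theta> z" 1 "f z"] f_nonneg[of z] by (simp add: levy_kernel_def)
    qed
    moreover have "(LBINT z:{0<..1}. - levy_kernel \<theta> z * f z) = - (LBINT z:{0<..1}. levy_kernel \<theta> z * f z)"
      by (simp add: set_lebesgue_integral_def)
    ultimately show ?thesis using bound[OF that(1)] by (simp add: levy_exponent_def)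
  qed
  have neg: "0 \<le> - levy_kernel \<theta> z" if "0 < z" "z \<le> 1" for \<theta> z
    using that exp_ge_add_one_self[of "- \<theta> * z"] by (simp add: levy_kernel_def)
  \<comment> \<open>The small-jump integrand at \<open>\<theta> = Suc n\<close>, divided by
    \<open>\<theta>\<close>. It is nonnegative and tends to \<open>z * f z\<close>, so Fatou's lemma
    turns the growth bound into a bound on the integral of \<open>z * f z\<close>.\<close>
  define k where "k n z = indicator {0<..1} z * (- levy_kernel (real (Suc n)) z / real (Suc n) * f z)" for n z
  define N where "N = nat \<lceil>l\<rceil>"
  have N: "l < real (Suc n)" if "N \<le> n" for n
    using that by (simp add: N_def)
  have k_nonneg: "0 \<le> k n z" for n z
  proof (cases "0 < z \<and> z \<le> 1")
    case True
    then have "0 \<le> - levy_kernel (real (Suc n)) z / real (Suc n) * f z"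
      using neg f_nonneg by (intro mult_nonneg_nonneg divide_nonneg_nonneg) auto
    then show ?thesis by (simp add: k_def indicator_def del: of_nat_Suc)
  qed (simp add: k_def)
  have k_int: "integrable lborel (k n)" for n
  proof -
    have "set_integrable lborel {0<..1} (\<lambda>z. levy_kernel (real (Suc n)) z * f z)"
      by (rule set_integrable_subset[OF kint]) auto
    then have "integrable lborel (\<lambda>z. (- 1 / real (Suc n)) * (indicator {0<..1} z *\<^sub>R (levy_kernel (real (Suc n)) z * f z)))"
      unfolding set_integrable_def by (rule integrable_mult_right)
    then show ?thesis by (simp add: k_def [abs_def] mult_ac)
  qed
  have k_eq: "(LINT z|lborel. k n z) = (LBINT z:{0<..1}. - levy_kernel (real (Suc n)) z * f z) / real (Suc n)" for n
    unfolding set_lebesgue_integral_def integral_divide_zero[symmetric] k_def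
    by (intro Bochner_Integration.integral_cong) auto
  have k_bound: "\<gamma> + s * real (Suc n) / 2 + (LINT z|lborel. k n z) \<le> K + (q + c1) / real (Suc n)" if "N \<le> n" for n
  proof -
    let ?\<theta> = "real (Suc n)"
    have "(\<gamma> * ?\<theta> + s * ?\<theta>\<^sup>2 / 2 + (LBINT z:{0<..1}. - levy_kernel ?\<theta> z * f z)) / ?\<theta> \<le> (K * ?\<theta> + q + c1) / ?\<theta>"
      by (intro divide_right_mono key N[OF that]) auto
    then show ?thesis
      unfolding k_eq by (simp add: add_divide_distrib power2_eq_square del: of_nat_Suc)
  qed
  have k_int_nonneg: "0 \<le> (LINT z|lborel. k n z)" for n by (simp add: k_nonneg)
  have lim: "(\<lambda>n. (q + c1) / real (Suc n)) \<longlonglongrightarrow> 0"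
    using tendsto_mult[OF tendsto_const LIMSEQ_Suc[OF lim_1_over_n], of "q + c1"] by simp
  have limK: "(\<lambda>n. K - \<gamma> + (q + c1) / real (Suc n)) \<longlonglongrightarrow> K - \<gamma>"
    using tendsto_add[OF tendsto_const lim, of "K - \<gamma>"] by simp
  show s0: "s = 0"
  proof (rule ccontr)
    assume "s \<noteq> 0"
    then have "filterlim (\<lambda>n. s / 2 * real (Suc n)) at_top sequentially"
      using \<open>0 \<le> s\<close> by (intro filterlim_tendsto_pos_mult_at_top[OF tendsto_const]
        filterlim_compose[OF filterlim_real_sequentially filterlim_Suc]) auto
    then have "eventually (\<lambda>n. K - \<gamma> + 1 < s / 2 * real (Suc n)) sequentially"
      unfolding filterlim_at_top_dense by blast
    moreover have "eventually (\<lambda>n. K - \<gamma> + (q + c1) / real (Suc n) < K - \<gamma> + 1) sequentially"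
      by (rule order_tendstoD[OF limK]) simp
    ultimately have "eventually (\<lambda>n::nat. False) sequentially"
      using eventually_ge_at_top[of N]
    proof eventually_elim
      case (elim n)
      have "s * real (Suc n) / 2 = s / 2 * real (Suc n)" by simp
      then show ?case using elim k_bound[OF elim(3)] k_int_nonneg[of n] by linarith
    qed
    then show False by simp
  qed
  have k_lim: "(\<lambda>n. k n z) \<longlonglongrightarrow> indicator {0<..1} z * (z * f z)" for z
  proof (cases "0 < z \<and> z \<le> 1")
    case True
    have "(\<lambda>n. z - (1 - exp (- real (Suc n) * z)) / real (Suc n)) \<longlonglongrightarrow> z - 0"
    proof (intro tendsto_intros)
      show "(\<lambda>n. (1 - exp (- real (Suc n) * z)) / real (Suc n)) \<longlonglongrightarrow> 0"
      proof (rule Lim_null_comparison)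
        show "eventually (\<lambda>n. norm ((1 - exp (- real (Suc n) * z)) / real (Suc n)) \<le> 1 / real (Suc n)) sequentially"
          using True by (auto intro!: always_eventually divide_right_mono simp: mult_nonneg_nonneg simp del: of_nat_Suc)
        show "(\<lambda>n. 1 / real (Suc n)) \<longlonglongrightarrow> 0" by (rule LIMSEQ_Suc[OF lim_1_over_n])
      qed
    qed
    moreover have "- levy_kernel (real (Suc n)) z / real (Suc n) = z - (1 - exp (- real (Suc n) * z)) / real (Suc n)" for n
      using True by (simp add: levy_kernel_def diff_divide_distrib del: of_nat_Suc)
    ultimately have "(\<lambda>n. - levy_kernel (real (Suc n)) z / real (Suc n) * f z) \<longlonglongrightarrow> z * f z"
      by (intro tendsto_mult tendsto_const) simp
    then show ?thesis using True by (simp add: k_def)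
  qed (simp add: k_def)
  define Z where "Z z = indicator {0<..1} z * (z * f z)" for z
  have Z_nonneg: "0 \<le> Z z" for z using f_nonneg[of z] by (auto simp: Z_def indicator_def)
  have Z_meas: "Z \<in> borel_measurable lborel"
  proof (rule borel_measurable_LIMSEQ_real)
    show "(\<lambda>n. k n z) \<longlonglongrightarrow> Z z" for z unfolding Z_def by (rule k_lim)
    show "k n \<in> borel_measurable lborel" for n by (rule borel_measurable_integrable[OF k_int])
  qed
  have "(\<integral>\<^sup>+z. ennreal (Z z) \<partial>lborel) = (\<integral>\<^sup>+z. liminf (\<lambda>n. ennreal (k n z)) \<partial>lborel)"
  proof (rule nn_integral_cong)
    fix z
    show "ennreal (Z z) = liminf (\<lambda>n. ennreal (k n z))"
      unfolding Z_def
      using lim_imp_Liminf[OF trivial_limit_sequentially tendsto_ennrealI[OF k_lim[of z]]] by (rule sym)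
  qed
  also have "\<dots> \<le> liminf (\<lambda>n. \<integral>\<^sup>+z. ennreal (k n z) \<partial>lborel)"
    using borel_measurable_integrable[OF k_int] by (intro nn_integral_liminf) simp
  also have "\<dots> = liminf (\<lambda>n. ennreal (LINT z|lborel. k n z))"
    by (simp add: nn_integral_eq_integral[OF k_int] k_nonneg)
  also have "\<dots> \<le> liminf (\<lambda>n. ennreal (K - \<gamma> + (q + c1) / real (Suc n)))"
  proof (intro Liminf_mono eventually_mono[OF eventually_ge_at_top[of N]] ennreal_leI)
    fix n assume "N \<le> n"
    from k_bound[OF this] show "(LINT z|lborel. k n z) \<le> K - \<gamma> + (q + c1) / real (Suc n)"
      by (simp add: s0 del: of_nat_Suc)
  qed
  also have "\<dots> = ennreal (K - \<gamma>)"
    by (intro lim_imp_Liminf tendsto_ennrealI limK) simp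
  finally have Z_le: "(\<integral>\<^sup>+z. ennreal (Z z) \<partial>lborel) \<le> ennreal (K - \<gamma>)" .
  then have "(\<integral>\<^sup>+z. ennreal (Z z) \<partial>lborel) < \<infinity>" by (rule order.strict_trans1) simp
  then have Z_int: "integrable lborel Z"
    using Z_meas Z_nonneg by (intro integrableI_nonneg) auto
  have "0 \<le> K - \<gamma>"
  proof (rule LIMSEQ_le_const[OF limK], intro exI[of _ N] allI impI)
    fix n assume "N \<le> n"
    from k_bound[OF this] k_int_nonneg[of n]
    show "0 \<le> K - \<gamma> + (q + c1) / real (Suc n)" by (simp add: s0 del: of_nat_Suc)
  qed
  then have "(LINT z|lborel. Z z) \<le> K - \<gamma>"
    using Z_le by (simp add: nn_integral_eq_integral[OF Z_int] Z_nonneg)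
  with Z_int show "set_integrable lborel {0<..1} (\<lambda>z. z * f z)" "\<gamma> + (LBINT z:{0<..1}. z * f z) \<le> K"
    by (simp_all add: Z_def [abs_def] set_integrable_def set_lebesgue_integral_def)
qed

text \<open>When the small jumps are summable the exponent equals the drift term minus the integral
  of \<open>(1 - exp (- \<theta> * z)) * f z\<close>, which is nonnegative.\<close>

lemma levy_exponent_le_drift:
  assumes "0 \<le> \<theta>" and f: "(\<lambda>z. indicator {0<..} z * f z) \<in> borel_measurable borel"
    and f_nonneg: "\<And>z. 0 < z \<Longrightarrow> 0 \<le> f z"
    and int: "set_integrable lborel {0<..} (\<lambda>z. min 1 (z\<^sup>2) * f z)"
    and int1: "set_integrable lborel {0<..1} (\<lambda>z. z * f z)"
  shows "levy_exponent \<gamma> 0 f \<theta> \<le> (\<gamma> + (LBINT z:{0<..1}. z * f z)) * \<theta>"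
proof -
  have ind: "(\<lambda>z. indicator {0<..} z *\<^sub>R (- \<theta> * (indicator {0<..1} z * (z * f z))))
      = (\<lambda>z. - \<theta> * (indicator {0<..1} z *\<^sub>R (z * f z)))"
    by (auto simp: indicator_def fun_eq_iff)
  have "set_integrable lborel {0<..} (\<lambda>z. - \<theta> * (indicator {0<..1} z * (z * f z)))"
    unfolding set_integrable_def ind using int1 unfolding set_integrable_def by (rule integrable_mult_right)
  then have "(LBINT z:{0<..}. - \<theta> * (indicator {0<..1} z * (z * f z))) \<le> (LBINT z:{0<..}. levy_kernel \<theta> z * f z)"
  proof (rule set_integral_mono)
    show "set_integrable lborel {0<..} (\<lambda>z. levy_kernel \<theta> z * f z)"
      by (rule set_integrable_levy_kernel[OF \<open>0 \<le> \<theta>\<close> f int]) (simp add: f_nonneg)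
    fix z :: real assume z: "z \<in> {0<..}"
    have "0 \<le> (1 - exp (- \<theta> * z)) * f z"
      using z \<open>0 \<le> \<theta>\<close> f_nonneg[of z] by (intro mult_nonneg_nonneg) auto
    then show "- \<theta> * (indicator {0<..1} z * (z * f z)) \<le> levy_kernel \<theta> z * f z"
      by (simp add: levy_kernel_def algebra_simps)
  qed
  moreover have "(LBINT z:{0<..}. - \<theta> * (indicator {0<..1} z * (z * f z))) = - \<theta> * (LBINT z:{0<..1}. z * f z)"
    unfolding set_lebesgue_integral_def ind by (rule integral_mult_right_zero)
  ultimately show ?thesis by (simp add: levy_exponent_def algebra_simps)
qed

section \<open>The scale function and the minimization problem\<close>

lemma infinitely_differentiable_onI:
  assumes "open S" and F0: "\<And>x. x \<in> S \<Longrightarrow> f x = F 0 x"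
    and F: "\<And>n x. x \<in> S \<Longrightarrow> (F n has_real_derivative F (Suc n) x) (at x)"
  shows "infinitely_differentiable_on S f"
proof -
  have D: "((deriv ^^ n) f has_real_derivative F (Suc n) x) (at x)"
    if "\<And>x. x \<in> S \<Longrightarrow> (deriv ^^ n) f x = F n x" "x \<in> S" for n x
    using F[OF that(2)] by (rule has_field_derivative_transform_within_open[OF _ \<open>open S\<close> that(2)]) (simp add: that(1))
  have eq: "(deriv ^^ n) f x = F n x" if "x \<in> S" for n x
    using that
  proof (induction n arbitrary: x)
    case (Suc n)
    from D[OF Suc.IH Suc.prems] show ?case by (simp add: DERIV_imp_deriv)
  qed (simp add: F0)
  show ?thesis
    unfolding infinitely_differentiable_on_def field_differentiable_def using D[OF eq] by blast
qed

context exponential_mixture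
begin

text \<open>The mixture supplies only nonnegativity, smoothness and weak convexity;
  \<open>D * exp (l * b)\<close> with \<open>D, l > 0\<close> makes the convexity strict and the
  limit infinite.\<close>

lemma exponential_plus_mix_properties:
  assumes w: "w \<in> borel_measurable borel" "\<And>t. 0 \<le> t \<Longrightarrow> 0 \<le> w t \<and> w t \<le> B"
    and pos: "0 < D" "0 < l" "0 \<le> E"
    and h: "\<And>b. 0 \<le> b \<Longrightarrow> h b = D * exp (l * b) + E * mix w b"
  shows "(\<forall>b\<ge>0. 0 \<le> h b) \<and> infinitely_differentiable_on {0<..} h \<and> strictly_convex_on {0<..} h \<and>
    filterlim h at_top at_top \<and> (\<exists>!b. is_arg_min h (\<lambda>b. 0 \<le> b) b)"
proof -
  have w': "\<bar>w t\<bar> \<le> B" if "0 \<le> t" for t using w(2)[OF that] by auto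
  have mix_pos: "0 \<le> mix w b" for b using w by (intro mix_nonneg) auto
  have lower: "D * exp (l * b) \<le> h b" if "0 \<le> b" for b
    using mix_pos[of b] pos that by (simp add: h)
  have nonneg: "\<forall>b\<ge>0. 0 \<le> h b"
  proof (intro allI impI)
    fix b :: real assume "0 \<le> b"
    have "0 \<le> D * exp (l * b)" using pos by simp
    with lower[OF \<open>0 \<le> b\<close>] show "0 \<le> h b" by linarith
  qed
  have smooth: "infinitely_differentiable_on {0<..} h"
  proof (rule infinitely_differentiable_onI)
    fix n and x :: real assume "x \<in> {0<..}"
    then have "0 < x" by simp
    show "((\<lambda>x. D * (l ^ n * exp (l * x)) + E * mix (\<lambda>t. (- t) ^ n * w t) x) has_real_derivative
        D * (l ^ Suc n * exp (l * x)) + E * mix (\<lambda>t. (- t) ^ Suc n * w t) x) (at x)"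
      by (intro DERIV_add DERIV_cmult has_real_derivative_mix[OF w(1) w' \<open>0 < x\<close>])
         (auto intro!: derivative_eq_intros)
  qed (auto simp: h)
  have strict: "h ((1 - u) * x + u * y) < (1 - u) * h x + u * h y"
    if "0 \<le> x" "0 \<le> y" "0 < u" "u < 1" "x \<noteq> y" for x y u
  proof -
    have "exp ((1 - u) * (l * x) + u * (l * y)) < (1 - u) * exp (l * x) + u * exp (l * y)"
      using that pos by (intro exp_strict_convex) auto
    moreover have "(1 - u) * (l * x) + u * (l * y) = l * ((1 - u) * x + u * y)"
      by (simp add: algebra_simps)
    ultimately have "D * exp (l * ((1 - u) * x + u * y)) < D * ((1 - u) * exp (l * x) + u * exp (l * y))"
      using pos by (simp only: mult_strict_left_mono)
    moreover have "E * mix w ((1 - u) * x + u * y) \<le> E * ((1 - u) * mix w x + u * mix w y)"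
      using that pos by (intro mult_left_mono mix_convex[OF w]) auto
    ultimately have "D * exp (l * ((1 - u) * x + u * y)) + E * mix w ((1 - u) * x + u * y)
        < D * ((1 - u) * exp (l * x) + u * exp (l * y)) + E * ((1 - u) * mix w x + u * mix w y)"
      by (rule add_less_le_mono)
    also have "\<dots> = (1 - u) * h x + u * h y" using that by (simp add: h algebra_simps)
    finally show ?thesis using that by (simp add: h)
  qed
  then have convex: "strictly_convex_on {0<..} h"
    unfolding strictly_convex_on_def by (auto simp: less_imp_le)
  have exp_top: "filterlim (\<lambda>b. D * exp (l * b)) at_top at_top"
    using pos by (intro filterlim_tendsto_pos_mult_at_top[OF tendsto_const]
      filterlim_compose[OF exp_at_top] filterlim_ident) auto
  have "eventually (\<lambda>b. D * exp (l * b) \<le> h b) at_top"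
    using lower by (rule eventually_mono[OF eventually_ge_at_top[of 0]])
  with exp_top have top: "filterlim h at_top at_top" by (rule filterlim_at_top_mono)
  have cont: "continuous_on {0..} h"
  proof -
    have "continuous_on {0..} (\<lambda>b. D * exp (l * b) + E * mix w b)"
      by (intro continuous_intros continuous_on_mix[OF w(1) w'])
    then show ?thesis by (rule continuous_on_eq) (simp add: h)
  qed
  from top have "eventually (\<lambda>b. h 0 < h b) at_top" unfolding filterlim_at_top_dense by blast
  then obtain c where c: "\<And>b. c \<le> b \<Longrightarrow> h 0 < h b" by (auto simp: eventually_at_top_linorder)
  \<comment> \<open>Beyond \<open>T\<close> the function exceeds \<open>h 0\<close>, so a minimum
    over the compact interval \<open>[0, T]\<close> is global.\<close>
  define T where "T = max c 0"
  have "continuous_on {0..T} h" using cont by (rule continuous_on_subset) auto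
  then obtain m where m: "m \<in> {0..T}" "\<And>b. b \<in> {0..T} \<Longrightarrow> h m \<le> h b"
    using continuous_attains_inf[of "{0..T}" h] by (auto simp: T_def)
  have min: "h m \<le> h b" if "0 \<le> b" for b
  proof (cases "b \<le> T")
    case True
    then show ?thesis using m(2)[of b] that by simp
  next
    case False
    then have "h 0 < h b" by (intro c) (simp add: T_def)
    moreover have "h m \<le> h 0" by (rule m(2)) (simp add: T_def)
    ultimately show ?thesis by simp
  qed
  have argmin: "\<exists>!b. is_arg_min h (\<lambda>b. 0 \<le> b) b"
  proof (rule ex1I)
    show "is_arg_min h (\<lambda>b. 0 \<le> b) m" using m(1) min by (auto simp: is_arg_min_def not_less)
    fix b assume b: "is_arg_min h (\<lambda>b. 0 \<le> b) b"
    show "b = m"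
    proof (rule ccontr)
      assume "b \<noteq> m"
      have "0 \<le> b" "h b \<le> h m" using b m(1) by (auto simp: is_arg_min_def not_less)
      have "h ((1 - 1 / 2) * b + 1 / 2 * m) < (1 - 1 / 2) * h b + 1 / 2 * h m"
        using \<open>0 \<le> b\<close> \<open>b \<noteq> m\<close> m(1) by (intro strict) auto
      also have "\<dots> \<le> h m" using \<open>h b \<le> h m\<close> by simp
      finally show False using min[of "(1 - 1 / 2) * b + 1 / 2 * m"] \<open>0 \<le> b\<close> m(1) by simp
    qed
  qed
  from nonneg smooth convex top argmin show ?thesis by blast
qed

text \<open>Both sides are continuous on the open half-line and have the same Laplace transform
  beyond \<open>l\<close>; the term \<open>A / (\<theta> - l)\<close> belongs to
  \<open>A * exp (l * x)\<close>.\<close>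

lemma scale_function_eq:
  assumes pos: "0 < l" and W: "continuous_on {0..} W"
    and lap: "\<And>\<theta>. l < \<theta> \<Longrightarrow> set_integrable lborel {0..} (\<lambda>y. exp (- \<theta> * y) * W y)"
      "\<And>\<theta>. l < \<theta> \<Longrightarrow> (LBINT y:{0..}. exp (- \<theta> * y) * W y) = A / (\<theta> - l) - (LINT t|\<mu>. 1 / (\<theta> + t))"
    and x: "0 < x"
  shows "W x = A * exp (l * x) - mix (\<lambda>_. 1) x"
proof -
  define F where "F x = W x - (A * exp (l * x) - mix (\<lambda>_. 1) x)" for x
  \<comment> \<open>The transform of \<open>W\<close> is given on the closed half-line, that of a
    mixture on the open one; they differ by a null set.\<close>
  have open_closed: "set_integrable lborel {0<..} g = set_integrable lborel {0..} g"
    "(LBINT y:{0<..}. g y) = (LBINT y:{0..}. g y)" for g :: "real \<Rightarrow> real"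
  proof -
    show "set_integrable lborel {0<..} g = set_integrable lborel {0..} g"
      by (rule set_integrable_discrete_difference[of "{0}"]) auto
    show "(LBINT y:{0<..}. g y) = (LBINT y:{0..}. g y)"
      by (rule set_integral_discrete_difference[of "{0}"]) auto
  qed
  have "F x = 0"
  proof (rule laplace_transform_eq_0_imp_eq_0[OF _ _ _ x])
    show "continuous_on {0<..} F"
      unfolding F_def
      by (intro continuous_intros continuous_on_subset[OF W] continuous_on_subset[OF continuous_on_mix[of _ 1]]) auto
    fix \<theta> assume \<theta>: "l < \<theta>"
    have eq: "exp (- \<theta> * y) * F y = exp (- \<theta> * y) * W y
        - (A * exp (- (\<theta> - l) * y) - exp (- \<theta> * y) * mix (\<lambda>_. 1) (0 + y))" for y
    proof -
      have "exp (- \<theta> * y) * exp (l * y) = exp (- (\<theta> - l) * y)"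
        by (simp add: exp_add[symmetric] algebra_simps)
      then show ?thesis by (simp add: F_def right_diff_distrib mult.left_commute[of _ A])
    qed
    have "0 < \<theta>" "0 < \<theta> - l" using \<theta> pos by auto
    note mixI = mix_laplace[of "\<lambda>_. 1" 1 \<theta> 0, OF _ _ \<open>0 < \<theta>\<close>, simplified]
    note expI = set_integral_exp_decay[OF \<open>0 < \<theta> - l\<close>]
    have i1: "set_integrable lborel {0<..} (\<lambda>y. exp (- \<theta> * y) * W y)"
      using lap(1)[OF \<theta>] by (simp only: open_closed)
    have i2: "set_integrable lborel {0<..} (\<lambda>y. A * exp (- (\<theta> - l) * y))"
      using expI(1) by simp
    have i3: "set_integrable lborel {0<..} (\<lambda>y. exp (- \<theta> * y) * mix (\<lambda>_. 1) (0 + y))"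
      using mixI(1) by simp
    show "set_integrable lborel {0<..} (\<lambda>y. exp (- \<theta> * y) * F y)"
      unfolding eq by (intro set_integral_diff(1) i1 i2 i3)
    have "(LBINT y:{0<..}. exp (- \<theta> * y) * mix (\<lambda>_. 1) (0 + y)) = (LINT t|\<mu>. 1 / (\<theta> + t))"
      using mixI(2) by (simp add: mix_def)
    moreover have "(LBINT y:{0<..}. A * exp (- (\<theta> - l) * y)) = A / (\<theta> - l)"
      using expI(2) by simp
    moreover have "(LBINT y:{0<..}. exp (- \<theta> * y) * W y) = A / (\<theta> - l) - (LINT t|\<mu>. 1 / (\<theta> + t))"
      using lap(2)[OF \<theta>] by (simp only: open_closed)
    ultimately show "(LBINT y:{0<..}. exp (- \<theta> * y) * F y) = 0"
      unfolding eq set_integral_diff(2)[OF i1 set_integral_diff(1)[OF i2 i3]] set_integral_diff(2)[OF i2 i3]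
      by simp
  qed
  then show ?thesis by (simp add: F_def)
qed

text \<open>The total transform at \<open>\<phi>\<close> is \<open>1 / p\<close>, so the bracket in
  \<open>Z\<close> equals \<open>p\<close> times the tail integral beyond \<open>x\<close>.
  Absorbing \<open>exp (\<phi> * x)\<close> into a shift of this tail removes the growth of order
  \<open>exp (\<phi> * x)\<close>; only \<open>exp (l * x)\<close> remains.\<close>

lemma Z_fun_eq:
  assumes pos: "0 < l" "l < \<phi>" "0 < p" and \<phi>: "\<phi> = right_inverse \<psi> (p + q)"
    and W: "\<And>x. 0 < x \<Longrightarrow> W x = A * exp (l * x) - mix (\<lambda>_. 1) x"
    and int: "set_integrable lborel {0..} (\<lambda>y. exp (- \<phi> * y) * W y)"
    and total: "(LBINT y:{0..}. exp (- \<phi> * y) * W y) = 1 / p"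
    and x: "0 < x"
  shows "Z_fun \<psi> W q p x = p * A / (\<phi> - l) * exp (l * x) - p * mix (\<lambda>t. 1 / (\<phi> + t)) x"
proof -
  have split: "{0..} = {0..x} \<union> {x<..}" using x by auto
  have i1: "set_integrable lborel {0..x} (\<lambda>y. exp (- \<phi> * y) * W y)"
    "set_integrable lborel {x<..} (\<lambda>y. exp (- \<phi> * y) * W y)"
    by (rule set_integrable_subset[OF int]; use x in auto)+
  have "1 / p = (LBINT y:{0..x}. exp (- \<phi> * y) * W y) + (LBINT y:{x<..}. exp (- \<phi> * y) * W y)"
    unfolding total[symmetric] split by (rule set_integral_Un[OF _ i1]) auto
  then have "1 - p * (LBINT y:{0..x}. exp (- \<phi> * y) * W y) = p * (LBINT y:{x<..}. exp (- \<phi> * y) * W y)"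
    using pos by (simp add: field_simps)
  then have Z: "Z_fun \<psi> W q p x = p * (exp (\<phi> * x) * (LBINT y:{x<..}. exp (- \<phi> * y) * W y))"
    by (simp add: Z_fun_def \<phi>[symmetric] Let_def)
  have "0 < \<phi>" "0 < \<phi> - l" using pos by auto
  note mixI = mix_laplace[of "\<lambda>_. 1" 1 \<phi> x, OF _ _ \<open>0 < \<phi>\<close>, simplified]
  note expI = set_integral_exp_decay[OF \<open>0 < \<phi> - l\<close>]
  have i2: "set_integrable lborel {0<..} (\<lambda>y. A * exp (l * x) * exp (- (\<phi> - l) * y))"
    using expI(1) by simp
  have i3: "set_integrable lborel {0<..} (\<lambda>y. exp (- \<phi> * y) * mix (\<lambda>_. 1) (x + y))"
    using mixI(1) x by simp
  have "exp (\<phi> * x) * (LBINT y:{x<..}. exp (- \<phi> * y) * W y)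
      = exp (\<phi> * x) * (LINT y|lborel. indicator {x<..} (x + 1 * y) *\<^sub>R (exp (- \<phi> * (x + 1 * y)) * W (x + 1 * y)))"
    unfolding set_lebesgue_integral_def by (subst lborel_integral_real_affine[of 1 _ x]) simp_all
  also have "\<dots> = (LINT y|lborel. exp (\<phi> * x) * (indicator {x<..} (x + 1 * y) *\<^sub>R (exp (- \<phi> * (x + 1 * y)) * W (x + 1 * y))))"
    by (rule integral_mult_right_zero[symmetric])
  also have "\<dots> = (LBINT y:{0<..}. A * exp (l * x) * exp (- (\<phi> - l) * y) - exp (- \<phi> * y) * mix (\<lambda>_. 1) (x + y))"
    unfolding set_lebesgue_integral_def
  proof (rule Bochner_Integration.integral_cong[OF refl])
    fix y :: real
    show "exp (\<phi> * x) * (indicator {x<..} (x + 1 * y) *\<^sub>R (exp (- \<phi> * (x + 1 * y)) * W (x + 1 * y)))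
        = indicator {0<..} y *\<^sub>R (A * exp (l * x) * exp (- (\<phi> - l) * y) - exp (- \<phi> * y) * mix (\<lambda>_. 1) (x + y))"
    proof (cases "0 < y")
      case True
      then have "W (x + y) = A * exp (l * (x + y)) - mix (\<lambda>_. 1) (x + y)" using x by (intro W) simp
      moreover have "exp (\<phi> * x) * exp (- \<phi> * (x + y)) = exp (- \<phi> * y)"
        "exp (- \<phi> * y) * exp (l * (x + y)) = exp (l * x) * exp (- (\<phi> - l) * y)"
        by (simp_all add: exp_add[symmetric] algebra_simps)
      ultimately show ?thesis using True
        by (simp add: mult.assoc[symmetric] right_diff_distrib)
    qed simp
  qed
  also have "\<dots> = A * exp (l * x) * (1 / (\<phi> - l)) - mix (\<lambda>t. 1 / (\<phi> + t)) x"
    unfolding set_integral_diff(2)[OF i2 i3] using expI(2) mixI(2) x by simp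
  finally have "exp (\<phi> * x) * (LBINT y:{x<..}. exp (- \<phi> * y) * W y)
      = A * exp (l * x) * (1 / (\<phi> - l)) - mix (\<lambda>t. 1 / (\<phi> + t)) x" .
  then show ?thesis unfolding Z by (simp only: right_diff_distrib) simp
qed

lemma deriv_Z_fun:
  assumes pos: "0 < \<phi>" and Z: "\<And>x. 0 < x \<Longrightarrow> Z x = C * exp (l * x) - p * mix (\<lambda>t. 1 / (\<phi> + t)) x"
    and x: "0 < x"
  shows "deriv Z x = C * l * exp (l * x) + p * mix (\<lambda>t. t / (\<phi> + t)) x"
proof -
  let ?w = "\<lambda>t. 1 / (\<phi> + t)"
  have w: "?w \<in> borel_measurable borel" "\<And>t. 0 \<le> t \<Longrightarrow> \<bar>?w t\<bar> \<le> 1 / \<phi>"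
    using pos by (auto intro!: divide_left_mono)
  have "(mix ?w has_real_derivative mix (\<lambda>t. (- t) * ?w t) x) (at x)"
    using has_real_derivative_mix[OF w x, of 0] by simp
  moreover have "mix (\<lambda>t. (- t) * ?w t) x = - mix (\<lambda>t. t / (\<phi> + t)) x"
    by (simp add: mix_def)
  ultimately have "((\<lambda>x. C * exp (l * x) - p * mix ?w x) has_real_derivative
      C * l * exp (l * x) - p * (- mix (\<lambda>t. t / (\<phi> + t)) x)) (at x)"
    by (intro DERIV_diff DERIV_cmult) (auto intro!: derivative_eq_intros)
  then have "(Z has_real_derivative C * l * exp (l * x) - p * (- mix (\<lambda>t. t / (\<phi> + t)) x)) (at x)"
    by (rule has_field_derivative_transform_within_open[OF _ open_greaterThan[of 0]]) (use x Z in auto)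
  then show ?thesis by (simp add: DERIV_imp_deriv)
qed

text \<open>The derivative of \<open>Z\<close> contains \<open>exp (l * x)\<close>, so
  \<open>l < \<kappa>\<close> is what makes the integral converge.\<close>

lemma h_integral:
  assumes pos: "0 < \<phi>" "0 < \<kappa>" "l < \<kappa>"
    and deriv: "\<And>x. 0 < x \<Longrightarrow> deriv (Z_fun \<psi> W q p) x = C * exp (l * x) + p * mix (\<lambda>t. t / (\<phi> + t)) x"
    and b: "0 \<le> b"
  shows "set_integrable lborel {0<..} (h_integrand \<psi> W q p \<kappa> b)"
    "(LBINT y:{0<..}. h_integrand \<psi> W q p \<kappa> b y) =
       C / (\<kappa> - l) * exp (l * b) + p * mix (\<lambda>t. t / (\<phi> + t) / (\<kappa> + t)) b"
proof -
  have eq: "h_integrand \<psi> W q p \<kappa> b y = C * exp (l * b) * exp (- (\<kappa> - l) * y)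
      + p * (exp (- \<kappa> * y) * mix (\<lambda>t. t / (\<phi> + t)) (b + y))" if "y \<in> {0<..}" for y
  proof -
    have "exp (- \<kappa> * y) * exp (l * (b + y)) = exp (l * b) * exp (- (\<kappa> - l) * y)"
      by (simp add: exp_add[symmetric] algebra_simps)
    then show ?thesis using that b
      by (simp add: h_integrand_def deriv distrib_left mult.left_commute[of _ C] mult.left_commute[of _ p] mult.assoc)
  qed
  have "0 < \<kappa> - l" using pos by simp
  note expI = set_integral_exp_decay[OF this]
  have w: "(\<lambda>t. t / (\<phi> + t)) \<in> borel_measurable borel" "\<And>t. 0 \<le> t \<Longrightarrow> 0 \<le> t / (\<phi> + t) \<and> t / (\<phi> + t) \<le> 1"
    using pos by auto
  note mixI = mix_laplace[OF w \<open>0 < \<kappa>\<close> b]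
  have i2: "set_integrable lborel {0<..} (\<lambda>y. C * exp (l * b) * exp (- (\<kappa> - l) * y))"
    using expI(1) by simp
  have i3: "set_integrable lborel {0<..} (\<lambda>y. p * (exp (- \<kappa> * y) * mix (\<lambda>t. t / (\<phi> + t)) (b + y)))"
    using mixI(1) by simp
  show "set_integrable lborel {0<..} (h_integrand \<psi> W q p \<kappa> b)"
    using set_integral_add(1)[OF i2 i3] by (subst set_integrable_cong[OF refl refl eq]) auto
  have "(LBINT y:{0<..}. h_integrand \<psi> W q p \<kappa> b y) = (LBINT y:{0<..}. C * exp (l * b) * exp (- (\<kappa> - l) * y)
      + p * (exp (- \<kappa> * y) * mix (\<lambda>t. t / (\<phi> + t)) (b + y)))"
    by (rule set_lebesgue_integral_cong) (auto simp: eq)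
  also have "\<dots> = C / (\<kappa> - l) * exp (l * b) + p * mix (\<lambda>t. t / (\<phi> + t) / (\<kappa> + t)) b"
    unfolding set_integral_add(2)[OF i2 i3] using expI(2) mixI(2) by simp
  finally show "(LBINT y:{0<..}. h_integrand \<psi> W q p \<kappa> b y) =
       C / (\<kappa> - l) * exp (l * b) + p * mix (\<lambda>t. t / (\<phi> + t) / (\<kappa> + t)) b" .
qed

end

text \<open>Convexity and \<open>g 0 = 0\<close> make \<open>g x / x\<close> nondecreasing. Hence a
  positive level is crossed exactly once, although \<open>g\<close> itself may first decrease, and
  the supremum is taken over a single point.\<close>

lemma right_inverse_convex:
  assumes conv: "convex_on {0..} g" and g0: "g 0 = 0" and "0 < r" and z: "0 \<le> z" "r < g z"
  shows "0 < right_inverse g r" "g (right_inverse g r) = r"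
    "\<And>x. right_inverse g r < x \<Longrightarrow> r < g x" "\<And>x. 0 \<le> x \<Longrightarrow> x < right_inverse g r \<Longrightarrow> g x < r"
proof -
  have "0 < z" using z g0 \<open>0 < r\<close> by (cases "z = 0") auto
  have scale: "g x \<le> x / y * g y" if "0 \<le> x" "x < y" for x y
  proof -
    have "g ((1 - x / y) * 0 + (x / y) * y) \<le> (1 - x / y) * g 0 + (x / y) * g y"
      using convex_onD[OF conv, of "x / y" 0 y] that by simp
    then show ?thesis using that by (simp add: g0)
  qed
  \<comment> \<open>Chosen such that the chord from 0 to \<open>z\<close> has height
    \<open>r / 2\<close> at \<open>d\<close>. Positivity of \<open>d\<close> keeps the intermediate
    value argument in the open half-line, where convexity yields continuity.\<close>
  define d where "d = z * (r / (2 * g z))"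
  have gz: "0 < g z" using z \<open>0 < r\<close> by simp
  have d: "0 < d" "d < z"
  proof -
    show "0 < d" using \<open>0 < z\<close> gz \<open>0 < r\<close> by (simp add: d_def)
    have "r / (2 * g z) < 1" using gz z(2) \<open>0 < r\<close> by (simp add: field_simps)
    then have "z * (r / (2 * g z)) < z * 1" using \<open>0 < z\<close> by (rule mult_strict_left_mono)
    then show "d < z" by (simp add: d_def)
  qed
  have "g d \<le> d / z * g z" using d by (intro scale) auto
  also have "d / z * g z = r / 2" using \<open>0 < z\<close> gz by (simp add: d_def)
  finally have "g d \<le> r" using \<open>0 < r\<close> by simp
  have "continuous_on {0<..} g"
    by (intro convex_on_continuous convex_on_subset[OF conv]) auto
  then have "continuous_on {d..z} g" by (rule continuous_on_subset) (use d in auto)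
  from IVT'[of g d r z, OF \<open>g d \<le> r\<close> _ _ this] z d obtain R where R: "d \<le> R" "g R = r" by auto
  have "0 < R" using R d by simp
  have above: "r < g x" if "R < x" for x
  proof -
    have "r \<le> R / x * g x" using scale[of R x] that \<open>0 < R\<close> R(2) by simp
    then have "r * x \<le> R * g x" using that \<open>0 < R\<close> by (simp add: field_simps)
    moreover have "R * r < r * x" using that \<open>0 < r\<close> by (simp add: mult.commute)
    ultimately have "R * r < R * g x" by linarith
    then show ?thesis using \<open>0 < R\<close> by simp
  qed
  have below: "g x < r" if "0 \<le> x" "x < R" for x
  proof -
    have "g x \<le> x / R * r" using scale[OF that] R(2) by simp
    also have "\<dots> < 1 * r" using that \<open>0 < r\<close> by (intro mult_strict_right_mono) auto
    finally show ?thesis by simp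
  qed
  have "{x. 0 \<le> x \<and> g x = r} = {R}"
    using above below R(2) \<open>0 < R\<close> by (auto, metis less_irrefl linorder_neqE_linordered_idom)
  then have "right_inverse g r = R" by (simp add: right_inverse_def)
  then show "0 < right_inverse g r" "g (right_inverse g r) = r"
    "\<And>x. right_inverse g r < x \<Longrightarrow> r < g x" "\<And>x. 0 \<le> x \<Longrightarrow> x < right_inverse g r \<Longrightarrow> g x < r"
    using \<open>0 < R\<close> R(2) above below by auto
qed

section \<open>From the Levy measure to its density\<close>

lemma integral_density_on_half_line:
  assumes f: "(\<lambda>z. indicator {0<..} z * f z) \<in> borel_measurable borel" "\<And>z. 0 < z \<Longrightarrow> 0 \<le> f z"
    and \<nu>: "\<nu> = density lborel (\<lambda>z. ennreal (f z) * indicator {0<..} z)"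
    and g: "g \<in> borel_measurable borel" and S: "S \<in> sets borel" "S \<subseteq> {0<..}"
  shows "(LINT z:S|\<nu>. g z) = (LBINT z:S. g z * f z)"
proof -
  have "\<nu> = density lborel (\<lambda>z. ennreal (indicator {0<..} z * f z))"
    unfolding \<nu> by (intro arg_cong[where f="density lborel"] ext) (simp add: indicator_def)
  then have "(LINT z:S|\<nu>. g z) = (LINT z|lborel. (indicator {0<..} z * f z) *\<^sub>R (indicator S z *\<^sub>R g z))"
    unfolding set_lebesgue_integral_def
    using f g S(1) by (subst integral_density[symmetric]) (auto simp: indicator_def)
  also have "\<dots> = (LBINT z:S. g z * f z)"
    unfolding set_lebesgue_integral_def using S(2)
    by (intro Bochner_Integration.integral_cong) (auto simp: indicator_def)
  finally show ?thesis .
qed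

lemma levy_measure_density_integrable:
  assumes f: "(\<lambda>z. indicator {0<..} z * f z) \<in> borel_measurable borel" "\<And>z. 0 < z \<Longrightarrow> 0 \<le> f z"
    and \<nu>: "\<nu> = density lborel (\<lambda>z. ennreal (f z) * indicator {0<..} z)" and "levy_measure \<nu>"
  shows "set_integrable lborel {0<..} (\<lambda>z. min 1 (z\<^sup>2) * f z)"
proof -
  have dens: "(\<lambda>z. ennreal (f z) * indicator {0<..} z) = (\<lambda>z. ennreal (indicator {0<..} z * f z))"
    by (auto simp: indicator_def fun_eq_iff)
  have "(\<integral>\<^sup>+z. ennreal (indicator {0<..} z *\<^sub>R (min 1 (z\<^sup>2) * f z)) \<partial>lborel)
      = (\<integral>\<^sup>+z. ennreal (indicator {0<..} z * f z) * (ennreal (min 1 (z\<^sup>2)) * indicator {0<..} z) \<partial>lborel)"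
    using f(2) by (intro nn_integral_cong) (auto simp: indicator_def ennreal_mult' mult.commute)
  also have "\<dots> = (\<integral>\<^sup>+z\<in>{0<..}. ennreal (min 1 (z\<^sup>2)) \<partial>\<nu>)"
    unfolding \<nu> dens using f(1) by (subst nn_integral_density) auto
  also have "\<dots> < \<infinity>" using \<open>levy_measure \<nu>\<close> by (simp add: levy_measure_def)
  finally have fin: "(\<integral>\<^sup>+z. ennreal (indicator {0<..} z *\<^sub>R (min 1 (z\<^sup>2) * f z)) \<partial>lborel) < \<infinity>" .
  have "(\<lambda>z. min 1 (z\<^sup>2) * (indicator {0<..} z * f z)) \<in> borel_measurable borel"
    using f(1) by measurable
  then have "(\<lambda>z. indicator {0<..} z *\<^sub>R (min 1 (z\<^sup>2) * f z)) \<in> borel_measurable lborel"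
    by (simp add: mult.left_commute)
  then show ?thesis
    unfolding set_integrable_def
    by (rule integrableI_nonneg[OF _ _ fin]) (use f(2) in \<open>auto intro!: AE_I2 simp: indicator_def\<close>)
qed

theorem lemma3p2:
  fixes M :: "'a measure" and X :: "real \<Rightarrow> 'a \<Rightarrow> real"
    and \<gamma> \<sigma> p q K :: real and \<nu> :: "real measure"
    and \<psi> W h :: "real \<Rightarrow> real"
  assumes X: "spectrally_negative_levy_process M X"
    and triplet: "has_levy_triplet M X \<gamma> \<sigma> \<nu>"
    and psi_def: "\<psi> = laplace_exponent \<gamma> \<sigma> \<nu>"
    and psi_convex: "strictly_convex_on {0..} \<psi>"
    and psi_infinity: "filterlim \<psi> at_top at_top"
    and pos: "0 < p" "0 < q" "0 < K"
    and BV: "has_bounded_variation_paths M X \<Longrightarrow> K < bv_drift \<gamma> \<nu>"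
    and density: "has_completely_monotone_density \<nu>"
    and W: "is_scale_function \<psi> q W"
    and h_def: "h = h_fun \<psi> W K q p"
  shows "(\<forall>b\<ge>0. set_integrable lborel {0<..}
            (h_integrand \<psi> W q p (right_inverse (\<lambda>\<theta>. \<psi> \<theta> - K * \<theta>) q) b)) \<and>
         (\<forall>b\<ge>0. 0 \<le> h b) \<and>
         infinitely_differentiable_on {0<..} h \<and>
         strictly_convex_on {0<..} h \<and>
         filterlim h at_top at_top \<and>
         (\<exists>!b. is_arg_min h (\<lambda>b. 0 \<le> b) b)"
proof -
  interpret spectrally_negative_levy_process M X by (rule X)
  obtain f where cm: "completely_monotone_on {0<..} f"
    and \<nu>: "\<nu> = density lborel (\<lambda>z. ennreal (f z) * indicator {0<..} z)"
    using density unfolding has_completely_monotone_density_def by blast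
  have f_nonneg: "0 \<le> f z" if "0 < z" for z
    using completely_monotone_on_antimono(2)[OF cm that order_refl] .
  have f_meas: "(\<lambda>z. indicator {0<..} z * f z) \<in> borel_measurable borel"
  proof -
    have "continuous_on {0<..} f"
      using completely_monotone_on_isCont[OF cm] by (intro continuous_at_imp_continuous_on) auto
    from borel_measurable_continuous_on_indicator[OF _ this] show ?thesis by simp
  qed
  have f_int: "set_integrable lborel {0<..} (\<lambda>z. min 1 (z\<^sup>2) * f z)"
    using triplet by (intro levy_measure_density_integrable[OF f_meas f_nonneg \<nu>]) (auto simp: has_levy_triplet_def)
  have \<psi>_eq: "\<psi> = levy_exponent \<gamma> (\<sigma>\<^sup>2) f"
  proof
    fix \<theta>
    have "(LINT z:{0<..}|\<nu>. levy_kernel \<theta> z) = (LBINT z:{0<..}. levy_kernel \<theta> z * f z)"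
      by (rule integral_density_on_half_line[OF f_meas f_nonneg \<nu>]) auto
    then show "\<psi> \<theta> = levy_exponent \<gamma> (\<sigma>\<^sup>2) f \<theta>"
      by (simp add: psi_def laplace_exponent_def levy_exponent_def levy_kernel_def)
  qed
  have "\<psi> 0 = 0" by (simp add: \<psi>_eq)
  \<comment> \<open>Used with \<open>c = 0\<close> for \<open>\<psi>\<close> and with
    \<open>c = K\<close> for the exponent of the process with the drift \<open>K\<close>
    removed.\<close>
  have convex: "convex_on {0..} (\<lambda>\<theta>. \<psi> \<theta> - c * \<theta>)" for c
  proof (rule convex_onI)
    fix t x y :: real assume t: "0 < t" "t < 1" "x \<in> {0..}" "y \<in> {0..}"
    have "\<psi> ((1 - t) * x + t * y) \<le> (1 - t) * \<psi> x + t * \<psi> y"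
    proof (cases "x = y")
      case True
      then show ?thesis by (simp add: algebra_simps)
    next
      case False
      then show ?thesis
        using psi_convex t unfolding strictly_convex_on_def by (intro less_imp_le) auto
    qed
    then show "\<psi> ((1 - t) *\<^sub>R x + t *\<^sub>R y) - c * ((1 - t) *\<^sub>R x + t *\<^sub>R y)
        \<le> (1 - t) * (\<psi> x - c * x) + t * (\<psi> y - c * y)"
      by (simp add: algebra_simps)
  qed simp
  have \<psi>_large: "\<exists>z\<ge>0. r < \<psi> z" for r
  proof -
    have "eventually (\<lambda>z. r < \<psi> z) at_top"
      using psi_infinity unfolding filterlim_at_top_dense by blast
    then have "eventually (\<lambda>z. r < \<psi> z \<and> 0 \<le> z) at_top" by (intro eventually_conj eventually_ge_at_top)
    then show ?thesis using eventually_happens'[OF trivial_limit_at_top_linorder] by blast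
  qed

  define l where "l = right_inverse \<psi> q"
  define \<phi> where "\<phi> = right_inverse \<psi> (p + q)"
  define \<kappa> where "\<kappa> = right_inverse (\<lambda>\<theta>. \<psi> \<theta> - K * \<theta>) q"
  have convex_\<psi>: "convex_on {0..} \<psi>" using convex[of 0] by simp
  have l: "0 < l" "\<psi> l = q" "\<And>x. l < x \<Longrightarrow> q < \<psi> x" "\<And>x. 0 \<le> x \<Longrightarrow> x < l \<Longrightarrow> \<psi> x < q"
    using right_inverse_convex[OF convex_\<psi> \<open>\<psi> 0 = 0\<close> \<open>0 < q\<close>] \<psi>_large[of q] unfolding l_def by blast+
  have l_less: "l < x" if "0 \<le> x" "q < \<psi> x" for x
    using l(2) l(4)[of x] that by (cases x l rule: linorder_cases) auto
  have "0 < p + q" using pos by simp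
  then have \<phi>: "0 < \<phi>" "\<psi> \<phi> = p + q"
    using right_inverse_convex[OF convex_\<psi> \<open>\<psi> 0 = 0\<close>] \<psi>_large[of "p + q"] unfolding \<phi>_def by blast+
  then have "l < \<phi>" using pos by (intro l_less) auto
  \<comment> \<open>Otherwise \<open>\<psi>\<close> has linear growth, so there is no Gaussian part,
    the small jumps are summable and the drift is at most \<open>K\<close>. The paths then have
    bounded variation, which contradicts the assumption that in this case the drift exceeds
    \<open>K\<close>.\<close>
  have "\<exists>z>l. K * z + q < \<psi> z"
  proof (rule ccontr)
    assume "\<not> (\<exists>z>l. K * z + q < \<psi> z)"
    then have "levy_exponent \<gamma> (\<sigma>\<^sup>2) f \<theta> \<le> K * \<theta> + q" if "l < \<theta>" for \<theta>
      using that unfolding \<psi>_eq not_less[symmetric] by blast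
    from levy_exponent_linear_upper_bound[OF zero_le_power2 f_meas f_nonneg f_int this]
    have "\<sigma>\<^sup>2 = 0" and int1: "set_integrable lborel {0<..1} (\<lambda>z. z * f z)"
      and drift: "\<gamma> + (LBINT z:{0<..1}. z * f z) \<le> K" by auto
    define c where "c = \<gamma> + (LBINT z:{0<..1}. z * f z)"
    \<comment> \<open>The negated claim bounds \<open>\<psi>\<close> only beyond \<open>l\<close>
      and with the additive constant \<open>q\<close>. The path argument needs a bound without a
      constant for all \<open>\<theta> \<ge> 0\<close>, which the drift provides.\<close>
    have \<psi>_le: "\<psi> \<theta> \<le> c * \<theta>" if "0 \<le> \<theta>" for \<theta>
      using levy_exponent_le_drift[OF that f_meas f_nonneg f_int int1, of \<gamma>] \<open>\<sigma>\<^sup>2 = 0\<close>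
      by (simp add: \<psi>_eq c_def)
    have "AE \<omega> in M. \<forall>s\<ge>0. \<forall>t\<ge>s. X t \<omega> - X s \<omega> \<le> c * (t - s)"
    proof (rule linear_upper_bound_paths)
      fix t \<theta> :: real assume *: "0 \<le> t" "0 \<le> \<theta>"
      then show "integrable M (\<lambda>\<omega>. exp (\<theta> * X t \<omega>))"
        using triplet by (simp add: has_levy_triplet_def)
      have "expectation (\<lambda>\<omega>. exp (\<theta> * X t \<omega>)) = exp (t * \<psi> \<theta>)"
        using triplet * by (simp add: has_levy_triplet_def psi_def)
      also have "\<dots> \<le> exp (t * (c * \<theta>))" using * \<psi>_le by (simp add: mult_left_mono)
      finally show "expectation (\<lambda>\<omega>. exp (\<theta> * X t \<omega>)) \<le> exp (t * (c * \<theta>))" .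
    qed
    then have "has_bounded_variation_paths M X"
      unfolding has_bounded_variation_paths_def
      by (rule eventually_mono) (blast intro: bounded_variation_on_linear_upper_bound)
    then have "K < bv_drift \<gamma> \<nu>" by (rule BV)
    also have "bv_drift \<gamma> \<nu> = c"
      unfolding bv_drift_def c_def
      by (subst integral_density_on_half_line[OF f_meas f_nonneg \<nu>]) auto
    finally show False using drift by (simp add: c_def)
  qed
  then obtain z where z: "l < z" "q < \<psi> z - K * z" by (auto simp: algebra_simps)
  have \<kappa>: "0 < \<kappa>" "\<psi> \<kappa> - K * \<kappa> = q"
    using right_inverse_convex(1,2)[OF convex[of K] _ \<open>0 < q\<close> _ z(2)] z(1) l(1) \<open>\<psi> 0 = 0\<close>
    unfolding \<kappa>_def by auto
  \<comment> \<open>This is where \<open>K > 0\<close> enters: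
    \<open>\<psi> \<kappa> = q + K * \<kappa>\<close> exceeds \<open>q\<close>, which places
    \<open>\<kappa>\<close> to the right of \<open>l\<close>.\<close>
  have "q < \<psi> \<kappa>" using \<kappa> mult_pos_pos[OF \<open>0 < K\<close> \<kappa>(1)] by linarith
  then have "l < \<kappa>" using \<kappa>(1) by (intro l_less) auto

  \<comment> \<open>The normalization point \<open>l + 1\<close> is an arbitrary choice to the right
    of \<open>l\<close>.\<close>
  have "reciprocal_stieltjes l (l + 1) (diff_quotient \<psi> l)"
    unfolding \<psi>_eq
    by (rule reciprocal_stieltjes_completely_monotone[OF cm f_int])
       (use l \<open>0 < q\<close> in \<open>auto simp: \<psi>_eq[symmetric]\<close>)
  moreover have "0 < diff_quotient \<psi> l (l + 1)"
    using l(3)[of "l + 1"] l(2) by (simp add: diff_quotient_def)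
  ultimately obtain A \<mu> where A: "0 < A" and \<mu>: "finite_measure \<mu>" "sets \<mu> = sets borel" "AE t in \<mu>. 0 \<le> t"
    and rep: "\<And>x. l < x \<Longrightarrow> 1 / ((x - l) * diff_quotient \<psi> l x) = A / (x - l) - (LINT t|\<mu>. 1 / (x + t))"
    using l(1) by (elim reciprocal_stieltjes_representation) auto
  interpret \<mu>: exponential_mixture \<mu>
    using \<mu> by (simp add: exponential_mixture_def exponential_mixture_axioms_def)
  have W_cont: "continuous_on {0..} W"
    and W_int: "\<And>\<theta>. l < \<theta> \<Longrightarrow> set_integrable lborel {0..} (\<lambda>y. exp (- \<theta> * y) * W y)"
    and W_lap: "\<And>\<theta>. l < \<theta> \<Longrightarrow> (LBINT y:{0..}. exp (- \<theta> * y) * W y) = 1 / (\<psi> \<theta> - q)"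
    using W by (auto simp: is_scale_function_def l_def)
  \<comment> \<open>Since \<open>\<psi> l = q\<close>, the product of \<open>\<theta> - l\<close>
    and the difference quotient is \<open>\<psi> \<theta> - q\<close>.\<close>
  have lap: "(LBINT y:{0..}. exp (- \<theta> * y) * W y) = A / (\<theta> - l) - (LINT t|\<mu>. 1 / (\<theta> + t))" if "l < \<theta>" for \<theta>
    using W_lap[OF that] rep[OF that] that l(2) by (simp add: diff_quotient_def)
  have W_eq: "W x = A * exp (l * x) - \<mu>.mix (\<lambda>_. 1) x" if "0 < x" for x
    by (rule \<mu>.scale_function_eq[OF l(1) W_cont W_int lap that])
  have total: "(LBINT y:{0..}. exp (- \<phi> * y) * W y) = 1 / p"
    using W_lap[OF \<open>l < \<phi>\<close>] \<phi>(2) by simp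
  have Z: "Z_fun \<psi> W q p x = p * A / (\<phi> - l) * exp (l * x) - p * \<mu>.mix (\<lambda>t. 1 / (\<phi> + t)) x" if "0 < x" for x
    by (rule \<mu>.Z_fun_eq[OF l(1) \<open>l < \<phi>\<close> \<open>0 < p\<close> \<phi>_def W_eq W_int[OF \<open>l < \<phi>\<close>] total that])
  have Z': "deriv (Z_fun \<psi> W q p) x = p * A / (\<phi> - l) * l * exp (l * x) + p * \<mu>.mix (\<lambda>t. t / (\<phi> + t)) x" if "0 < x" for x
    by (rule \<mu>.deriv_Z_fun[OF \<phi>(1) Z that])
  note h_integral = \<mu>.h_integral[OF \<phi>(1) \<kappa>(1) \<open>l < \<kappa>\<close> Z']
  have h_int: "set_integrable lborel {0<..} (h_integrand \<psi> W q p \<kappa> b)" if "0 \<le> b" for b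
    by (rule h_integral(1)[OF _ that])
  have h_val: "(LBINT y:{0<..}. h_integrand \<psi> W q p \<kappa> b y) = p * A / (\<phi> - l) * l / (\<kappa> - l) * exp (l * b)
      + p * \<mu>.mix (\<lambda>t. t / (\<phi> + t) / (\<kappa> + t)) b" if "0 \<le> b" for b
    by (rule h_integral(2)[OF _ that])
  have w: "0 \<le> t / (\<phi> + t) / (\<kappa> + t) \<and> t / (\<phi> + t) / (\<kappa> + t) \<le> 1 / \<kappa>" if "0 \<le> t" for t
    using that \<phi>(1) \<kappa>(1) frac_le[of 1 "t / (\<phi> + t)" \<kappa> "\<kappa> + t"] by simp
  have h: "h b = \<kappa> * (p * A / (\<phi> - l) * l / (\<kappa> - l)) * exp (l * b)
      + \<kappa> * p * \<mu>.mix (\<lambda>t. t / (\<phi> + t) / (\<kappa> + t)) b" if "0 \<le> b" for b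
    using h_val[OF that] by (simp add: h_def h_fun_def Let_def \<kappa>_def[symmetric] distrib_left mult.assoc)
  have "(\<lambda>t. t / (\<phi> + t) / (\<kappa> + t)) \<in> borel_measurable borel" by measurable
  moreover have "0 < \<kappa> * (p * A / (\<phi> - l) * l / (\<kappa> - l))" "0 \<le> \<kappa> * p"
    using \<kappa>(1) \<open>l < \<kappa>\<close> \<open>l < \<phi>\<close> pos A l(1) by simp_all
  ultimately have "(\<forall>b\<ge>0. 0 \<le> h b) \<and> infinitely_differentiable_on {0<..} h \<and> strictly_convex_on {0<..} h \<and>
    filterlim h at_top at_top \<and> (\<exists>!b. is_arg_min h (\<lambda>b. 0 \<le> b) b)"
    by (intro \<mu>.exponential_plus_mix_properties[OF _ w _ l(1) _ h])
  with h_int show ?thesis unfolding \<kappa>_def by blast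
qed

end
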